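(* Let $G$ be a connected graph having at most bicyclic blocks, with distance matrix $D(G)$. If $G=K_1$ or some block of $G$ is an even cycle or a graph $\theta(l,p,q)$ with $\det D(\theta(l,p,q))=0$, then $\det D(G)=\operatorname{cof}D(G)=0$. Otherwise, if the blocks of $G$ are: - $m$ edge blocks, - $c$ odd cycles of lengths $l_1,l_2,\dots,l_c$, - $r$ graphs $\theta(1,p_1,q_1),\theta(1,p_2,q_2),\dots,\theta(1,p_r,q_r)$ for even integers $p_1,q_1,\dots,p_r,q_r$, - $s$ graphs $\theta(2,2,2)$, and - $t$ graphs $\theta(2,2,q'_1),\theta(2,2,q'_2),\dots,\theta(2,2,q'_t)$ for odd integers $q'_1,q'_2,\dots,q'_t>1$, then $$\det D(G)=\left(\frac{m}{2}+\sum_{h=1}^c\frac{l_h^2-1}{4l_h}+\sum_{i=1}^r\frac{p_i+q_i}{4}+s+\sum_{j=1}^t\frac{(q'_j)^2-5}{4q'_j-8}\right)\operatorname{cof}D(G),$$ where $$\operatorname{cof}D(G)=(-2)^m(-1)^r(-16)^s\left(\prod_{h=1}^c l_h\right)\left(\prod_{i=1}^r(p_i+q_i)\right)\prod_{j=1}^t(4q'_j-8).$$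
   Context: Graphs are finite and simple (no loops, no multiple edges). $K_1$ is the graph with a single vertex. For a connected graph $G$ with vertices $v_1,\dots,v_n$, the distance $d(v_i,v_j)$ is the number of edges of a shortest path from $v_i$ to $v_j$, and the distance matrix $D(G)$ is the $n\times n$ matrix with $(i,j)$-entry $d(v_i,v_j)$. For a square matrix $A$, $\operatorname{cof}(A)$ denotes the sum of the cofactors of $A$. A cut-vertex of a connected graph is a vertex whose removal disconnects the graph; a block of a graph $G$ is a maximal connected subgraph of $G$ having no cut-vertices (of its own). An edge block is a block consisting of a single edge with its two endpoints. A graph is at most bicyclic if it arises from a tree by the addition of at most two edges; $G$ has at most bicyclic blocks if each of its blocks is at most bicyclic. For integers $l\ge 1$ and $p,q\ge 2$, the $\theta$-graph $\theta(l,p,q)$ is obtained from three vertex-disjoint paths with $l$, $p$, $q$ edges respectively (with endpoints $v_1^l,v_2^l$; $v_1^p,v_2^p$; $v_1^q,v_2^q$) by identifying $v_1^l,v_1^p,v_1^q$ into one vertex and $v_2^l,v_2^p,v_2^q$ into one vertex; up to isomorphism the order of the parameters is immaterial. Empty sums are $0$ and empty products are $1$.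
   Formalization: The sum of cofactors of a matrix of order 1 is taken to be 0; with the usual convention (determinant of the empty matrix is 1) one has cof D(K_1) = 1, so the claim cof D(K_1) = 0 would fail. No other graph is affected. *)

theory Defs
  imports
    "Graph_Theory.Digraph_Isomorphism"
    "Jordan_Normal_Form.Determinant"
begin

text \<open>
  Finite simple graphs are represented by \<^locale>\<open>pair_graph\<close>: an undirected edge is a pair of
  opposite arcs. In this representation the library's \<^const>\<open>tree\<close> and \<^const>\<open>forest\<close> are
  not the undirected notions, since going back and forth along one edge counts as a cycle (of
  length 2); hence the restriction to cycles of length at least 3 below.
\<close>

definition undirected_tree :: "'a pair_pre_digraph \<Rightarrow> bool" where
  "undirected_tree T \<longleftrightarrow> pair_graph T \<and> connected (with_proj T) \<and>
     \<not> (\<exists>C. pre_digraph.cycle (with_proj T) C \<and> 3 \<le> length C)"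

definition undirected_edges :: "'a pair_pre_digraph \<Rightarrow> 'a set set" where
  "undirected_edges G = (\<lambda>(u, v). {u, v}) ` parcs G"

definition at_most_bicyclic :: "'a pair_pre_digraph \<Rightarrow> bool" where
  "at_most_bicyclic G \<longleftrightarrow> pair_graph G \<and>
     (\<exists>T. undirected_tree T \<and> spanning (with_proj T) (with_proj G) \<and>
        card (undirected_edges G - undirected_edges T) \<le> 2)"

text \<open>
  The library's \<^const>\<open>connected\<close> is false for the graph without vertices; the nonemptiness
  condition keeps the vertex of \<open>K\<^sub>1\<close> from being a cut-vertex.
\<close>

definition cut_vertex :: "('a, 'b) pre_digraph \<Rightarrow> 'a \<Rightarrow> bool" where
  "cut_vertex G v \<longleftrightarrow> v \<in> verts G \<and> verts G \<noteq> {v} \<and>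
     \<not> connected (pre_digraph.del_vert G v)"

definition blocks :: "'a pair_pre_digraph \<Rightarrow> 'a pair_pre_digraph set" where
  "blocks G = {B. pre_digraph.max_subgraph (with_proj G)
     (\<lambda>H. graph H \<and> connected H \<and> (\<nexists>v. cut_vertex H v)) (with_proj B)}"

definition graph_dist :: "'a pair_pre_digraph \<Rightarrow> 'a \<Rightarrow> 'a \<Rightarrow> nat" where
  "graph_dist G u v = (LEAST n. \<exists>P. pre_digraph.apath (with_proj G) u P v \<and> length P = n)"

definition vertex_enum :: "'a pair_pre_digraph \<Rightarrow> 'a list \<Rightarrow> bool" where
  "vertex_enum G vs \<longleftrightarrow> distinct vs \<and> set vs = pverts G"

definition distance_matrix :: "'a pair_pre_digraph \<Rightarrow> 'a list \<Rightarrow> real mat" where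
  "distance_matrix G vs =
     mat (length vs) (length vs) (\<lambda>(i, j). real (graph_dist G (vs ! i) (vs ! j)))"

text \<open>
  Convention: a matrix of order 1 has no cofactors (there is no minor of order 0), so its cofactor
  sum is the empty sum 0. With the other common convention, that the empty determinant is 1,
  one would get \<open>cof D(K\<^sub>1) = 1\<close>. The two conventions differ for no other matrix
  of positive order.
\<close>

definition cof :: "real mat \<Rightarrow> real" where
  "cof A = (if dim_row A \<le> 1 then 0 else (\<Sum>i<dim_row A. \<Sum>j<dim_col A. cofactor A i j))"

definition is_K1 :: "'a pair_pre_digraph \<Rightarrow> bool" where
  "is_K1 G \<longleftrightarrow> (\<exists>v. G = \<lparr>pverts = {v}, parcs = {}\<rparr>)"

definition is_edge :: "'a pair_pre_digraph \<Rightarrow> bool" where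
  "is_edge G \<longleftrightarrow> (\<exists>u v. u \<noteq> v \<and> G = \<lparr>pverts = {u, v}, parcs = {(u, v), (v, u)}\<rparr>)"

definition cycle_graph :: "nat \<Rightarrow> nat pair_pre_digraph" where
  "cycle_graph n =
     (let E = {(i, Suc i mod n) |i. i < n} in \<lparr>pverts = {..<n}, parcs = E \<union> E\<inverse>\<rparr>)"

definition is_cycle :: "nat \<Rightarrow> 'a pair_pre_digraph \<Rightarrow> bool" where
  "is_cycle n G \<longleftrightarrow> 3 \<le> n \<and> digraph_iso (with_proj G) (with_proj (cycle_graph n))"

text \<open>
  \<open>theta_point n k i\<close> is the image, under the identification of the endpoints, of the \<open>i\<close>-th
  vertex of the \<open>k\<close>-th path, which has \<open>n\<close> edges and vertices \<open>0, \<dots>, n\<close>.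
\<close>

datatype theta_vertex = Source | Sink | Inner nat nat

definition theta_point :: "nat \<Rightarrow> nat \<Rightarrow> nat \<Rightarrow> theta_vertex" where
  "theta_point n k i = (if i = 0 then Source else if i = n then Sink else Inner k i)"

definition theta_graph :: "nat \<Rightarrow> nat \<Rightarrow> nat \<Rightarrow> theta_vertex pair_pre_digraph" where
  "theta_graph l p q =
     (let len = (\<lambda>k. [l, p, q] ! k);
          E = {(theta_point (len k) k i, theta_point (len k) k (Suc i)) |k i. k < 3 \<and> i < len k}
      in \<lparr>pverts = {theta_point (len k) k i |k i. k < 3 \<and> i \<le> len k}, parcs = E \<union> E\<inverse>\<rparr>)"

definition is_theta :: "nat \<Rightarrow> nat \<Rightarrow> nat \<Rightarrow> 'a pair_pre_digraph \<Rightarrow> bool" where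
  "is_theta l p q G \<longleftrightarrow> 1 \<le> l \<and> 2 \<le> p \<and> 2 \<le> q \<and>
     digraph_iso (with_proj G) (with_proj (theta_graph l p q))"

definition is_singular_theta :: "'a pair_pre_digraph \<Rightarrow> bool" where
  "is_singular_theta G \<longleftrightarrow> (\<exists>l p q ws. is_theta l p q G \<and> vertex_enum (theta_graph l p q) ws \<and>
     det (distance_matrix (theta_graph l p q) ws) = 0)"

definition degenerate :: "'a pair_pre_digraph \<Rightarrow> bool" where
  "degenerate G \<longleftrightarrow> is_K1 G \<or>
     (\<exists>B\<in>blocks G. (\<exists>n. even n \<and> is_cycle n B) \<or> is_singular_theta B)"

text \<open>The list \<open>bs\<close> contains every block exactly once.\<close>

definition blocks_are ::
  "'a pair_pre_digraph \<Rightarrow> nat \<Rightarrow> nat \<Rightarrow> (nat \<Rightarrow> nat) \<Rightarrow> nat \<Rightarrow> (nat \<Rightarrow> nat) \<Rightarrow> (nat \<Rightarrow> nat) \<Rightarrow>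
    nat \<Rightarrow> nat \<Rightarrow> (nat \<Rightarrow> nat) \<Rightarrow> bool" where
  "blocks_are G m c l r p q s t q' \<longleftrightarrow>
     (\<forall>h\<in>{1..c}. odd (l h)) \<and>
     (\<forall>i\<in>{1..r}. even (p i) \<and> even (q i)) \<and>
     (\<forall>j\<in>{1..t}. odd (q' j) \<and> 1 < q' j) \<and>
     (\<exists>bs. distinct bs \<and> set bs = blocks G \<and>
       list_all2 (\<lambda>B is_kind. is_kind B) bs
        (replicate m is_edge @
         map (\<lambda>h. is_cycle (l h)) [1..<Suc c] @
         map (\<lambda>i. is_theta 1 (p i) (q i)) [1..<Suc r] @
         replicate s (is_theta 2 2 2) @
         map (\<lambda>j. is_theta 2 2 (q' j)) [1..<Suc t]))"

end

theory Submission
  imports Defs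
begin

text \<open>
  Let \<open>d\<close> be a matrix indexed by a finite set and \<open>J\<close> the all-ones matrix. Then
  \<open>det (d + t J) = det d + t cof d\<close>, so the cofactor sum is the coefficient of \<open>t\<close>. Fix a rooted
  tree on the index set and subtract from every row (and column) except the root's the one of its
  parent: the shift by \<open>t J\<close> then survives only in the corner of the root, and \<open>cof d\<close> is the
  determinant of the form \<open>d\<close> on the differences \<open>e\<^sub>u - e\<^sub>p\<close> of a vertex and its parent
  (\<open>idet_cof_eq_diff_form\<close>). The choice of the tree is free, and everything below rests on it.

  Reduction to blocks. If \<open>c\<close> is a cut-vertex, then \<open>d a b = d a c + d c b\<close> for \<open>a\<close> and \<open>b\<close> on
  different sides. With the star at \<open>c\<close> as tree, the two sides decouple: \<open>cof\<close> is multiplicative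
  and \<open>det\<close> behaves like a derivation (\<open>idet_glue\<close>). Induction over cut-vertices gives the theorem
  of Graham, Hoffman and Hosoya (\<open>dist_cof_det_blocks\<close>): \<open>cof D(G)\<close> is the product of the cofactor
  sums of the blocks, and, as long as none of these is zero, \<open>det D(G) / cof D(G)\<close> is the sum of
  the same ratios of the blocks. It remains to evaluate the blocks.

  Vanishing blocks. A nonzero vector with entry sum \<open>0\<close> in the kernel of \<open>D\<close> is in the kernel of
  all \<open>D + t J\<close>, so it kills both \<open>det\<close> and \<open>cof\<close>. In an even cycle, any two antipodal pairs of
  vertices have the same sum of distances to every vertex, and their difference is such a vector.
  In a \<open>\<theta>\<close>-graph, take two of the three paths whose lengths have the same parity, two vertices of
  the shorter one that lie symmetrically to its middle at distance \<open>1\<close> or \<open>2\<close>, and for each its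
  antipode in the even cycle formed by the two paths. If the distance of the two vertices is at
  most the distance of the end points, then again the two pairs have the same sum of distances to
  every vertex (\<open>theta_singular\<close>). Such a choice, with two different pairs, is possible in all
  \<open>\<theta>\<close>-graphs except \<open>\<theta>(1,p,q)\<close> with \<open>p\<close>, \<open>q\<close> even, \<open>\<theta>(2,2,2)\<close> and \<open>\<theta>(2,2,q)\<close> with \<open>q\<close> odd
  (\<open>theta_cases\<close>). These turn out to have a nonzero determinant, so \<open>det = 0\<close> forces \<open>cof = 0\<close> for
  every \<open>\<theta>\<close>-graph.

  Nonvanishing blocks. The distance function of an odd cycle bends only at its origin and at the
  opposite edge. Hence on the edges of a Hamiltonian path the form \<open>d\<close> has \<open>-2\<close> on the diagonal
  and \<open>1\<close> between an edge and the two edges at its opposite vertex; with this adjacency the edges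
  form a path, and \<open>n\<close> edges give the determinant \<open>(-1)\<^sup>n (n + 1)\<close> (\<open>idet_path\<close>). The same happens
  for \<open>\<theta>(1,p,q)\<close> along the even cycle of length \<open>p + q\<close>, while \<open>\<theta>(2,2,q)\<close> is an odd cycle with one
  vertex doubled. Finally, a vector \<open>x\<close> with \<open>D x\<close> constant determines the ratio of \<open>det\<close> and \<open>cof\<close>
  (\<open>idet_balanced_vector\<close>).
\<close>

section \<open>Determinants over a finite index set\<close>

definition list_matrix :: "'a list \<Rightarrow> ('a \<Rightarrow> 'a \<Rightarrow> real) \<Rightarrow> real mat" where
  "list_matrix vs f = mat (length vs) (length vs) (\<lambda>(i, j). f (vs ! i) (vs ! j))"

text \<open>
  The determinant of a square matrix does not depend on the order in which rows and columns are
  listed together. Indexing by a set instead of by positions keeps vertex orderings out of the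
  graph-theoretic arguments; \<open>idet_list\<close> shows that the ordering chosen here is immaterial.
\<close>

definition idet :: "'a set \<Rightarrow> ('a \<Rightarrow> 'a \<Rightarrow> real) \<Rightarrow> real" where
  "idet V f = det (list_matrix (SOME vs. distinct vs \<and> set vs = V) f)"

lemma list_matrix_carrier [simp]: "list_matrix vs f \<in> carrier_mat (length vs) (length vs)"
  by (simp add: list_matrix_def)

lemma list_matrix_dim [simp]:
  "dim_row (list_matrix vs f) = length vs" "dim_col (list_matrix vs f) = length vs"
  by (simp_all add: list_matrix_def)

lemma list_matrix_transpose: "transpose_mat (list_matrix vs f) = list_matrix vs (\<lambda>u v. f v u)"
  by (rule eq_matI) (auto simp: list_matrix_def)

lemma det_list_matrix_transpose: "det (list_matrix vs (\<lambda>u v. f v u)) = det (list_matrix vs f)"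
  by (metis det_transpose list_matrix_carrier list_matrix_transpose)

lemma det_list_matrix_reorder:
  assumes "distinct vs" "distinct ws" "set vs = set ws"
  shows "det (list_matrix ws f) = det (list_matrix vs f)"
proof -
  let ?n = "length vs"
  have "mset ws = mset vs"
    using assms by (metis set_eq_iff_mset_eq_distinct)
  then obtain p where p: "p permutes {..<?n}" "permute_list p vs = ws"
    by (rule mset_eq_permutation)
  have p': "p permutes {0..<?n}" using p(1) by (simp add: atLeast0LessThan)
  have len: "length ws = ?n" using p(2) by auto
  have nth: "ws ! i = vs ! p i" if "i < ?n" for i
    using p that by (metis permute_list_nth)
  have lt: "p i < ?n" if "i < ?n" for i
    using p(1) that by (metis lessThan_iff permutes_in_image)
  \<comment> \<open>Reordering permutes the rows and the columns alike, so the sign enters twice.\<close>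
  let ?B = "mat ?n ?n (\<lambda>(i, j). list_matrix vs f $$ (p i, j))"
  have B: "?B \<in> carrier_mat ?n ?n" by simp
  have "list_matrix ws f = transpose_mat (mat ?n ?n (\<lambda>(i, j). transpose_mat ?B $$ (p i, j)))"
    by (rule eq_matI) (auto simp: list_matrix_def len nth lt)
  also have "det \<dots> = det (mat ?n ?n (\<lambda>(i, j). transpose_mat ?B $$ (p i, j)))"
    by (rule det_transpose[where n = ?n]) simp
  also have "\<dots> = signof p * det (transpose_mat ?B)"
    by (rule det_permute_rows[OF _ p']) simp
  also have "det (transpose_mat ?B) = det ?B"
    by (rule det_transpose[OF B])
  also have "det ?B = signof p * det (list_matrix vs f)"
    by (rule det_permute_rows[OF _ p']) simp
  finally show ?thesis
    by (cases "sign p = (1::int)") (auto simp: sign_def split: if_splits)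
qed

lemma idet_list:
  assumes "distinct vs"
  shows "idet (set vs) f = det (list_matrix vs f)"
proof -
  have "\<exists>ws. distinct ws \<and> set ws = set vs" using assms by blast
  then have "distinct (SOME ws. distinct ws \<and> set ws = set vs) \<and>
      set (SOME ws. distinct ws \<and> set ws = set vs) = set vs"
    by (rule someI_ex)
  then show ?thesis
    unfolding idet_def using det_list_matrix_reorder[OF assms] by metis
qed

lemma idet_cong:
  assumes "finite V" "\<And>u v. u \<in> V \<Longrightarrow> v \<in> V \<Longrightarrow> f u v = g u v"
  shows "idet V f = idet V g"
proof -
  obtain vs where vs: "distinct vs" "set vs = V" using finite_distinct_list[OF assms(1)] by auto
  have "list_matrix vs f = list_matrix vs g"
    by (rule eq_matI) (use assms(2) vs in \<open>auto simp: list_matrix_def\<close>)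
  then show ?thesis using idet_list[OF vs(1)] vs(2) by metis
qed

lemma idet_transpose:
  assumes "finite V"
  shows "idet V (\<lambda>u v. f v u) = idet V f"
proof -
  obtain vs where vs: "distinct vs" "set vs = V" using finite_distinct_list[OF assms(1)] by auto
  then show ?thesis using idet_list[OF vs(1)] det_list_matrix_transpose by metis
qed

lemma idet_image:
  assumes "finite V" "inj_on \<phi> V"
  shows "idet (\<phi> ` V) f = idet V (\<lambda>u v. f (\<phi> u) (\<phi> v))"
proof -
  obtain vs where vs: "distinct vs" "set vs = V" using finite_distinct_list[OF assms(1)] by auto
  have "list_matrix (map \<phi> vs) f = list_matrix vs (\<lambda>u v. f (\<phi> u) (\<phi> v))"
    by (rule eq_matI) (auto simp: list_matrix_def)
  moreover have "distinct (map \<phi> vs)" using vs assms(2) by (simp add: distinct_map)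
  ultimately show ?thesis using idet_list[OF vs(1)] idet_list[of "map \<phi> vs"] vs(2)
    by (metis set_map)
qed

lemma idet_bij:
  assumes "finite V" "bij_betw \<phi> V W"
    and "\<And>u v. u \<in> V \<Longrightarrow> v \<in> V \<Longrightarrow> f u v = g (\<phi> u) (\<phi> v)"
  shows "idet V f = idet W g"
proof -
  have "idet W g = idet V (\<lambda>u v. g (\<phi> u) (\<phi> v))"
    using idet_image[OF assms(1)] assms(2) by (metis bij_betw_def)
  moreover have "idet V f = idet V (\<lambda>u v. g (\<phi> u) (\<phi> v))"
    by (rule idet_cong[OF assms(1) assms(3)])
  ultimately show ?thesis by simp
qed

lemma idet_empty [simp]: "idet {} f = 1"
  using idet_list[of "[]" f] by (simp add: list_matrix_def)

lemma idet_singleton [simp]: "idet {v} f = f v v"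
  using idet_list[of "[v]" f] det_single[of "list_matrix [v] f"] by (simp add: list_matrix_def)

lemma sum_set_nth:
  assumes "distinct vs"
  shows "(\<Sum>v\<in>set vs. h v) = (\<Sum>i<length vs. h (vs ! i))"
proof -
  have "bij_betw ((!) vs) {..<length vs} (set vs)" using assms by (simp add: bij_betw_nth)
  then show ?thesis by (simp add: sum.reindex_bij_betw)
qed

lemma idet_mult:
  assumes "finite V"
  shows "idet V (\<lambda>u v. \<Sum>w\<in>V. g u w * f w v) = idet V g * idet V f"
proof -
  obtain vs where vs: "distinct vs" "set vs = V" using finite_distinct_list[OF assms(1)] by auto
  have "list_matrix vs (\<lambda>u v. \<Sum>w\<in>V. g u w * f w v) = list_matrix vs g * list_matrix vs f"
    unfolding vs(2)[symmetric] sum_set_nth[OF vs(1)]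
    by (rule eq_matI) (simp_all add: list_matrix_def scalar_prod_def lessThan_atLeast0)
  then show ?thesis using det_mult[OF list_matrix_carrier list_matrix_carrier]
      idet_list[OF vs(1)] vs(2) by metis
qed

lemma idet_block_triangular:
  assumes "finite A" "finite B" "A \<inter> B = {}"
    and zero: "\<And>a b. a \<in> A \<Longrightarrow> b \<in> B \<Longrightarrow> f a b = 0"
  shows "idet (A \<union> B) f = idet A f * idet B f"
proof -
  obtain as where as: "distinct as" "set as = A" using finite_distinct_list[OF assms(1)] by auto
  obtain bs where bs: "distinct bs" "set bs = B" using finite_distinct_list[OF assms(2)] by auto
  let ?n = "length as" and ?m = "length bs"
  have "list_matrix (as @ bs) f = four_block_mat (list_matrix as f) (0\<^sub>m ?n ?m)
      (mat ?m ?n (\<lambda>(i, j). f (bs ! i) (as ! j))) (list_matrix bs f)"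
    by (rule eq_matI) (use zero as bs in \<open>auto simp: list_matrix_def nth_append\<close>)
  then have "det (list_matrix (as @ bs) f) = det (list_matrix as f) * det (list_matrix bs f)"
    by (simp add: det_four_block_mat_upper_right_zero[of _ ?n _ ?m])
  then show ?thesis
    using idet_list[OF as(1)] idet_list[OF bs(1)] idet_list[of "as @ bs"] as bs assms(3) by simp
qed

text \<open>
  The determinant is a linear function of row \<open>r\<close> whose coefficients depend only on the other rows,
  which agree with those of \<open>g\<close>. The coefficients are cofactors, but their values do not matter.
\<close>

lemma idet_row_expansion:
  assumes "finite V" "r \<in> V"
  obtains C where "\<And>f. (\<And>u v. u \<in> V - {r} \<Longrightarrow> v \<in> V \<Longrightarrow> f u v = g u v) \<Longrightarrow>
      idet V f = (\<Sum>v\<in>V. f r v * C v)"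
proof -
  obtain ws where ws: "distinct ws" "set ws = V - {r}"
    using finite_distinct_list[of "V - {r}"] assms(1) by auto
  let ?vs = "r # ws"
  have vs: "distinct ?vs" "set ?vs = V" using ws assms(2) by auto
  define ix where "ix = inv_into {..<length ?vs} ((!) ?vs)"
  have ix: "ix (?vs ! i) = i" if "i < length ?vs" for i
    unfolding ix_def using that inj_on_nth[OF vs(1), of "{..<length ?vs}"]
    by (intro inv_into_f_f) auto
  let ?C = "\<lambda>v. cofactor (list_matrix ?vs g) 0 (ix v)"
  show ?thesis
  proof (rule that[of ?C])
    fix f assume eq: "\<And>u v. u \<in> V - {r} \<Longrightarrow> v \<in> V \<Longrightarrow> f u v = g u v"
    have "mat_delete (list_matrix ?vs f) 0 j = mat_delete (list_matrix ?vs g) 0 j"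
      if "j < length ?vs" for j
    proof (rule eq_matI)
      fix i k assume "i < dim_row (mat_delete (list_matrix ?vs g) 0 j)"
        "k < dim_col (mat_delete (list_matrix ?vs g) 0 j)"
      then have ik: "i < length ws" "k < length ws" by auto
      define k' where "k' = (if k < j then k else Suc k)"
      have k': "k' < length ?vs" using ik by (auto simp: k'_def)
      then have "?vs ! k' \<in> V" using vs(2) nth_mem by metis
      moreover have "ws ! i \<in> V - {r}" using ik(1) ws(2) nth_mem by metis
      ultimately show "mat_delete (list_matrix ?vs f) 0 j $$ (i, k) =
          mat_delete (list_matrix ?vs g) 0 j $$ (i, k)"
        using eq ik k' by (simp add: mat_delete_def list_matrix_def flip: k'_def)
    qed auto
    then have "cofactor (list_matrix ?vs f) 0 j = cofactor (list_matrix ?vs g) 0 j"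
      if "j < length ?vs" for j using that by (simp add: cofactor_def)
    then have "det (list_matrix ?vs f) =
        (\<Sum>j<length ?vs. f r (?vs ! j) * cofactor (list_matrix ?vs g) 0 j)"
      by (subst laplace_expansion_row[of _ "length ?vs" 0]) (auto simp: list_matrix_def)
    also have "\<dots> = (\<Sum>v\<in>set ?vs. f r v * ?C v)"
      unfolding sum_set_nth[OF vs(1)] using ix by (intro sum.cong) auto
    finally show "idet V f = (\<Sum>v\<in>V. f r v * ?C v)"
      using idet_list[OF vs(1), of f] vs(2) by simp
  qed
qed

lemma idet_row_add:
  assumes "finite V" "r \<in> V"
    and "\<And>v. v \<in> V \<Longrightarrow> f r v = s * g r v + h r v"
    and "\<And>u v. u \<in> V - {r} \<Longrightarrow> v \<in> V \<Longrightarrow> g u v = f u v"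
    and "\<And>u v. u \<in> V - {r} \<Longrightarrow> v \<in> V \<Longrightarrow> h u v = f u v"
  shows "idet V f = s * idet V g + idet V h"
proof -
  obtain C where C: "\<And>f'. (\<And>u v. u \<in> V - {r} \<Longrightarrow> v \<in> V \<Longrightarrow> f' u v = f u v) \<Longrightarrow>
      idet V f' = (\<Sum>v\<in>V. f' r v * C v)"
    using idet_row_expansion[OF assms(1,2), of f] by blast
  have "idet V f = (\<Sum>v\<in>V. f r v * C v)" "idet V g = (\<Sum>v\<in>V. g r v * C v)"
    "idet V h = (\<Sum>v\<in>V. h r v * C v)"
    using C assms(4,5) by auto
  moreover have "(\<Sum>v\<in>V. f r v * C v) = (\<Sum>v\<in>V. s * (g r v * C v) + h r v * C v)"
    using assms(3) by (intro sum.cong) (simp_all add: algebra_simps)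
  ultimately show ?thesis by (simp add: sum.distrib sum_distrib_left)
qed

lemma idet_zero_row:
  assumes "finite V" "r \<in> V" "\<And>v. v \<in> V \<Longrightarrow> f r v = 0"
  shows "idet V f = 0"
proof -
  obtain C where "idet V f = (\<Sum>v\<in>V. f r v * C v)"
    using idet_row_expansion[OF assms(1,2), of f] by blast
  then show ?thesis using assms(3) by simp
qed

lemma idet_zero_col:
  assumes "finite V" "r \<in> V" "\<And>v. v \<in> V \<Longrightarrow> f v r = 0"
  shows "idet V f = 0"
  using idet_zero_row[OF assms(1,2), of "\<lambda>u v. f v u"] assms idet_transpose[OF assms(1)] by metis

lemma idet_kernel_vector:
  assumes "finite V" "\<And>u. u \<in> V \<Longrightarrow> (\<Sum>v\<in>V. f u v * x v) = 0"
    and "w \<in> V" "x w \<noteq> 0"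
  shows "idet V f = 0"
proof -
  obtain vs where vs: "distinct vs" "set vs = V" using finite_distinct_list[OF assms(1)] by auto
  let ?x = "vec (length vs) (\<lambda>i. x (vs ! i))"
  have "list_matrix vs f *\<^sub>v ?x = 0\<^sub>v (length vs)"
    using assms(2)[unfolded vs(2)[symmetric] sum_set_nth[OF vs(1)]]
    by (intro eq_vecI) (simp_all add: list_matrix_def scalar_prod_def lessThan_atLeast0)
  moreover obtain i where "i < length vs" "vs ! i = w"
    using assms(3) vs(2) by (metis in_set_conv_nth)
  then have "?x \<noteq> 0\<^sub>v (length vs)"
    using assms(4) by (metis index_vec index_zero_vec(1))
  ultimately have "det (list_matrix vs f) = 0"
    using det_0_iff_vec_prod_zero[OF list_matrix_carrier[of vs f]]
    by (metis vec_carrier)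
  then show ?thesis using idet_list[OF vs(1)] vs(2) by metis
qed

text \<open>
  Ordering the indices by \<open>rk\<close> makes the matrix triangular; the induction splits off an index of
  maximal rank, whose column is a unit vector.
\<close>

lemma idet_unitriangular:
  fixes rk :: "'a \<Rightarrow> nat"
  assumes "finite V" "\<And>u. u \<in> V \<Longrightarrow> g u u = 1"
    and "\<And>u w. u \<in> V \<Longrightarrow> w \<in> V \<Longrightarrow> u \<noteq> w \<Longrightarrow> rk u \<le> rk w \<Longrightarrow> g u w = 0"
  shows "idet V g = 1"
  using assms
proof (induction "card V" arbitrary: V)
  case 0
  then show ?case by simp
next
  case (Suc n)
  then have "V \<noteq> {}" by auto
  then have "Max (rk ` V) \<in> rk ` V" using Suc.prems(1) by (intro Max_in) auto
  then obtain u where u: "u \<in> V" "Max (rk ` V) = rk u" by blast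
  then have max: "rk w \<le> rk u" if "w \<in> V" for w
    using Max_ge[of "rk ` V" "rk w"] Suc.prems(1) that by simp
  have "idet ((V - {u}) \<union> {u}) g = idet (V - {u}) g * idet {u} g"
    by (rule idet_block_triangular) (use Suc.prems u(1) max in auto)
  moreover have "idet (V - {u}) g = 1"
    by (rule Suc.hyps(1)) (use Suc.prems Suc.hyps(2) u(1) in auto)
  moreover have "(V - {u}) \<union> {u} = V" using u(1) by auto
  ultimately show ?case using Suc.prems(2) u(1) by simp
qed

lemma idet_two:
  assumes "u \<noteq> v" "f u u = 0"
  shows "idet {u, v} f = - f u v * f v u"
proof -
  let ?A = "list_matrix [u, v] f"
  have "idet {u, v} f = det ?A"
    using idet_list[of "[u, v]" f] assms(1) by simp
  also have "\<dots> = (\<Sum>j<2. ?A $$ (0, j) * cofactor ?A 0 j)"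
    by (rule laplace_expansion_row) (simp_all add: list_matrix_def numeral_2_eq_2)
  also have "\<dots> = - f u v * det (mat_delete ?A 0 1)"
    using assms(2) by (simp add: numeral_2_eq_2 cofactor_def list_matrix_def)
  also have "det (mat_delete ?A 0 1) = f v u"
    by (subst det_single) (simp_all add: mat_delete_def list_matrix_def)
  finally show ?thesis .
qed

section \<open>Sums of cofactors\<close>

text \<open>
  For at least two indices this is the sum of the cofactors (\<open>cof_list_matrix\<close>); as a difference of two determinants it
  inherits the calculus of \<open>idet\<close>. A matrix of order \<open>1\<close> gets the value \<open>1\<close>, which is what makes the
  product formula for cut-vertices hold without exceptions.
\<close>

definition idet_cof :: "'a set \<Rightarrow> ('a \<Rightarrow> 'a \<Rightarrow> real) \<Rightarrow> real" where
  "idet_cof V d = idet V (\<lambda>u v. d u v + 1) - idet V d"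

lemma idet_cof_cong:
  assumes "finite V" "\<And>u v. u \<in> V \<Longrightarrow> v \<in> V \<Longrightarrow> f u v = g u v"
  shows "idet_cof V f = idet_cof V g"
  unfolding idet_cof_def using assms by (intro arg_cong2[where f = "(-)"] idet_cong) auto

lemma idet_cof_bij:
  assumes "finite V" "bij_betw \<phi> V W"
    and "\<And>u v. u \<in> V \<Longrightarrow> v \<in> V \<Longrightarrow> f u v = g (\<phi> u) (\<phi> v)"
  shows "idet_cof V f = idet_cof W g"
  unfolding idet_cof_def using assms
  by (intro arg_cong2[where f = "(-)"] idet_bij[where \<phi> = \<phi>]) auto

text \<open>
  The value of the bilinear form \<open>d\<close> at the differences \<open>e\<^sub>u - e\<^bsub>\<pi> u\<^esub>\<close> and \<open>e\<^sub>v - e\<^bsub>\<pi> v\<^esub>\<close>, where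
  \<open>\<pi>\<close> maps a vertex to its parent.
\<close>

definition diff_form :: "('a \<Rightarrow> 'a) \<Rightarrow> ('a \<Rightarrow> 'a \<Rightarrow> real) \<Rightarrow> 'a \<Rightarrow> 'a \<Rightarrow> real" where
  "diff_form \<pi> d u v = d u v - d (\<pi> u) v - d u (\<pi> v) + d (\<pi> u) (\<pi> v)"

text \<open>
  The matrix of the form \<open>d\<close> in the basis consisting of \<open>e\<^sub>c\<close> for the root \<open>c\<close> and of the
  differences for all other vertices.
\<close>

definition bordered_form :: "'a \<Rightarrow> ('a \<Rightarrow> 'a) \<Rightarrow> ('a \<Rightarrow> 'a \<Rightarrow> real) \<Rightarrow> 'a \<Rightarrow> 'a \<Rightarrow> real" where
  "bordered_form c \<pi> d u v =
    (if u = c then if v = c then d c c else d c v - d c (\<pi> v)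
     else if v = c then d u c - d (\<pi> u) c else diff_form \<pi> d u v)"

text \<open>
  The operation is multiplication by a matrix that is unitriangular with respect to the rank,
  because every parent has smaller rank.
\<close>

lemma idet_subtract_parent_rows:
  fixes rk :: "'a \<Rightarrow> nat"
  assumes "finite V" "c \<in> V"
    and parent: "\<And>u. u \<in> V - {c} \<Longrightarrow> \<pi> u \<in> V \<and> rk (\<pi> u) < rk u"
  shows "idet V (\<lambda>u v. if u = c then f c v else f u v - k u * f (\<pi> u) v) = idet V f"
proof -
  let ?g = "\<lambda>u w. if u = w then 1 else if u \<noteq> c \<and> w = \<pi> u then - k u else (0::real)"
  have "(\<Sum>w\<in>V. ?g u w * f w v) = (if u = c then f c v else f u v - k u * f (\<pi> u) v)"
    if "u \<in> V" for u v
  proof (cases "u = c")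
    case True
    then have "(\<Sum>w\<in>V. ?g u w * f w v) = (\<Sum>w\<in>V. if w = c then f c v else 0)"
      by (intro sum.cong) auto
    then show ?thesis using True assms(1,2) by simp
  next
    case False
    then have p: "\<pi> u \<in> V" "\<pi> u \<noteq> u" using parent[of u] that by auto
    have "(\<Sum>w\<in>V. ?g u w * f w v) =
        (\<Sum>w\<in>V. (if w = u then f u v else 0) - (if w = \<pi> u then k u * f (\<pi> u) v else 0))"
      using p False by (intro sum.cong) auto
    also have "\<dots> = f u v - k u * f (\<pi> u) v"
      using assms(1) that p by (simp add: sum_subtractf)
    finally show ?thesis using False by simp
  qed
  then have "idet V (\<lambda>u v. if u = c then f c v else f u v - k u * f (\<pi> u) v) =
      idet V (\<lambda>u v. \<Sum>w\<in>V. ?g u w * f w v)"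
    by (intro idet_cong assms(1)) auto
  also have "\<dots> = idet V ?g * idet V f" by (rule idet_mult[OF assms(1)])
  also have "idet V ?g = 1"
  proof (rule idet_unitriangular[OF assms(1), of _ rk])
    fix u w assume "u \<in> V" "w \<in> V" "u \<noteq> w" "rk u \<le> rk w"
    then show "?g u w = 0" using parent[of u] by auto
  qed simp
  finally show ?thesis by simp
qed

lemma idet_bordered_form:
  fixes rk :: "'a \<Rightarrow> nat"
  assumes "finite V" "c \<in> V"
    and parent: "\<And>u. u \<in> V - {c} \<Longrightarrow> \<pi> u \<in> V \<and> rk (\<pi> u) < rk u"
  shows "idet V (bordered_form c \<pi> d) = idet V d"
proof -
  let ?r = "\<lambda>u v. if u = c then d c v else d u v - d (\<pi> u) v"
  have "idet V d = idet V ?r"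
    using idet_subtract_parent_rows[OF assms, of d "\<lambda>_. 1"] by (simp only: mult_1)
  also have "\<dots> = idet V (\<lambda>u v. ?r v u)"
    by (rule idet_transpose[symmetric, OF assms(1)])
  also have "\<dots> = idet V (\<lambda>u v. if u = c then ?r v c else ?r v u - ?r v (\<pi> u))"
    using idet_subtract_parent_rows[OF assms, of "\<lambda>u v. ?r v u" "\<lambda>_. 1"] by (simp only: mult_1)
  also have "\<dots> = idet V (\<lambda>u v. bordered_form c \<pi> d v u)"
    by (rule idet_cong[OF assms(1)]) (auto simp: bordered_form_def diff_form_def)
  also have "\<dots> = idet V (bordered_form c \<pi> d)"
    by (rule idet_transpose[OF assms(1)])
  finally show ?thesis by simp
qed

text \<open>
  Adding \<open>t\<close> to all entries does not change differences, so in the bordered form only the corner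
  entry at the root changes; expand along the root's row.
\<close>

lemma idet_add_const:
  fixes rk :: "'a \<Rightarrow> nat"
  assumes "finite V" "c \<in> V"
    and parent: "\<And>u. u \<in> V - {c} \<Longrightarrow> \<pi> u \<in> V \<and> rk (\<pi> u) < rk u"
  shows "idet V (\<lambda>u v. d u v + t) = t * idet (V - {c}) (diff_form \<pi> d) + idet V d"
proof -
  let ?d = "\<lambda>u v. d u v + t"
  let ?e = "\<lambda>u v. if u = c then if v = c then 1 else 0 else bordered_form c \<pi> d u v"
  have "idet V ?d = idet V (bordered_form c \<pi> ?d)"
    by (rule idet_bordered_form[symmetric, OF assms])
  also have "\<dots> = t * idet V ?e + idet V (bordered_form c \<pi> d)"
    by (rule idet_row_add[OF assms(1,2)]) (auto simp: bordered_form_def diff_form_def)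
  also have "idet V (bordered_form c \<pi> d) = idet V d"
    by (rule idet_bordered_form[OF assms])
  also have "idet V ?e = idet (V - {c}) (diff_form \<pi> d)"
  proof -
    have "idet ({c} \<union> (V - {c})) ?e = idet {c} ?e * idet (V - {c}) ?e"
      by (rule idet_block_triangular) (use assms(1) in auto)
    moreover have "{c} \<union> (V - {c}) = V" using assms(2) by auto
    moreover have "idet (V - {c}) ?e = idet (V - {c}) (diff_form \<pi> d)"
      by (rule idet_cong) (use assms(1) in \<open>auto simp: bordered_form_def\<close>)
    ultimately show ?thesis by simp
  qed
  finally show ?thesis .
qed

lemma idet_cof_eq_diff_form:
  fixes rk :: "'a \<Rightarrow> nat"
  assumes "finite V" "c \<in> V"
    and parent: "\<And>u. u \<in> V - {c} \<Longrightarrow> \<pi> u \<in> V \<and> rk (\<pi> u) < rk u"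
  shows "idet_cof V d = idet (V - {c}) (diff_form \<pi> d)"
  using idet_add_const[OF assms, of d 1] by (simp add: idet_cof_def)

text \<open>
  The identity \<open>det (d + t J) = det d + t cof d\<close>, obtained from the star with an arbitrary root.
\<close>

lemma idet_add_const_cof:
  assumes "finite V" "V \<noteq> {}"
  shows "idet V (\<lambda>u v. d u v + t) = idet V d + t * idet_cof V d"
proof -
  obtain c where c: "c \<in> V" using assms(2) by auto
  have *: "u \<in> V - {c} \<Longrightarrow> c \<in> V \<and> (if c = c then 0 else 1) < (if u = c then 0 else (1::nat))" for u
    using c by auto
  show ?thesis
    using idet_add_const[OF assms(1) c, of "\<lambda>_. c" "\<lambda>u. if u = c then 0 else 1" d t]
      idet_cof_eq_diff_form[OF assms(1) c, of "\<lambda>_. c" "\<lambda>u. if u = c then 0 else 1" d] c by simp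
qed

text \<open>
  Adding \<open>1\<close> to the rows one after the other telescopes. In each step, row \<open>r\<close> contributes the
  determinant with row \<open>r\<close> replaced by ones; in it, the ones already added to the other rows can be
  removed by subtracting row \<open>r\<close>.
\<close>

lemma sum_idet_ones_row:
  assumes "finite V"
  shows "(\<Sum>r\<in>V. idet V (\<lambda>u v. if u = r then 1 else d u v)) = idet_cof V d"
proof -
  have "idet V (\<lambda>u v. d u v + (if u \<in> S then 1 else 0)) =
      idet V d + (\<Sum>r\<in>S. idet V (\<lambda>u v. if u = r then 1 else d u v))" if "S \<subseteq> V" for S
    using finite_subset[OF that assms] that
  proof (induction S rule: finite_induct)
    case empty
    then show ?case by simp
  next
    case (insert r S)
    let ?d = "\<lambda>u v. d u v + (if u \<in> S then 1 else 0)"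
    let ?e = "\<lambda>u v. if u = r then 1 else d u v"
    have r: "r \<in> V" using insert.prems by simp
    have "idet V (\<lambda>u v. d u v + (if u \<in> insert r S then 1 else 0)) =
        1 * idet V (\<lambda>u v. if u = r then 1 else ?d u v) + idet V ?d"
      by (rule idet_row_add[OF assms r]) (use insert.hyps in auto)
    moreover have "idet V (\<lambda>u v. if u = r then 1 else ?d u v) = idet V ?e"
    proof -
      have "idet V ?e = idet V (\<lambda>u v. if u = r then ?e r v
          else ?e u v - (if u \<in> S then -1 else 0) * ?e r v)"
        by (rule idet_subtract_parent_rows[symmetric, of _ _ _ "\<lambda>u. if u = r then 0 else 1"])
          (use assms r in auto)
      also have "\<dots> = idet V (\<lambda>u v. if u = r then 1 else ?d u v)"
        by (rule idet_cong[OF assms]) auto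
      finally show ?thesis by simp
    qed
    ultimately show ?case using insert by simp
  qed
  from this[of V] have "idet V (\<lambda>u v. d u v + (if u \<in> V then 1 else 0)) =
      idet V d + (\<Sum>r\<in>V. idet V (\<lambda>u v. if u = r then 1 else d u v))" by simp
  moreover have "idet V (\<lambda>u v. d u v + (if u \<in> V then 1 else 0)) = idet V (\<lambda>u v. d u v + 1)"
    by (rule idet_cong[OF assms]) simp
  ultimately show ?thesis by (simp add: idet_cof_def)
qed

lemma cof_list_matrix:
  assumes "distinct vs" "2 \<le> length vs"
  shows "cof (list_matrix vs d) = idet_cof (set vs) d"
proof -
  let ?n = "length vs" and ?A = "list_matrix vs d"
  have "(\<Sum>j<?n. cofactor ?A i j) = idet (set vs) (\<lambda>u v. if u = vs ! i then 1 else d u v)"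
    if i: "i < ?n" for i
  proof -
    let ?B = "list_matrix vs (\<lambda>u v. if u = vs ! i then 1 else d u v)"
    have "mat_delete ?B i j = mat_delete ?A i j" for j
      using i nth_eq_iff_index_eq[OF assms(1)]
      by (intro eq_matI) (auto simp: mat_delete_def list_matrix_def)
    then have "cofactor ?B i j = cofactor ?A i j" for j by (simp add: cofactor_def)
    moreover have "det ?B = (\<Sum>j<?n. ?B $$ (i, j) * cofactor ?B i j)"
      by (rule laplace_expansion_row) (use i in auto)
    moreover have "?B $$ (i, j) = 1" if "j < ?n" for j
      using i that by (simp add: list_matrix_def)
    ultimately show ?thesis using idet_list[OF assms(1)] by simp
  qed
  then have "cof ?A = (\<Sum>i<?n. idet (set vs) (\<lambda>u v. if u = vs ! i then 1 else d u v))"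
    using assms(2) by (simp add: cof_def)
  also have "\<dots> = (\<Sum>r\<in>set vs. idet (set vs) (\<lambda>u v. if u = r then 1 else d u v))"
    by (rule sum_set_nth[OF assms(1), symmetric])
  also have "\<dots> = idet_cof (set vs) d" by (rule sum_idet_ones_row) simp
  finally show ?thesis .
qed

lemma idet_kernel_vector_sum_zero:
  assumes "finite V" "\<And>u. u \<in> V \<Longrightarrow> (\<Sum>v\<in>V. d u v * x v) = 0" "(\<Sum>v\<in>V. x v) = 0"
    and "w \<in> V" "x w \<noteq> 0"
  shows "idet V d = 0" "idet_cof V d = 0"
proof -
  have "idet V (\<lambda>u v. d u v + t) = 0" for t
  proof (rule idet_kernel_vector[where x = x and w = w])
    fix u assume "u \<in> V"
    then show "(\<Sum>v\<in>V. (d u v + t) * x v) = 0"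
      using assms(2)[of u] assms(3) by (simp add: distrib_right sum.distrib flip: sum_distrib_left)
  qed (use assms in auto)
  from this[of 0] this[of 1] show "idet V d = 0" "idet_cof V d = 0"
    by (simp_all add: idet_cof_def)
qed

text \<open>
  If \<open>d x\<close> is constantly \<open>l\<close> and \<open>x\<close> has entry sum \<open>m\<close>, then \<open>x\<close> is in the kernel of \<open>d + t J\<close> for
  \<open>t = - l / m\<close>, and \<open>det d + t cof d = 0\<close> is the claim.
\<close>

lemma idet_balanced_vector:
  assumes "finite V" "\<And>u. u \<in> V \<Longrightarrow> (\<Sum>v\<in>V. d u v * x v) = l" "(\<Sum>v\<in>V. x v) = m" "m \<noteq> 0"
  shows "idet V d = l / m * idet_cof V d"
proof -
  obtain w where w: "w \<in> V" "x w \<noteq> 0" using assms(3,4) by (metis sum.neutral)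
  have "idet V (\<lambda>u v. d u v + (- l / m)) = 0"
  proof (rule idet_kernel_vector[where x = x and w = w])
    fix u assume "u \<in> V"
    have "(\<Sum>v\<in>V. (d u v + (- l / m)) * x v) = (\<Sum>v\<in>V. d u v * x v) + (\<Sum>v\<in>V. (- l / m) * x v)"
      by (simp only: distrib_right sum.distrib)
    also have "(\<Sum>v\<in>V. (- l / m) * x v) = (- l / m) * m"
      by (simp only: sum_distrib_left[symmetric] assms(3))
    finally show "(\<Sum>v\<in>V. (d u v + (- l / m)) * x v) = 0"
      using assms(2)[OF \<open>u \<in> V\<close>] assms(4) by simp
  qed (use assms w in auto)
  moreover have "V \<noteq> {}" using w by auto
  ultimately show ?thesis using idet_add_const_cof[OF assms(1), of d "- l / m"] by simp
qed

text \<open>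
  Subtract row and column \<open>c\<close> from all others. The additivity across \<open>c\<close> makes the blocks between
  \<open>A\<close> and \<open>B\<close> vanish, so the two sides interact only through the row and column of \<open>c\<close>, and the
  determinant is the sum of the contributions of the two halves of row \<open>c\<close>.
\<close>

lemma idet_glue:
  assumes fin: "finite A" "finite B" and disj: "A \<inter> B = {}" "c \<notin> A" "c \<notin> B"
    and zero: "d c c = 0"
    and cut: "\<And>a b. a \<in> A \<Longrightarrow> b \<in> B \<Longrightarrow> d a b = d a c + d c b \<and> d b a = d b c + d c a"
  shows "idet_cof (insert c (A \<union> B)) d = idet_cof (insert c A) d * idet_cof (insert c B) d"
      (is ?cof)
    and "idet (insert c (A \<union> B)) d =
      idet (insert c A) d * idet_cof (insert c B) d + idet (insert c B) d * idet_cof (insert c A) d"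
      (is ?det)
proof -
  let ?\<pi> = "\<lambda>_. c" and ?rk = "\<lambda>u. if u = c then 0 else (1::nat)"
  let ?M = "diff_form ?\<pi> d" and ?F = "bordered_form c ?\<pi> d"
  have cof: "idet_cof (insert c S) d = idet S ?M" if "finite S" "c \<notin> S" for S
  proof -
    have "idet_cof (insert c S) d = idet (insert c S - {c}) ?M"
      by (rule idet_cof_eq_diff_form[of _ _ _ ?rk]) (use that in auto)
    then show ?thesis using that by simp
  qed
  have det: "idet (insert c S) d = idet (insert c S) ?F" if "finite S" for S
    by (rule idet_bordered_form[symmetric, of _ _ _ ?rk]) (use that in auto)
  have M0: "?M a b = 0" "?M b a = 0" if "a \<in> A" "b \<in> B" for a b
    using cut[OF that] zero by (auto simp: diff_form_def)
  have MF: "?F a b = ?M a b" if "a \<in> A \<union> B" "b \<in> A \<union> B" for a b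
    using that disj by (auto simp: bordered_form_def)
  have "idet (A \<union> B) ?M = idet A ?M * idet B ?M"
    by (rule idet_block_triangular) (use fin disj M0 in auto)
  then show ?cof
    using cof fin disj by simp
  \<comment> \<open>Row \<open>c\<close> is split into its entries outside \<open>B\<close> and those in \<open>B\<close>; the corner entry is \<open>0\<close>,
       so it does not matter to which part it goes.\<close>
  let ?g = "\<lambda>u v. if u = c \<and> v \<in> B then 0 else ?F u v"
  let ?h = "\<lambda>u v. if u = c \<and> v \<notin> B then 0 else ?F u v"
  have "idet (insert c (A \<union> B)) ?F = 1 * idet (insert c (A \<union> B)) ?g + idet (insert c (A \<union> B)) ?h"
    by (rule idet_row_add) (use fin in auto)
  also have "idet (insert c (A \<union> B)) ?g = idet (insert c A \<union> B) ?g" by simp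
  also have "\<dots> = idet (insert c A) ?g * idet B ?g"
    by (rule idet_block_triangular) (use fin disj M0 MF in auto)
  also have "idet (insert c (A \<union> B)) ?h = idet (insert c B \<union> A) ?h" by (simp add: Un_commute)
  also have "\<dots> = idet (insert c B) ?h * idet A ?h"
    by (rule idet_block_triangular) (use fin disj M0 MF in auto)
  also have "idet (insert c A) ?g = idet (insert c A) ?F"
    by (rule idet_cong) (use fin disj in auto)
  also have "idet (insert c B) ?h = idet (insert c B) ?F"
    by (rule idet_cong) (use fin disj zero in \<open>auto simp: bordered_form_def\<close>)
  also have "idet B ?g = idet B ?M"
    by (rule idet_cong) (use fin disj MF in auto)
  also have "idet A ?h = idet A ?M"
    by (rule idet_cong) (use fin disj MF in auto)
  finally show ?det
    using det cof fin disj by simp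
qed

text \<open>
  The pendant-vertex recursion for determinants, seeing the matrix as a weighted graph in which
  \<open>u\<close> is the only neighbour of \<open>v\<close>.
\<close>

lemma idet_leaf:
  assumes "finite V" "v \<in> V" "u \<in> V" "v \<noteq> u"
    and leaf: "\<And>x. x \<in> V - {u, v} \<Longrightarrow> f v x = 0 \<and> f x v = 0"
  shows "idet V f = f v v * idet (V - {v}) f - f v u * f u v * idet (V - {v, u}) f"
proof -
  let ?g = "\<lambda>a b. if a = v then if b = v then 1 else 0 else f a b"
  let ?h = "\<lambda>a b. if a = v \<and> b = v then 0 else f a b"
  have "idet V f = f v v * idet V ?g + idet V ?h"
    by (rule idet_row_add[where r = v]) (use assms in auto)
  moreover have "idet V ?g = idet (V - {v}) f"
  proof -
    have "idet ({v} \<union> (V - {v})) ?g = idet {v} ?g * idet (V - {v}) ?g"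
      by (rule idet_block_triangular) (use assms in auto)
    moreover have "{v} \<union> (V - {v}) = V" using assms by auto
    moreover have "idet (V - {v}) ?g = idet (V - {v}) f"
      by (rule idet_cong) (use assms in auto)
    ultimately show ?thesis by simp
  qed
  moreover have "idet V ?h = - f v u * f u v * idet (V - {v, u}) f"
  proof -
    let ?p = "\<lambda>a b. if a = u then if b = v then 1 else 0 else ?h a b"
    let ?q = "\<lambda>a b. if a = u \<and> b = v then 0 else ?h a b"
    have "idet V ?h = f u v * idet V ?p + idet V ?q"
      by (rule idet_row_add[where r = u]) (use assms in auto)
    moreover have "idet V ?q = 0"
      by (rule idet_zero_col[where r = v]) (use assms in auto)
    moreover have "idet V ?p = idet {v, u} ?p * idet (V - {v, u}) ?p"
    proof -
      have "idet ({v, u} \<union> (V - {v, u})) ?p = idet {v, u} ?p * idet (V - {v, u}) ?p"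
        by (rule idet_block_triangular) (use assms in auto)
      moreover have "{v, u} \<union> (V - {v, u}) = V" using assms by auto
      ultimately show ?thesis by simp
    qed
    moreover have "idet {v, u} ?p = - f v u"
      using idet_two[of v u ?p] assms(4) by simp
    moreover have "idet (V - {v, u}) ?p = idet (V - {v, u}) f"
      by (rule idet_cong) (use assms in auto)
    ultimately show ?thesis by simp
  qed
  ultimately show ?thesis by simp
qed

lemma idet_path_nat:
  assumes "\<And>i j. i < n \<Longrightarrow> j < n \<Longrightarrow> f i j =
      (if i = j then -2 else if i = Suc j \<or> j = Suc i then 1 else 0)"
  shows "idet {..<n} f = (-1) ^ n * (real n + 1)"
  using assms
proof (induction n rule: less_induct)
  case (less n)
  consider "n = 0" | "n = 1" | k where "n = Suc (Suc k)"
    by (metis One_nat_def old.nat.exhaust)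
  then show ?case
  proof cases
    case 1
    then show ?thesis by simp
  next
    case 2
    then have "{..<n} = {0}" by auto
    then show ?thesis using less.prems[of 0 0] 2 by simp
  next
    case (3 k)
    have "idet {..<n} f = f (Suc k) (Suc k) * idet ({..<n} - {Suc k}) f
        - f (Suc k) k * f k (Suc k) * idet ({..<n} - {Suc k, k}) f"
      by (rule idet_leaf) (use 3 less.prems in auto)
    moreover have "{..<n} - {Suc k} = {..<Suc k}" "{..<n} - {Suc k, k} = {..<k}" using 3 by auto
    moreover have "idet {..<Suc k} f = (-1) ^ Suc k * (real (Suc k) + 1)"
      by (rule less.IH) (use 3 less.prems in auto)
    moreover have "idet {..<k} f = (-1) ^ k * (real k + 1)"
      by (rule less.IH) (use 3 less.prems in auto)
    ultimately show ?thesis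
      using less.prems[of "Suc k" "Suc k"] less.prems[of "Suc k" k] less.prems[of k "Suc k"] 3
      by (simp add: algebra_simps)
  qed
qed

text \<open>
  The adjacency makes the index set a path, on which \<open>pos\<close> gives the places. Explicit places are
  needed because edges that are consecutive here are nearly opposite in the cycle they come from.
\<close>

lemma idet_path:
  fixes pos :: "'a \<Rightarrow> int"
  assumes "finite W" "card W = n" "inj_on pos W"
    and range: "\<And>u. u \<in> W \<Longrightarrow> 0 \<le> pos u \<and> pos u < int n"
    and "\<And>u v. u \<in> W \<Longrightarrow> v \<in> W \<Longrightarrow>
      f u v = (if u = v then -2 else if \<bar>pos u - pos v\<bar> = 1 then 1 else 0)"
  shows "idet W f = (-1) ^ n * (real n + 1)"
proof -
  let ?p = "\<lambda>u. nat (pos u)"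
  let ?g = "\<lambda>i j. if i = j then -2 else if i = Suc j \<or> j = Suc i then 1 else (0::real)"
  have inj: "inj_on ?p W"
    using assms(3) range by (auto simp: inj_on_def eq_nat_nat_iff)
  have "?p u < n" if "u \<in> W" for u using range[OF that] by linarith
  then have "?p ` W = {..<n}"
    by (intro card_subset_eq) (use assms(2) inj in \<open>auto simp: card_image\<close>)
  then have "bij_betw ?p W {..<n}" using inj by (simp add: bij_betw_def)
  moreover have "f u v = ?g (?p u) (?p v)" if "u \<in> W" "v \<in> W" for u v
  proof -
    have "?p u = ?p v \<longleftrightarrow> u = v" using inj that by (auto dest: inj_onD)
    moreover have "?p u = Suc (?p v) \<or> ?p v = Suc (?p u) \<longleftrightarrow> \<bar>pos u - pos v\<bar> = 1"
      using range[OF that(1)] range[OF that(2)] by auto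
    ultimately show ?thesis using assms(5)[OF that] by simp
  qed
  ultimately have "idet W f = idet {..<n} ?g"
    by (intro idet_bij[OF assms(1)]) auto
  then show ?thesis using idet_path_nat[of n ?g] by simp
qed

section \<open>Graphs, blocks and distances\<close>

lemma pair_graph_iff:
  "pair_graph G \<longleftrightarrow> finite (pverts G) \<and> parcs G \<subseteq> pverts G \<times> pverts G \<and>
     sym (parcs G) \<and> irrefl (parcs G)" (is "?L \<longleftrightarrow> ?R")
proof
  assume ?L
  then interpret pair_graph G .
  have "(a, a) \<notin> parcs G" for a using no_loops' by blast
  then show ?R
    using pair_finite_verts in_arcsD1 in_arcsD2 pair_sym_arcs
    by (auto simp: symmetric_def irrefl_def)
next
  assume R: ?R
  then have "finite (parcs G)" by (meson finite_SigmaI finite_subset)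
  with R show ?L
    by unfold_locales (auto simp: symmetric_def irrefl_def)
qed

lemma graph_with_proj_iff: "graph (with_proj G) \<longleftrightarrow> pair_graph G"
proof
  assume "graph (with_proj G)"
  then interpret G: graph "with_proj G" .
  show "pair_graph G"
    unfolding pair_graph_iff
    using G.finite_verts G.tail_in_verts G.head_in_verts G.sym_arcs G.no_loops[of "(a, a)" for a]
    by (auto simp: symmetric_def irrefl_def)
next
  assume "pair_graph G"
  then interpret pair_graph G .
  show "graph (with_proj G)" by unfold_locales
qed

definition conn :: "'a pair_pre_digraph \<Rightarrow> bool" where
  "conn G \<longleftrightarrow> pair_graph G \<and> pverts G \<noteq> {} \<and>
     (\<forall>u\<in>pverts G. \<forall>v\<in>pverts G. (u, v) \<in> (parcs G)\<^sup>*)"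

lemma connected_with_proj_iff:
  assumes "pair_graph G"
  shows "connected (with_proj G) \<longleftrightarrow> conn G"
proof -
  let ?H = "mk_symmetric (with_proj G)"
  have G: "parcs G \<subseteq> pverts G \<times> pverts G" "sym (parcs G)"
    using assms by (auto simp: pair_graph_iff)
  have "parcs ?H = (\<Union>e\<in>parcs G. {e, (snd e, fst e)})"
    by (simp add: mk_symmetric_def)
  also have "\<dots> = parcs G" using G(2) by (auto dest: symD)
  finally have arcs: "parcs ?H = parcs G" .
  have verts: "pverts ?H = pverts G" by (simp add: mk_symmetric_def)
  have "(u, v) \<in> rtrancl_on (pverts G) (parcs G) \<longleftrightarrow> (u, v) \<in> (parcs G)\<^sup>*"
    if "u \<in> pverts G" for u v
  proof
    assume "(u, v) \<in> (parcs G)\<^sup>*"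
    then show "(u, v) \<in> rtrancl_on (pverts G) (parcs G)"
    proof (induction rule: rtrancl_induct)
      case base
      then show ?case using that by auto
    next
      case (step y z)
      then show ?case using G(1) by (auto intro: rtrancl_on_into_rtrancl_on)
    qed
  qed (rule rtrancl_on_rtranclI)
  then show ?thesis
    unfolding connected_def strongly_connected_def reachable_def conn_def
    using assms by (simp add: arcs verts)
qed

definition induce :: "'a pair_pre_digraph \<Rightarrow> 'a set \<Rightarrow> 'a pair_pre_digraph" where
  "induce G S = \<lparr>pverts = S, parcs = parcs G \<inter> S \<times> S\<rparr>"

lemma induce_simps [simp]: "pverts (induce G S) = S" "parcs (induce G S) = parcs G \<inter> S \<times> S"
  by (simp_all add: induce_def)

lemma pair_graph_induce:
  assumes "pair_graph G" "S \<subseteq> pverts G"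
  shows "pair_graph (induce G S)"
  using assms finite_subset[of S "pverts G"]
  by (auto simp: pair_graph_iff sym_def irrefl_def)

lemma del_vert_with_proj:
  assumes "pair_graph G"
  shows "pre_digraph.del_vert (with_proj G) v = with_proj (induce G (pverts G - {v}))"
  using assms by (auto simp: pre_digraph.del_vert_def with_proj_def pair_graph_iff)

text \<open>
  Blocks are the maximal subgraphs with this property. The case \<open>pverts G = {v}\<close> keeps a single vertex
  from being a cut-vertex.
\<close>

definition nonseparable :: "'a pair_pre_digraph \<Rightarrow> bool" where
  "nonseparable G \<longleftrightarrow> conn G \<and>
     (\<forall>v\<in>pverts G. pverts G = {v} \<or> conn (induce G (pverts G - {v})))"

lemma nonseparable_iff:
  assumes "pair_graph G"
  shows "connected (with_proj G) \<and> (\<nexists>v. cut_vertex (with_proj G) v) \<longleftrightarrow> nonseparable G"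
  using assms pair_graph_induce[OF assms]
  by (auto simp: nonseparable_def cut_vertex_def connected_with_proj_iff del_vert_with_proj)

definition subgr :: "'a pair_pre_digraph \<Rightarrow> 'a pair_pre_digraph \<Rightarrow> bool" where
  "subgr H G \<longleftrightarrow> pverts H \<subseteq> pverts G \<and> parcs H \<subseteq> parcs G"

lemma subgr_trans: "subgr H G \<Longrightarrow> subgr G K \<Longrightarrow> subgr H K"
  by (auto simp: subgr_def)

lemma subgr_antisym: "subgr H G \<Longrightarrow> subgr G H \<Longrightarrow> H = G"
  by (auto simp: subgr_def intro!: pair_pre_digraph.equality)

lemma subgraph_with_proj_iff:
  assumes "pair_graph G" "pair_graph H"
  shows "subgraph (with_proj H) (with_proj G) \<longleftrightarrow> subgr H G"
  using assms by (auto simp: subgraph_def subgr_def wf_digraph_wp_iff pair_graph_iff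
      compatibleI_with_proj pair_wf_digraph_def)

lemma with_proj_eq_iff: "with_proj G = with_proj H \<longleftrightarrow> G = H"
  by (metis pair_pre_digraph.surjective old.unit.exhaust with_proj_simps(1,2))

text \<open>
  A subgraph of a graph in the pair representation is again in this representation, since it
  shares the two end point maps; so maximality may be tested among such graphs only.
\<close>

lemma blocks_iff:
  assumes "pair_graph G"
  shows "B \<in> blocks G \<longleftrightarrow> nonseparable B \<and> subgr B G \<and>
    (\<forall>H. nonseparable H \<longrightarrow> subgr B H \<longrightarrow> subgr H G \<longrightarrow> H = B)" (is "?L \<longleftrightarrow> ?R")
proof
  assume ?L
  then have B: "subgraph (with_proj B) (with_proj G)" "graph (with_proj B)"
      "connected (with_proj B) \<and> (\<nexists>v. cut_vertex (with_proj B) v)"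
    and max: "\<And>H'. H' \<noteq> with_proj B \<Longrightarrow> subgraph (with_proj B) H' \<Longrightarrow> subgraph H' (with_proj G) \<Longrightarrow>
      graph H' \<Longrightarrow> connected H' \<Longrightarrow> (\<nexists>v. cut_vertex H' v) \<Longrightarrow> False"
    unfolding blocks_def pre_digraph.max_subgraph_def by blast+
  then have pB: "pair_graph B" by (simp add: graph_with_proj_iff)
  have "nonseparable B" "subgr B G"
    using B nonseparable_iff[OF pB] subgraph_with_proj_iff[OF assms pB] by auto
  moreover have "H = B" if H: "nonseparable H" "subgr B H" "subgr H G" for H
  proof (rule ccontr)
    assume "H \<noteq> B"
    have pH: "pair_graph H" using H(1) by (simp add: nonseparable_def conn_def)
    show False
      by (rule max[of "with_proj H"])
        (use \<open>H \<noteq> B\<close> H pH pB assms nonseparable_iff[OF pH] in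
          \<open>auto simp: with_proj_eq_iff subgraph_with_proj_iff graph_with_proj_iff\<close>)
  qed
  ultimately show ?R by blast
next
  assume R: ?R
  have pB: "pair_graph B" using R by (simp add: nonseparable_def conn_def)
  have "\<not> (subgraph H' (with_proj G) \<and> graph H' \<and> connected H' \<and> (\<nexists>v. cut_vertex H' v))"
    if H': "H' \<noteq> with_proj B \<and> subgraph (with_proj B) H'" for H'
  proof
    assume *: "subgraph H' (with_proj G) \<and> graph H' \<and> connected H' \<and> (\<nexists>v. cut_vertex H' v)"
    let ?H = "\<lparr>pverts = verts H', parcs = arcs H'\<rparr>"
    have "tail H' = fst" "head H' = snd"
      using * by (auto simp: subgraph_def compatible_def)
    then have eq: "H' = with_proj ?H" by (simp add: with_proj_def)
    then have pH: "pair_graph ?H" using * graph_with_proj_iff by metis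
    then have "nonseparable ?H" using nonseparable_iff[OF pH] * eq by metis
    moreover have "subgr B ?H" "subgr ?H G"
      using * H' eq subgraph_with_proj_iff[OF assms pH] subgraph_with_proj_iff[OF pH pB] by metis+
    ultimately have "?H = B" using R by blast
    then show False using H' eq by simp
  qed
  then show ?L
    unfolding blocks_def pre_digraph.max_subgraph_def
    using R nonseparable_iff[OF pB] subgraph_with_proj_iff[OF assms pB] pB
    by (auto simp: graph_with_proj_iff)
qed

lemma finite_blocks:
  assumes "pair_graph G"
  shows "finite (blocks G)"
proof (rule finite_subset)
  show "blocks G \<subseteq> (\<lambda>(V, E). \<lparr>pverts = V, parcs = E\<rparr>) ` (Pow (pverts G) \<times> Pow (parcs G))"
  proof
    fix B assume "B \<in> blocks G"
    then have "subgr B G" using blocks_iff[OF assms] by blast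
    then show "B \<in> (\<lambda>(V, E). \<lparr>pverts = V, parcs = E\<rparr>) ` (Pow (pverts G) \<times> Pow (parcs G))"
      by (intro image_eqI[where x = "(pverts B, parcs B)"]) (auto simp: subgr_def)
  qed
  have "finite (parcs G)" using assms by (auto simp: pair_graph_iff intro: finite_subset)
  then show "finite ((\<lambda>(V, E). \<lparr>pverts = V, parcs = E\<rparr>) ` (Pow (pverts G) \<times> Pow (parcs G)))"
    using assms by (auto simp: pair_graph_iff)
qed

text \<open>
  A potential that vanishes at \<open>u\<close> and increases by at most \<open>1\<close> along an arc is a lower bound for
  the distance from \<open>u\<close>. If every other vertex has a neighbour where it is smaller by \<open>1\<close>, walking
  down gives a path of exactly this length. All distances below are computed by guessing such
  a potential.
\<close>

lemma graph_dist_eqI: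
  assumes G: "pair_graph G" and u: "u \<in> pverts G" "f u = (0::nat)"
    and step: "\<And>a b. (a, b) \<in> parcs G \<Longrightarrow> f b \<le> f a + 1"
    and closer: "\<And>v. v \<in> pverts G \<Longrightarrow> v \<noteq> u \<Longrightarrow> \<exists>w. (w, v) \<in> parcs G \<and> f v = f w + 1"
    and v: "v \<in> pverts G"
  shows "graph_dist G u v = f v"
proof -
  interpret pair_graph G by (rule G)
  \<comment> \<open>The bound on \<open>f\<close> along the walk is what shows that the next vertex is new.\<close>
  have upper: "\<exists>P. apath u P v \<and> length P = n \<and> (\<forall>w\<in>set (pawalk_verts u P). f w \<le> n)"
    if "f v = n" "v \<in> pverts G" for v n
    using that
  proof (induction n arbitrary: v)
    case 0
    then have "v = u" using closer by fastforce
    then show ?case using u by (intro exI[of _ "[]"]) (auto simp: apath_def awalk_def)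
  next
    case (Suc n)
    then have "v \<noteq> u" using u by auto
    then obtain w where w: "(w, v) \<in> parcs G" "f w = n" using closer[of v] Suc.prems by auto
    then obtain P where P: "apath u P w" "length P = n" "\<forall>x\<in>set (pawalk_verts u P). f x \<le> n"
      using Suc.IH[of w] in_arcsD1 by blast
    have Pw: "awalk u P w" "distinct (pawalk_verts u P)" using P(1) by (auto simp: apath_def)
    have walk: "awalk u (P @ [(w, v)]) v"
      using Pw(1) w(1) Suc.prems(2) by (auto simp: awalk_def in_arcsD1 intro: awalk_appendI)
    have "pawalk_verts u (P @ [(w, v)]) = pawalk_verts u P @ [v]"
      using Pw(1)
      by (metis awalk_verts_append walk awalk_Cons_iff awalk_append_iff butlast.simps last_ConsL list.sel pawalk_verts.simps snd_conv)
    then show ?case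
      using walk Pw P(2,3) Suc.prems(1)
      by (intro exI[of _ "P @ [(w, v)]"]) (auto simp: apath_def)
  qed
  have lower: "f w \<le> f x + length P" if "pcas x P w" "set P \<subseteq> parcs G" for x P w
    using that
  proof (induction P arbitrary: x)
    case (Cons e P)
    then show ?case using step[of x "snd e"] by (cases e) force
  qed simp
  obtain P where P: "apath u P v" "length P = f v" using upper[OF refl v] by blast
  show ?thesis
    unfolding graph_dist_def
  proof (rule Least_equality)
    show "\<exists>P. apath u P v \<and> length P = f v" using P by blast
    fix n assume "\<exists>P. apath u P v \<and> length P = n"
    then show "f v \<le> n" using lower[of u _ v] u by (auto simp: apath_def awalk_def)
  qed
qed

lemma graph_dist_props:
  assumes G: "conn G" and u: "u \<in> pverts G"
  shows "graph_dist G u u = 0"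
    and "\<And>a b. (a, b) \<in> parcs G \<Longrightarrow> graph_dist G u b \<le> graph_dist G u a + 1"
    and "\<And>v. v \<in> pverts G \<Longrightarrow> v \<noteq> u \<Longrightarrow> \<exists>w. (w, v) \<in> parcs G \<and> graph_dist G u v = graph_dist G u w + 1"
    and "\<And>v. v \<in> pverts G \<Longrightarrow> graph_dist G u v = (LEAST n. (u, v) \<in> parcs G ^^ n)"
proof -
  have pG: "pair_graph G" using G by (simp add: conn_def)
  then have E: "parcs G \<subseteq> pverts G \<times> pverts G" by (simp add: pair_graph_iff)
  define f where "f v = (LEAST n. (u, v) \<in> parcs G ^^ n)" for v
  have reach: "(u, v) \<in> parcs G ^^ f v" if "v \<in> pverts G" for v
  proof -
    have "(u, v) \<in> (parcs G)\<^sup>*" using G u that by (auto simp: conn_def)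
    then obtain n where "(u, v) \<in> parcs G ^^ n" by (auto simp: rtrancl_power)
    then show ?thesis unfolding f_def by (rule LeastI)
  qed
  have le: "f v \<le> n" if "(u, v) \<in> parcs G ^^ n" for v n
    unfolding f_def using that by (rule Least_le)
  have f0: "f u = 0" using le[of u 0] by simp
  have step: "f b \<le> f a + 1" if "(a, b) \<in> parcs G" for a b
    using le[of b "Suc (f a)"] reach[of a] that E by auto
  have closer: "\<exists>w. (w, v) \<in> parcs G \<and> f v = f w + 1" if v: "v \<in> pverts G" "v \<noteq> u" for v
  proof (cases "f v")
    case 0
    then show ?thesis using reach[OF v(1)] v(2) by simp
  next
    case (Suc n)
    then obtain w where w: "(u, w) \<in> parcs G ^^ n" "(w, v) \<in> parcs G"
      using reach[OF v(1)] by auto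
    then show ?thesis using le[of w n] step[of w v] Suc by fastforce
  qed
  have eq: "graph_dist G u v = f v" if "v \<in> pverts G" for v
    by (rule graph_dist_eqI[OF pG u f0 step closer that])
  show "graph_dist G u u = 0" using eq u f0 by simp
  show "graph_dist G u b \<le> graph_dist G u a + 1" if "(a, b) \<in> parcs G" for a b
    using eq step[OF that] that E by auto
  show "\<exists>w. (w, v) \<in> parcs G \<and> graph_dist G u v = graph_dist G u w + 1"
    if "v \<in> pverts G" "v \<noteq> u" for v
    using closer[OF that] eq that E by (metis SigmaD1 subsetD)
  show "graph_dist G u v = (LEAST n. (u, v) \<in> parcs G ^^ n)" if "v \<in> pverts G" for v
    using eq[OF that] by (simp add: f_def)
qed

lemma graph_dist_commute:
  assumes "conn G" "u \<in> pverts G" "v \<in> pverts G"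
  shows "graph_dist G u v = graph_dist G v u"
proof -
  have sym: "sym (parcs G)" using assms(1) by (simp add: conn_def pair_graph_iff)
  have "(b, a) \<in> parcs G ^^ n" if "(a, b) \<in> parcs G ^^ n" for a b n
    using that
  proof (induction n arbitrary: b)
    case (Suc n)
    then obtain c where "(a, c) \<in> parcs G ^^ n" "(c, b) \<in> parcs G" by auto
    then show ?case using Suc.IH symD[OF sym] by (blast intro: relpow_Suc_I2)
  qed simp
  then have "(u, v) \<in> parcs G ^^ n \<longleftrightarrow> (v, u) \<in> parcs G ^^ n" for n by blast
  then show ?thesis using graph_dist_props(4)[OF assms(1)] assms by simp
qed

lemma graph_dist_iso:
  assumes "pair_graph G" "conn H" "bij_betw \<phi> (pverts G) (pverts H)"
    and "\<And>a b. a \<in> pverts G \<Longrightarrow> b \<in> pverts G \<Longrightarrow> (a, b) \<in> parcs G \<longleftrightarrow> (\<phi> a, \<phi> b) \<in> parcs H"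
    and "u \<in> pverts G" "v \<in> pverts G"
  shows "graph_dist G u v = graph_dist H (\<phi> u) (\<phi> v)"
proof (rule graph_dist_eqI[OF assms(1,5), where f = "\<lambda>v. graph_dist H (\<phi> u) (\<phi> v)"])
  have E: "parcs G \<subseteq> pverts G \<times> pverts G" "parcs H \<subseteq> pverts H \<times> pverts H"
    using assms(1,2) by (auto simp: pair_graph_iff conn_def)
  have in_H: "\<phi> a \<in> pverts H" if "a \<in> pverts G" for a
    using assms(3) that by (auto simp: bij_betw_def)
  note props = graph_dist_props[OF assms(2) in_H[OF assms(5)]]
  show "graph_dist H (\<phi> u) (\<phi> u) = 0" by (rule props(1))
  show "graph_dist H (\<phi> u) (\<phi> b) \<le> graph_dist H (\<phi> u) (\<phi> a) + 1" if "(a, b) \<in> parcs G" for a b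
    using props(2) assms(4) that E by blast
  show "\<exists>w. (w, v) \<in> parcs G \<and> graph_dist H (\<phi> u) (\<phi> v) = graph_dist H (\<phi> u) (\<phi> w) + 1"
    if v: "v \<in> pverts G" "v \<noteq> u" for v
  proof -
    have "\<phi> v \<noteq> \<phi> u" using assms(3,5) v by (auto simp: bij_betw_def dest: inj_onD)
    then obtain w' where w': "(w', \<phi> v) \<in> parcs H"
        "graph_dist H (\<phi> u) (\<phi> v) = graph_dist H (\<phi> u) w' + 1"
      using props(3) in_H[OF v(1)] by blast
    then obtain w where "w \<in> pverts G" "w' = \<phi> w"
      using E(2) assms(3) unfolding bij_betw_def by blast
    then show ?thesis using w' assms(4) v by blast
  qed
qed (rule assms(6))

lemma digraph_isoE:
  assumes "digraph_iso (with_proj G) (with_proj H)" and G: "pair_graph G"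
  obtains \<phi> where "bij_betw \<phi> (pverts G) (pverts H)"
    "\<And>a b. a \<in> pverts G \<Longrightarrow> b \<in> pverts G \<Longrightarrow> (a, b) \<in> parcs G \<longleftrightarrow> (\<phi> a, \<phi> b) \<in> parcs H"
proof -
  obtain h where h: "pre_digraph.digraph_isomorphism (with_proj G) h"
      "with_proj H = app_iso h (with_proj G)"
    using assms(1) by (auto simp: digraph_iso_def)
  have inj: "inj_on (iso_verts h) (pverts G)"
    and arc: "\<And>a. a \<in> parcs G \<Longrightarrow> iso_verts h (fst a) = iso_tail h (iso_arcs h a) \<and>
        iso_verts h (snd a) = iso_head h (iso_arcs h a)"
    using h(1) by (auto simp: pre_digraph.digraph_isomorphism_def)
  have H: "pverts H = iso_verts h ` pverts G" "parcs H = iso_arcs h ` parcs G"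
    "fst = iso_tail h" "snd = iso_head h"
    using h(2) by (metis with_proj_simps app_iso_simps)+
  have arc': "iso_arcs h (a, b) = (iso_verts h a, iso_verts h b)" if "(a, b) \<in> parcs G" for a b
    using arc[OF that] H(3,4) by (metis fst_conv snd_conv prod.collapse)
  show ?thesis
  proof (rule that[of "iso_verts h"])
    show "bij_betw (iso_verts h) (pverts G) (pverts H)"
      using inj H(1) by (simp add: bij_betw_def)
    fix a b assume ab: "a \<in> pverts G" "b \<in> pverts G"
    show "(a, b) \<in> parcs G \<longleftrightarrow> (iso_verts h a, iso_verts h b) \<in> parcs H"
    proof
      assume "(a, b) \<in> parcs G"
      then show "(iso_verts h a, iso_verts h b) \<in> parcs H"
        unfolding H(2) using arc' by (metis image_eqI)
    next
      assume "(iso_verts h a, iso_verts h b) \<in> parcs H"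
      then obtain c d where cd: "(c, d) \<in> parcs G"
          "iso_verts h a = iso_verts h c" "iso_verts h b = iso_verts h d"
        unfolding H(2) using arc' by auto
      then have "c \<in> pverts G" "d \<in> pverts G" using G by (auto simp: pair_graph_iff)
      then show "(a, b) \<in> parcs G" using cd ab inj by (auto dest: inj_onD)
    qed
  qed
qed

abbreviation rdist :: "'a pair_pre_digraph \<Rightarrow> 'a \<Rightarrow> 'a \<Rightarrow> real" where
  "rdist G u v \<equiv> real (graph_dist G u v)"

section \<open>Cut-vertices and the theorem of Graham, Hoffman and Hosoya\<close>

definition dist_det :: "'a pair_pre_digraph \<Rightarrow> real" where
  "dist_det G = idet (pverts G) (rdist G)"

definition dist_cof :: "'a pair_pre_digraph \<Rightarrow> real" where
  "dist_cof G = idet_cof (pverts G) (rdist G)"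

lemma det_distance_matrix:
  assumes "vertex_enum G vs"
  shows "det (distance_matrix G vs) = dist_det G"
  using assms idet_list[of vs "rdist G"]
  by (simp add: vertex_enum_def dist_det_def distance_matrix_def list_matrix_def)

lemma cof_distance_matrix:
  assumes "vertex_enum G vs" "2 \<le> card (pverts G)"
  shows "cof (distance_matrix G vs) = dist_cof G"
proof -
  have "distinct vs" "set vs = pverts G" using assms(1) by (auto simp: vertex_enum_def)
  moreover from this have "2 \<le> length vs" using assms(2) by (metis distinct_card)
  moreover have "distance_matrix G vs = list_matrix vs (rdist G)"
    by (simp add: distance_matrix_def list_matrix_def)
  ultimately show ?thesis using cof_list_matrix[of vs "rdist G"] by (simp add: dist_cof_def)
qed

lemma dist_iso:
  assumes "pair_graph G" "conn H" "digraph_iso (with_proj G) (with_proj H)"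
  shows "dist_det G = dist_det H" "dist_cof G = dist_cof H" "card (pverts G) = card (pverts H)"
proof -
  obtain \<phi> where \<phi>: "bij_betw \<phi> (pverts G) (pverts H)"
    "\<And>a b. a \<in> pverts G \<Longrightarrow> b \<in> pverts G \<Longrightarrow> (a, b) \<in> parcs G \<longleftrightarrow> (\<phi> a, \<phi> b) \<in> parcs H"
    using digraph_isoE[OF assms(3,1)] by metis
  have eq: "rdist G u v = rdist H (\<phi> u) (\<phi> v)" if "u \<in> pverts G" "v \<in> pverts G" for u v
    using graph_dist_iso[OF assms(1,2) \<phi>] that by simp
  have fin: "finite (pverts G)" using assms(1) by (simp add: pair_graph_iff)
  show "dist_det G = dist_det H"
    unfolding dist_det_def by (rule idet_bij[OF fin \<phi>(1)]) (rule eq)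
  show "dist_cof G = dist_cof H"
    unfolding dist_cof_def by (rule idet_cof_bij[OF fin \<phi>(1)]) (rule eq)
  show "card (pverts G) = card (pverts H)" using \<phi>(1) by (rule bij_betw_same_card)
qed

text \<open>
  The graph is the union of two subgraphs that share only the vertex \<open>c\<close>. The locale is symmetric
  in \<open>A\<close> and \<open>B\<close>, so facts about one side transfer by \<open>flip\<close>.
\<close>

locale separation =
  fixes G :: "'a pair_pre_digraph" and c :: 'a and A B :: "'a set"
  assumes conn: "conn G"
    and verts: "pverts G = insert c (A \<union> B)"
    and disjoint: "A \<inter> B = {}" "c \<notin> A" "c \<notin> B"
    and no_arc: "\<And>a b. a \<in> A \<Longrightarrow> b \<in> B \<Longrightarrow> (a, b) \<notin> parcs G"
begin

lemma pair_graph: "pair_graph G"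
  and arcs: "parcs G \<subseteq> pverts G \<times> pverts G"
  and sym: "sym (parcs G)"
  and finite: "finite A" "finite B"
  using conn finite_subset[of _ "pverts G"] verts by (auto simp: conn_def pair_graph_iff)

lemma flip: "separation G c B A"
proof
  show "(b, a) \<notin> parcs G" if "b \<in> B" "a \<in> A" for a b
    using no_arc[OF that(2,1)] symD[OF sym] by blast
qed (use conn verts disjoint in auto)

abbreviation "left \<equiv> induce G (insert c A)"
abbreviation "right \<equiv> induce G (insert c B)"

text \<open>
  A walk that leaves \<open>A\<close> has to enter \<open>c\<close>, and up to there it stays in the left subgraph.
\<close>

lemma reaches_cut:
  assumes "v \<in> insert c A"
  shows "(v, c) \<in> (parcs left)\<^sup>*"
proof -
  have "(v, c) \<in> (parcs G)\<^sup>*" using conn assms verts by (auto simp: conn_def)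
  then show ?thesis using assms
  proof (induction rule: converse_rtrancl_induct)
    case (step y z)
    show ?case
    proof (cases "y = c")
      case False
      then have "z \<in> insert c A" using step.prems step.hyps(1) no_arc arcs verts by blast
      then have "(z, c) \<in> (parcs left)\<^sup>*" "(y, z) \<in> parcs left"
        using step by auto
      then show ?thesis by (rule converse_rtrancl_into_rtrancl[rotated])
    qed simp
  qed simp
qed

lemma conn_left: "conn left"
proof -
  have pg: "pair_graph left" by (rule pair_graph_induce[OF pair_graph]) (use verts in auto)
  then have "sym (parcs left)" by (simp add: pair_graph_iff)
  then have "sym ((parcs left)\<^sup>*)" by (rule sym_rtrancl)
  then have "(u, v) \<in> (parcs left)\<^sup>*" if "u \<in> insert c A" "v \<in> insert c A" for u v
    using reaches_cut[OF that(1)] reaches_cut[OF that(2)] by (meson rtrancl_trans symD)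
  then show ?thesis using pg by (auto simp: conn_def)
qed

lemma conn_right: "conn right"
  by (rule separation.conn_left[OF flip])

text \<open>
  The right-hand side is a potential as required by \<open>graph_dist_eqI\<close>. It yields at once that both
  sides are isometric subgraphs and that distances across \<open>c\<close> add up.
\<close>

lemma dist_from_left:
  assumes u: "u \<in> insert c A" and v: "v \<in> pverts G"
  shows "graph_dist G u v = (if v \<in> insert c A then graph_dist left u v
    else graph_dist left u c + graph_dist right c v)" (is "_ = ?f v")
proof (rule graph_dist_eqI[OF pair_graph])
  note L = graph_dist_props[OF conn_left, simplified, OF u[simplified]]
  note R = graph_dist_props[OF conn_right, of c, simplified]
  show "u \<in> pverts G" using u verts by auto
  show "?f u = 0" using L(1) u by simp
  show "?f b \<le> ?f a + 1" if ab: "(a, b) \<in> parcs G" for a b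
  proof -
    have "a \<in> insert c A \<and> b \<in> insert c A \<or> a \<in> insert c B \<and> b \<in> insert c B"
      using ab arcs verts no_arc symD[OF sym ab] by blast
    then show ?thesis using L(2)[of a b] R(1) R(2)[of a b] ab disjoint by auto
  qed
  show "\<exists>w. (w, v) \<in> parcs G \<and> ?f v = ?f w + 1" if v: "v \<in> pverts G" "v \<noteq> u" for v
  proof (cases "v \<in> insert c A")
    case True
    then obtain w where "(w, v) \<in> parcs G" "w \<in> insert c A"
        "graph_dist left u v = graph_dist left u w + 1"
      using L(3)[of v] v by auto
    then show ?thesis using True by (intro exI[of _ w]) auto
  next
    case False
    then obtain w where "(w, v) \<in> parcs G" "w \<in> insert c B"
        "graph_dist right c v = graph_dist right c w + 1"
      using R(3)[of v] v verts by auto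
    then show ?thesis using False R(1) disjoint by (intro exI[of _ w]) auto
  qed
qed (rule v)

lemma dist_left: "u \<in> insert c A \<Longrightarrow> v \<in> insert c A \<Longrightarrow> graph_dist G u v = graph_dist left u v"
  using dist_from_left[of u v] verts by auto

lemma dist_right: "u \<in> insert c B \<Longrightarrow> v \<in> insert c B \<Longrightarrow> graph_dist G u v = graph_dist right u v"
  by (rule separation.dist_left[OF flip])

lemma dist_across:
  assumes "a \<in> A" "b \<in> B"
  shows "graph_dist G a b = graph_dist G a c + graph_dist G c b"
  using dist_from_left[of a b] dist_left[of a c] dist_right[of c b] assms verts disjoint by auto

lemma dist_cof_separation: "dist_cof G = dist_cof left * dist_cof right" (is ?cof)
  and dist_det_separation:
    "dist_det G = dist_det left * dist_cof right + dist_det right * dist_cof left" (is ?det)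
proof -
  have cut: "rdist G a b = rdist G a c + rdist G c b \<and> rdist G b a = rdist G b c + rdist G c a"
    if "a \<in> A" "b \<in> B" for a b
    using dist_across[OF that] separation.dist_across[OF flip that(2,1)] by simp
  have zero: "rdist G c c = 0" using graph_dist_props(1)[OF conn, of c] verts by simp
  note glue = idet_glue[OF finite disjoint, of "rdist G", OF zero cut]
  have "idet (insert c A) (rdist G) = dist_det left" "idet_cof (insert c A) (rdist G) = dist_cof left"
    "idet (insert c B) (rdist G) = dist_det right" "idet_cof (insert c B) (rdist G) = dist_cof right"
    unfolding dist_det_def dist_cof_def induce_simps
    by (rule idet_cong idet_cof_cong; (simp add: finite; fail)?; (simp only: dist_left; fail)?; simp only: dist_right)+
  then show ?cof ?det
    using glue by (simp_all add: dist_det_def dist_cof_def verts)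
qed

text \<open>
  If \<open>H\<close> met both \<open>A\<close> and \<open>B\<close>, removing \<open>c\<close> from \<open>H\<close> would leave a connected graph, hence a walk
  from \<open>A\<close> to \<open>B\<close> that avoids \<open>c\<close>.
\<close>

lemma nonseparable_side:
  assumes "nonseparable H" "subgr H G"
  shows "subgr H left \<or> subgr H right"
proof -
  have H: "conn H" "pair_graph H" using assms(1) by (auto simp: nonseparable_def conn_def)
  have "\<not> (\<exists>x\<in>pverts H \<inter> A. \<exists>y\<in>pverts H \<inter> B. True)"
  proof
    assume "\<exists>x\<in>pverts H \<inter> A. \<exists>y\<in>pverts H \<inter> B. True"
    then obtain x y where xy: "x \<in> pverts H" "x \<in> A" "y \<in> pverts H" "y \<in> B" by blast
    let ?K = "induce H (pverts H - {c})"
    have "conn ?K"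
    proof (cases "c \<in> pverts H")
      case True
      then have "conn ?K \<or> pverts H = {c}" using assms(1) by (auto simp: nonseparable_def)
      then show ?thesis using xy disjoint by auto
    next
      case False
      then have "?K = H"
        using H(2) by (intro pair_pre_digraph.equality) (auto simp: pair_graph_iff)
      then show ?thesis using H(1) by simp
    qed
    then have "(x, y) \<in> (parcs ?K)\<^sup>*" using xy disjoint by (auto simp: conn_def)
    then have "y \<in> A"
    proof (induction rule: rtrancl_induct)
      case (step p q)
      then have "(p, q) \<in> parcs G" "q \<noteq> c" using assms(2) by (auto simp: subgr_def)
      then show ?case using step.IH no_arc arcs verts by blast
    qed (rule xy(2))
    then show False using xy(4) disjoint by blast
  qed
  then have "pverts H \<subseteq> insert c A \<or> pverts H \<subseteq> insert c B"
    using assms(2) verts by (auto simp: subgr_def)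
  then show ?thesis using assms(2) H(2) by (auto simp: subgr_def pair_graph_iff)
qed

end

lemma nonseparable_edge:
  assumes "u \<noteq> v"
  shows "nonseparable \<lparr>pverts = {u, v}, parcs = {(u, v), (v, u)}\<rparr>" (is "nonseparable ?K")
proof -
  have "pair_graph ?K" using assms by (auto simp: pair_graph_iff sym_def irrefl_def)
  moreover have "conn (induce ?K {w})" for w
    by (auto simp: conn_def pair_graph_iff sym_def irrefl_def)
      (use assms in blast)+
  moreover have "{u, v} - {u} = {v}" "{u, v} - {v} = {u}" using assms by auto
  ultimately show ?thesis by (auto simp: nonseparable_def conn_def)
qed

text \<open>
  A vertex of a connected graph with further vertices is contained in an edge, and an edge is
  nonseparable; so a single vertex is not maximal.
\<close>

lemma block_not_point:
  assumes G: "conn G" and x: "x \<in> pverts G" "x \<noteq> c" and B: "B \<in> blocks G" and c: "pverts B \<subseteq> {c}"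
  shows False
proof -
  have pG: "pair_graph G" using G by (simp add: conn_def)
  have b: "nonseparable B" "subgr B G" "\<And>H. nonseparable H \<Longrightarrow> subgr B H \<Longrightarrow> subgr H G \<Longrightarrow> H = B"
    using B blocks_iff[OF pG] by auto
  have pB: "pair_graph B" "pverts B = {c}"
    using b(1) c by (auto simp: nonseparable_def conn_def)
  then have "parcs B = {}" by (auto simp: pair_graph_iff irrefl_def)
  have "c \<in> pverts G" using pB b(2) by (auto simp: subgr_def)
  then have "(c, x) \<in> (parcs G)\<^sup>*" using G x by (auto simp: conn_def)
  then obtain a where a: "(c, a) \<in> parcs G" using x by (metis converse_rtranclE)
  then have a': "(a, c) \<in> parcs G" "a \<noteq> c" "a \<in> pverts G"
    using pG by (auto simp: pair_graph_iff irrefl_def dest: symD)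
  have "\<lparr>pverts = {c, a}, parcs = {(c, a), (a, c)}\<rparr> = B"
    by (rule b(3)) (use nonseparable_edge[of c a] a a' pB \<open>parcs B = {}\<close> \<open>c \<in> pverts G\<close>
        in \<open>auto simp: subgr_def\<close>)
  then show False using \<open>parcs B = {}\<close> by auto
qed

context separation
begin

lemma blocks_left_subset:
  assumes "A \<noteq> {}"
  shows "blocks left \<subseteq> blocks G"
proof
  fix K assume K: "K \<in> blocks left"
  have pl: "pair_graph left" using conn_left by (simp add: conn_def)
  have k: "nonseparable K" "subgr K left"
      "\<And>H. nonseparable H \<Longrightarrow> subgr K H \<Longrightarrow> subgr H left \<Longrightarrow> H = K"
    using K blocks_iff[OF pl] by auto
  have "H = K" if H: "nonseparable H" "subgr K H" "subgr H G" for H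
    using nonseparable_side[OF H(1,3)]
  proof
    assume "subgr H right"
    then have "subgr K right" using H(2) subgr_trans by blast
    then have "pverts K \<subseteq> {c}" using k(2) disjoint by (auto simp: subgr_def)
    moreover obtain x where "x \<in> A" using assms by blast
    ultimately show ?thesis
      using block_not_point[OF conn_left _ _ K, of x c] disjoint by auto
  qed (rule k(3)[OF H(1,2)])
  moreover have "subgr K G" using k(2) verts by (auto simp: subgr_def)
  ultimately show "K \<in> blocks G" using k(1) blocks_iff[OF pair_graph] by blast
qed

lemma blocks_separation:
  assumes "A \<noteq> {}" "B \<noteq> {}"
  shows "blocks G = blocks left \<union> blocks right" "blocks left \<inter> blocks right = {}"
proof -
  interpret F: separation G c B A by (rule flip)
  have pg: "pair_graph left" "pair_graph right"
    using conn_left conn_right by (auto simp: conn_def)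
  have sub: "subgr left G" "subgr right G" using verts by (auto simp: subgr_def)
  have "K \<in> blocks left \<union> blocks right" if K: "K \<in> blocks G" for K
  proof -
    have k: "nonseparable K" "subgr K G"
        "\<And>H. nonseparable H \<Longrightarrow> subgr K H \<Longrightarrow> subgr H G \<Longrightarrow> H = K"
      using K blocks_iff[OF pair_graph] by auto
    show ?thesis
      using nonseparable_side[OF k(1,2)] k sub subgr_trans
      unfolding Un_iff blocks_iff[OF pg(1)] blocks_iff[OF pg(2)] by blast
  qed
  then show "blocks G = blocks left \<union> blocks right"
    using blocks_left_subset F.blocks_left_subset assms by blast
  show "blocks left \<inter> blocks right = {}"
  proof (rule ccontr)
    assume "blocks left \<inter> blocks right \<noteq> {}"
    then obtain K where K: "K \<in> blocks left" "K \<in> blocks right" by blast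
    then have "subgr K left" "subgr K right" using blocks_iff pg by blast+
    then have "pverts K \<subseteq> {c}" using disjoint by (auto simp: subgr_def)
    moreover obtain x where "x \<in> A" using assms by blast
    ultimately show False
      using block_not_point[OF conn_left _ _ K(1), of x c] disjoint by auto
  qed
qed

end

text \<open>
  \<open>A\<close> is a connected component of the graph without \<open>c\<close>, and \<open>B\<close> is the rest.
\<close>

lemma separation_exists:
  assumes G: "conn G" and c: "c \<in> pverts G" "pverts G \<noteq> {c}"
    and cut: "\<not> conn (induce G (pverts G - {c}))"
  obtains A B where "separation G c A B" "A \<noteq> {}" "B \<noteq> {}"
proof -
  let ?K = "induce G (pverts G - {c})"
  have pG: "pair_graph G" using G by (simp add: conn_def)
  have pK: "pair_graph ?K" by (rule pair_graph_induce[OF pG]) auto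
  then have sym: "sym ((parcs ?K)\<^sup>*)" by (intro sym_rtrancl) (simp add: pair_graph_iff)
  obtain a where a: "a \<in> pverts ?K" using c by auto
  let ?A = "{v \<in> pverts ?K. (a, v) \<in> (parcs ?K)\<^sup>*}"
  let ?B = "pverts ?K - ?A"
  have "?B \<noteq> {}"
  proof
    assume "?B = {}"
    then have reach: "(a, v) \<in> (parcs ?K)\<^sup>*" if "v \<in> pverts ?K" for v using that by blast
    have "(u, v) \<in> (parcs ?K)\<^sup>*" if "u \<in> pverts ?K" "v \<in> pverts ?K" for u v
      using reach[OF that(1)] reach[OF that(2)] sym by (meson rtrancl_trans symD)
    then have "conn ?K" using pK a unfolding conn_def by blast
    with cut show False ..
  qed
  moreover have "?A \<noteq> {}" using a by blast
  moreover have "separation G c ?A ?B"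
  proof
    fix x y assume x: "x \<in> ?A" and y: "y \<in> ?B"
    show "(x, y) \<notin> parcs G"
    proof
      assume "(x, y) \<in> parcs G"
      then have "(x, y) \<in> parcs ?K" using x y by auto
      then have "(a, y) \<in> (parcs ?K)\<^sup>*" using x by (blast intro: rtrancl_into_rtrancl)
      then show False using y by blast
    qed
  qed (use G c in auto)
  ultimately show ?thesis using that by blast
qed

lemma blocks_nonseparable:
  assumes "nonseparable G"
  shows "blocks G = {G}"
proof -
  have pG: "pair_graph G" using assms by (simp add: nonseparable_def conn_def)
  show ?thesis
    using assms blocks_iff[OF pG] subgr_antisym[of _ G] by (auto simp: subgr_def)
qed

text \<open>
  Blocks of \<open>G\<close> are the blocks of the two sides of a cut-vertex, so both formulas follow by
  induction on the number of vertices. The second one is written without division because cofactor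
  sums of blocks may vanish.
\<close>

theorem dist_cof_det_blocks:
  assumes "conn G" "2 \<le> card (pverts G)"
  shows "dist_cof G = (\<Prod>B\<in>blocks G. dist_cof B)" (is "?cof G")
    and "dist_det G = (\<Sum>B\<in>blocks G. dist_det B * (\<Prod>C\<in>blocks G - {B}. dist_cof C))" (is "?det G")
proof -
  have "?cof G \<and> ?det G"
    using assms
  proof (induction "card (pverts G)" arbitrary: G rule: less_induct)
    case less
    show ?case
    proof (cases "nonseparable G")
      case True
      then show ?thesis by (simp add: blocks_nonseparable)
    next
      case False
      then obtain c where "c \<in> pverts G" "pverts G \<noteq> {c}" "\<not> conn (induce G (pverts G - {c}))"
        using less.prems(1) by (auto simp: nonseparable_def)
      then obtain A B where "separation G c A B" and ne: "A \<noteq> {}" "B \<noteq> {}"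
        using separation_exists[OF less.prems(1)] by metis
      then interpret S: separation G c A B by simp
      have fin: "finite (blocks S.left)" "finite (blocks S.right)"
        using S.conn_left S.conn_right by (auto simp: conn_def intro: finite_blocks)
      have card: "card (pverts G) = Suc (card A + card B)" "card A > 0" "card B > 0"
        using S.verts S.disjoint S.finite ne by (auto simp: card_Un_disjoint card_gt_0_iff)
      note b = S.blocks_separation[OF ne]
      have L: "?cof S.left" "?det S.left"
        using less.hyps[of S.left] S.conn_left card S.finite S.disjoint by auto
      have R: "?cof S.right" "?det S.right"
        using less.hyps[of S.right] S.conn_right card S.finite S.disjoint by auto
      have "(\<Prod>C\<in>blocks G - {B}. dist_cof C) =
          (\<Prod>C\<in>blocks S.left - {B}. dist_cof C) * dist_cof S.right" if "B \<in> blocks S.left" for B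
      proof -
        have "blocks G - {B} = (blocks S.left - {B}) \<union> blocks S.right" using that b by auto
        moreover have "(blocks S.left - {B}) \<inter> blocks S.right = {}" using b(2) by blast
        ultimately show ?thesis using R(1) fin by (simp add: prod.union_disjoint)
      qed
      moreover have "(\<Prod>C\<in>blocks G - {B}. dist_cof C) =
          (\<Prod>C\<in>blocks S.right - {B}. dist_cof C) * dist_cof S.left" if "B \<in> blocks S.right" for B
      proof -
        have "blocks G - {B} = (blocks S.right - {B}) \<union> blocks S.left" using that b by auto
        moreover have "(blocks S.right - {B}) \<inter> blocks S.left = {}" using b(2) by blast
        ultimately show ?thesis using L(1) fin by (simp add: prod.union_disjoint)
      qed
      ultimately have "(\<Sum>B\<in>blocks G. dist_det B * (\<Prod>C\<in>blocks G - {B}. dist_cof C)) =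
          dist_det S.left * dist_cof S.right + dist_det S.right * dist_cof S.left"
        unfolding L(2) R(2) by (subst b(1), subst sum.union_disjoint[OF fin b(2)])
          (simp add: sum_distrib_right mult.assoc)
      moreover have "(\<Prod>B\<in>blocks G. dist_cof B) = dist_cof S.left * dist_cof S.right"
        using b fin L(1) R(1) by (simp add: prod.union_disjoint)
      ultimately show ?thesis using S.dist_cof_separation S.dist_det_separation by simp
    qed
  qed
  then show "?cof G" "?det G" by blast+
qed

section \<open>Edges and cycles\<close>

text \<open>
  The potentials of \<open>graph_dist_eqI\<close> for all origins together. They take integer values because
  the distance formulas for cycles and \<open>\<theta>\<close>-graphs involve subtraction.
\<close>

lemma dist_functionI:
  fixes D :: "'a \<Rightarrow> 'a \<Rightarrow> int"
  assumes G: "pair_graph G" "pverts G \<noteq> {}"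
    and nonneg: "\<And>u v. u \<in> pverts G \<Longrightarrow> v \<in> pverts G \<Longrightarrow> 0 \<le> D u v"
    and zero: "\<And>u. u \<in> pverts G \<Longrightarrow> D u u = 0"
    and step: "\<And>u a b. u \<in> pverts G \<Longrightarrow> (a, b) \<in> parcs G \<Longrightarrow> D u b \<le> D u a + 1"
    and closer: "\<And>u v. u \<in> pverts G \<Longrightarrow> v \<in> pverts G \<Longrightarrow> v \<noteq> u \<Longrightarrow>
      \<exists>w. (w, v) \<in> parcs G \<and> D u w < D u v"
  shows "conn G"
    and "\<And>u v. u \<in> pverts G \<Longrightarrow> v \<in> pverts G \<Longrightarrow> int (graph_dist G u v) = D u v"
proof -
  have E: "parcs G \<subseteq> pverts G \<times> pverts G" using G by (simp add: pair_graph_iff)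
  show "int (graph_dist G u v) = D u v" if u: "u \<in> pverts G" and v: "v \<in> pverts G" for u v
  proof -
    have "graph_dist G u v = nat (D u v)"
    proof (rule graph_dist_eqI[OF G(1) u])
      show "nat (D u b) \<le> nat (D u a) + 1" if "(a, b) \<in> parcs G" for a b
        using step[OF u that] by linarith
      show "\<exists>w. (w, v) \<in> parcs G \<and> nat (D u v) = nat (D u w) + 1"
        if v: "v \<in> pverts G" "v \<noteq> u" for v
      proof -
        obtain w where w: "(w, v) \<in> parcs G" "D u w < D u v" using closer[OF u v] by blast
        then have "0 \<le> D u w" "D u v \<le> D u w + 1" using nonneg[OF u, of w] step[OF u] E by auto
        then show ?thesis using w by (intro exI[of _ w]) linarith
      qed
    qed (use zero[OF u] v in auto)
    then show ?thesis using nonneg[OF u v] by simp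
  qed
  have "(u, v) \<in> (parcs G)\<^sup>*" if u: "u \<in> pverts G" and "v \<in> pverts G" for u v
    using that(2)
  proof (induction "nat (D u v)" arbitrary: v rule: less_induct)
    case less
    show ?case
    proof (cases "v = u")
      case False
      then obtain w where w: "(w, v) \<in> parcs G" "D u w < D u v"
        using closer[OF u less.prems] by blast
      then have "w \<in> pverts G" using E by auto
      then have "(u, w) \<in> (parcs G)\<^sup>*" using less.hyps[of w] w(2) nonneg[OF u, of w] by auto
      then show ?thesis using w(1) by (rule rtrancl_into_rtrancl)
    qed simp
  qed
  then show "conn G" using G by (simp add: conn_def)
qed

definition cycle_dist :: "int \<Rightarrow> int \<Rightarrow> int \<Rightarrow> int" where
  "cycle_dist n i j = min \<bar>i - j\<bar> (n - \<bar>i - j\<bar>)"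

lemma parcs_cycle_graph:
  assumes "3 \<le> n"
  shows "(a, b) \<in> parcs (cycle_graph n) \<longleftrightarrow> a < n \<and> b < n \<and>
    (b = Suc a \<or> a = Suc b \<or> (a = n - 1 \<and> b = 0) \<or> (a = 0 \<and> b = n - 1))"
proof -
  have "Suc i mod n = (if i = n - 1 then 0 else Suc i)" if "i < n" for i
    using that assms by auto
  moreover have "(a, b) \<in> parcs (cycle_graph n) \<longleftrightarrow>
      (a < n \<and> b = Suc a mod n) \<or> (b < n \<and> a = Suc b mod n)"
    by (auto simp: cycle_graph_def Let_def)
  ultimately show ?thesis using assms by (auto split: if_splits)
qed

lemma pverts_cycle_graph [simp]: "pverts (cycle_graph n) = {..<n}"
  by (simp add: cycle_graph_def Let_def)

lemma pair_graph_cycle_graph: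
  assumes "3 \<le> n"
  shows "pair_graph (cycle_graph n)"
  unfolding pair_graph_iff using assms
  by (auto simp: parcs_cycle_graph sym_def irrefl_def)

lemma
  assumes n: "3 \<le> n"
  shows conn_cycle_graph: "conn (cycle_graph n)"
    and graph_dist_cycle_graph: "u < n \<Longrightarrow> v < n \<Longrightarrow>
      int (graph_dist (cycle_graph n) u v) = cycle_dist (int n) (int u) (int v)"
proof -
  let ?D = "\<lambda>u v. cycle_dist (int n) (int u) (int v)"
  have nonneg: "0 \<le> ?D u v"
    if "u \<in> pverts (cycle_graph n)" "v \<in> pverts (cycle_graph n)" for u v
    using that by (auto simp: cycle_dist_def)
  have step: "?D u b \<le> ?D u a + 1"
    if "u \<in> pverts (cycle_graph n)" "(a, b) \<in> parcs (cycle_graph n)" for u a b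
  proof -
    have "int u < int n" "int a < int n" "int b < int n"
      "int b = 1 + int a \<or> int a = 1 + int b \<or> (int a = int n - 1 \<and> int b = 0) \<or>
        (int a = 0 \<and> int b = int n - 1)"
      using that n unfolding parcs_cycle_graph[OF n] by auto
    then show ?thesis using n unfolding cycle_dist_def by linarith
  qed
  have closer: "\<exists>w. (w, v) \<in> parcs (cycle_graph n) \<and> ?D u w < ?D u v"
    if "u \<in> pverts (cycle_graph n)" "v \<in> pverts (cycle_graph n)" "v \<noteq> u" for u v
  proof -
    have uv: "u < n" "v < n" using that by auto
    define up where "up = (if v = n - 1 then 0 else v + 1)"
    define down where "down = (if v = 0 then n - 1 else v - 1)"
    have "(up, v) \<in> parcs (cycle_graph n)" "(down, v) \<in> parcs (cycle_graph n)"
      unfolding parcs_cycle_graph[OF n] using uv n by (auto simp: up_def down_def)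
    moreover have "?D u up < ?D u v \<or> ?D u down < ?D u v"
    proof -
      have "int up = (if int v = int n - 1 then 0 else int v + 1)"
        "int down = (if int v = 0 then int n - 1 else int v - 1)"
        using uv n by (auto simp: up_def down_def)
      moreover have "int u \<noteq> int v" "int u < int n" "int v < int n" "3 \<le> int n"
        "0 \<le> int u" "0 \<le> int v"
        using uv that(3) n by auto
      ultimately show ?thesis
        unfolding cycle_dist_def min_def abs_if by (smt (verit))
    qed
    ultimately show ?thesis by blast
  qed
  have zero: "?D u u = 0" for u by (simp add: cycle_dist_def)
  have ne: "pverts (cycle_graph n) \<noteq> {}" using n by (auto simp: lessThan_empty_iff)
  note * = dist_functionI[OF pair_graph_cycle_graph[OF n] ne nonneg zero step closer]
  show "conn (cycle_graph n)" by (rule *(1))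
  show "u < n \<Longrightarrow> v < n \<Longrightarrow> int (graph_dist (cycle_graph n) u v) = ?D u v"
    using *(2) by simp
qed

text \<open>
  The vector \<open>e\<^sub>a + e\<^sub>b - e\<^sub>c - e\<^sub>e\<close> has entry sum \<open>0\<close> and is in the kernel. It is nonzero since
  \<open>a\<close> differs from \<open>c\<close> and from \<open>e\<close>.
\<close>

lemma idet_four_points:
  assumes "finite V" "a \<in> V" "b \<in> V" "c \<in> V" "e \<in> V"
    and eq: "\<And>u. u \<in> V \<Longrightarrow> d u a + d u b = d u c + d u e"
    and "a \<noteq> c" "a \<noteq> e"
  shows "idet V d = 0" "idet_cof V d = 0"
proof -
  let ?i = "\<lambda>p v. if v = p then 1 else (0::real)"
  let ?x = "\<lambda>v. ?i a v + ?i b v - ?i c v - ?i e v"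
  have sum: "(\<Sum>v\<in>V. h v * ?x v) = h a + h b - h c - h e" for h :: "'a \<Rightarrow> real"
  proof -
    have "(\<Sum>v\<in>V. h v * ?x v) = (\<Sum>v\<in>V. (if v = a then h a else 0) + (if v = b then h b else 0)
        - (if v = c then h c else 0) - (if v = e then h e else 0))"
      by (rule sum.cong) auto
    then show ?thesis using assms(1-5) by (simp add: sum.distrib sum_subtractf)
  qed
  have "(\<Sum>v\<in>V. d u v * ?x v) = 0" if "u \<in> V" for u
    unfolding sum using eq[OF that] by simp
  moreover have "(\<Sum>v\<in>V. ?x v) = 0" using sum[of "\<lambda>_. 1"] by simp
  moreover have "?x a \<noteq> 0" using assms(7,8) by auto
  ultimately show "idet V d = 0" "idet_cof V d = 0"
    using idet_kernel_vector_sum_zero[OF assms(1), of d ?x a] assms(2) by blast+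
qed

lemma even_cycle:
  assumes "3 \<le> n" "even n"
  shows "dist_det (cycle_graph n) = 0" "dist_cof (cycle_graph n) = 0"
proof -
  obtain k where k: "n = 2 * k" "2 \<le> k" using assms by (auto elim!: evenE)
  \<comment> \<open>The distances to two antipodal vertices add up to half the length of the cycle.\<close>
  have d: "rdist (cycle_graph n) u 0 + rdist (cycle_graph n) u k =
      rdist (cycle_graph n) u 1 + rdist (cycle_graph n) u (k + 1)" if "u \<in> {..<n}" for u
  proof -
    have "cycle_dist (int n) (int u) (int 0) + cycle_dist (int n) (int u) (int k) =
        cycle_dist (int n) (int u) (int 1) + cycle_dist (int n) (int u) (int (k + 1))"
      using that k by (auto simp: cycle_dist_def)
    then have "graph_dist (cycle_graph n) u 0 + graph_dist (cycle_graph n) u k =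
        graph_dist (cycle_graph n) u 1 + graph_dist (cycle_graph n) u (k + 1)"
      using that k assms(1) by (subst (asm) (1 2 3 4) graph_dist_cycle_graph[symmetric]) auto
    then show ?thesis by (simp flip: of_nat_add)
  qed
  show "dist_det (cycle_graph n) = 0" "dist_cof (cycle_graph n) = 0"
    unfolding dist_det_def dist_cof_def pverts_cycle_graph
    by (rule idet_four_points[where a = 0 and b = k and c = 1 and e = "k + 1"]; use k d in simp)+
qed

text \<open>
  In the cycle of length \<open>2 k + 1\<close>, let edge \<open>i\<close> join \<open>i - 1\<close> and \<open>i\<close>. The edges at the vertex opposite
  to it are \<open>i \<plusminus> k\<close> modulo \<open>2 k + 1\<close>. Steps of size \<open>k\<close> run through all edges; starting after the edge
  \<open>2 k + 1\<close>, which is not used, they meet \<open>k, 2 k, k - 1, 2 k - 1, \<dots>, 1, k + 1\<close>. The function gives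
  the place of \<open>i\<close> in this list.
\<close>

definition cycle_edge_pos :: "int \<Rightarrow> int \<Rightarrow> int" where
  "cycle_edge_pos k i = (if i \<le> k then 2 * (k - i) else 2 * (2 * k - i) + 1)"

definition cycle_rdist :: "int \<Rightarrow> int \<Rightarrow> int \<Rightarrow> real" where
  "cycle_rdist n i j = real_of_int (cycle_dist n i j)"

lemma inj_on_cycle_edge_pos: "inj_on (cycle_edge_pos k) W"
proof (rule inj_onI)
  show "i = j" if "cycle_edge_pos k i = cycle_edge_pos k j" for i j
    using that unfolding cycle_edge_pos_def by presburger
qed

lemma cycle_edge_pos_adjacent:
  assumes "i \<in> {1..2 * k}" "j \<in> {1..2 * k}"
  shows "\<bar>cycle_edge_pos k i - cycle_edge_pos k j\<bar> = 1 \<longleftrightarrow> \<bar>i - j\<bar> = k \<or> \<bar>i - j\<bar> = k + 1"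
proof -
  have even: "\<bar>2 * a\<bar> \<noteq> 1" and odd: "\<bar>2 * a - 1\<bar> = 1 \<longleftrightarrow> a = 0 \<or> a = 1" for a :: int
    by presburger+
  consider "i \<le> k" "j \<le> k" | "k < i" "k < j" | "i \<le> k" "k < j" | "k < i" "j \<le> k" by linarith
  then show ?thesis
  proof cases
    case 1
    then have "cycle_edge_pos k i - cycle_edge_pos k j = 2 * (j - i)"
      by (simp add: cycle_edge_pos_def)
    moreover have "\<bar>i - j\<bar> < k" using 1 assms by simp
    ultimately show ?thesis using even[of "j - i"] by simp
  next
    case 2
    then have "cycle_edge_pos k i - cycle_edge_pos k j = 2 * (j - i)"
      by (simp add: cycle_edge_pos_def)
    moreover have "\<bar>i - j\<bar> < k" using 2 assms by simp
    ultimately show ?thesis using even[of "j - i"] by simp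
  next
    case 3
    then have "cycle_edge_pos k i - cycle_edge_pos k j = 2 * (j - i - k) - 1"
      by (simp add: cycle_edge_pos_def)
    then show ?thesis using odd[of "j - i - k"] 3 assms by auto
  next
    case 4
    then have "cycle_edge_pos k j - cycle_edge_pos k i = 2 * (i - j - k) - 1"
      by (simp add: cycle_edge_pos_def)
    then show ?thesis
      using odd[of "i - j - k"] 4 assms abs_minus_commute[of "cycle_edge_pos k i"] by auto
  qed
qed

text \<open>
  The form is the negative second difference of \<open>t \<mapsto> min \<bar>t\<bar> (2 k + 1 - \<bar>t\<bar>)\<close> at \<open>t = i - j\<close>. This
  function bends only at \<open>0\<close> and at its maximum, which is attained at \<open>\<bar>t\<bar> = k\<close> and \<open>\<bar>t\<bar> = k + 1\<close>.
\<close>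

lemma diff_form_odd_cycle:
  assumes "i \<in> {1..2 * k}" "j \<in> {1..2 * k}"
  shows "diff_form (\<lambda>i. i - 1) (cycle_rdist (2 * k + 1)) i j =
    (if i = j then -2 else if \<bar>cycle_edge_pos k i - cycle_edge_pos k j\<bar> = 1 then 1 else 0)"
proof -
  let ?d = "cycle_dist (2 * k + 1)"
  have peak: "2 * min t (2 * k + 1 - t) - min (t + 1) (2 * k - t) - min (t - 1) (2 * k + 2 - t) =
      (if t = k \<or> t = k + 1 then 1 else 0)" if "1 \<le> t" "t < 2 * k" for t
    using that by (cases "t < k"; cases "t = k"; cases "t = k + 1"; auto)
  have "?d i j - ?d (i - 1) j - ?d i (j - 1) + ?d (i - 1) (j - 1) =
      (if i = j then -2 else if \<bar>i - j\<bar> = k \<or> \<bar>i - j\<bar> = k + 1 then 1 else 0)"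
  proof (cases i j rule: linorder_cases)
    case less
    then show ?thesis using peak[of "j - i"] assms by (simp add: cycle_dist_def algebra_simps)
  next
    case equal
    then show ?thesis using assms by (auto simp: cycle_dist_def)
  next
    case greater
    then show ?thesis using peak[of "i - j"] assms by (simp add: cycle_dist_def algebra_simps)
  qed
  moreover have "diff_form (\<lambda>i. i - 1) (cycle_rdist (2 * k + 1)) i j =
      real_of_int (?d i j - ?d (i - 1) j - ?d i (j - 1) + ?d (i - 1) (j - 1))"
    by (simp add: diff_form_def cycle_rdist_def)
  ultimately show ?thesis using cycle_edge_pos_adjacent[OF assms] by simp
qed

lemma idet_odd_cycle_edges:
  assumes W: "W \<subseteq> {1..2 * k}" "card W = n"
    and "\<And>i. i \<in> W \<Longrightarrow> 0 \<le> cycle_edge_pos k i \<and> cycle_edge_pos k i < int n"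
  shows "idet W (diff_form (\<lambda>i. i - 1) (cycle_rdist (2 * k + 1))) = (-1) ^ n * (real n + 1)"
proof (rule idet_path[where pos = "cycle_edge_pos k"])
  show "finite W" using W(1) by (rule finite_subset) simp
  fix i j assume "i \<in> W" "j \<in> W"
  then show "diff_form (\<lambda>i. i - 1) (cycle_rdist (2 * k + 1)) i j =
      (if i = j then -2 else if \<bar>cycle_edge_pos k i - cycle_edge_pos k j\<bar> = 1 then 1 else 0)"
    using W(1) by (intro diff_form_odd_cycle) auto
qed (use assms inj_on_cycle_edge_pos in auto)

lemma idet_cof_odd_cycle:
  assumes "0 \<le> k"
  shows "idet_cof {0..2 * k} (cycle_rdist (2 * k + 1)) = 2 * real_of_int k + 1"
proof -
  let ?d = "cycle_rdist (2 * k + 1)"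
  have "idet_cof {0..2 * k} ?d = idet ({0..2 * k} - {0}) (diff_form (\<lambda>i. i - 1) ?d)"
    by (rule idet_cof_eq_diff_form[where rk = nat]) (use assms in auto)
  also have "{0..2 * k} - {0} = {1..2 * k}" by auto
  also have "idet {1..2 * k} (diff_form (\<lambda>i. i - 1) ?d) = (-1) ^ nat (2 * k) * (real (nat (2 * k)) + 1)"
    by (rule idet_odd_cycle_edges) (use assms in \<open>auto simp: cycle_edge_pos_def\<close>)
  finally show ?thesis using assms by (simp add: nat_mult_distrib)
qed

lemma sum_int_upto:
  assumes "0 \<le> (k::int)"
  shows "2 * (\<Sum>j=0..k. j) = k * (k + 1)"
  using assms
proof (induction k rule: int_ge_induct)
  case (step k)
  then have "{0..k + 1} = insert (k + 1) {0..k}" by auto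
  then show ?case using step by (simp add: algebra_simps)
qed simp

lemma sum_cycle_dist:
  assumes "0 \<le> i" "i \<le> 2 * k"
  shows "(\<Sum>j=0..2 * k. cycle_dist (2 * k + 1) i j) = k * (k + 1)"
proof -
  let ?n = "2 * k + 1"
  have "(\<Sum>j=0..2 * k. cycle_dist ?n i j) = (\<Sum>j=0..2 * k. min j (?n - j))"
    by (rule sum.reindex_bij_witness[where j = "\<lambda>j. if i \<le> j then j - i else ?n + j - i"
          and i = "\<lambda>t. if i + t < ?n then i + t else i + t - ?n"])
      (use assms in \<open>auto simp: cycle_dist_def\<close>)
  also have "\<dots> = (\<Sum>j=0..k. min j (?n - j)) + (\<Sum>j=k + 1..2 * k. min j (?n - j))"
  proof -
    have "{0..2 * k} = {0..k} \<union> {k + 1..2 * k}" "{0..k} \<inter> {k + 1..2 * k} = {}"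
      using assms by auto
    then show ?thesis by (simp add: sum.union_disjoint)
  qed
  also have "(\<Sum>j=k + 1..2 * k. min j (?n - j)) = (\<Sum>j=1..k. j)"
    by (rule sum.reindex_bij_witness[where j = "\<lambda>j. ?n - j" and i = "\<lambda>j. ?n - j"]) auto
  also have "(\<Sum>j=1..k. j) = (\<Sum>j=0..k. j)"
    by (rule sum.mono_neutral_left) auto
  also have "(\<Sum>j=0..k. min j (?n - j)) = (\<Sum>j=0..k. j)" by (rule sum.cong) auto
  finally show ?thesis using sum_int_upto[of k] assms by simp
qed

text \<open>
  All row sums of the distance matrix are equal, so the all-ones vector is balanced.
\<close>

lemma odd_cycle:
  assumes "3 \<le> n" "odd n"
  shows "dist_cof (cycle_graph n) = real n"
    and "dist_det (cycle_graph n) = ((real n)\<^sup>2 - 1) / (4 * real n) * dist_cof (cycle_graph n)"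
proof -
  obtain k where n: "n = 2 * k + 1" using assms(2) by (auto elim!: oddE)
  let ?d = "cycle_rdist (2 * int k + 1)"
  have bij: "bij_betw int (pverts (cycle_graph n)) {0..2 * int k}"
    by (rule bij_betw_byWitness[where f' = nat]) (auto simp: n)
  have eq: "rdist (cycle_graph n) u v = ?d (int u) (int v)"
    if "u \<in> pverts (cycle_graph n)" "v \<in> pverts (cycle_graph n)" for u v
  proof -
    have "real_of_int (int (graph_dist (cycle_graph n) u v)) = ?d (int u) (int v)"
      using that graph_dist_cycle_graph[OF assms(1), of u v]
      by (simp add: cycle_rdist_def n add.commute)
    then show ?thesis by simp
  qed
  have cof: "dist_cof (cycle_graph n) = idet_cof {0..2 * int k} ?d"
    unfolding dist_cof_def by (rule idet_cof_bij[OF _ bij]) (use eq in auto)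
  then show "dist_cof (cycle_graph n) = real n" by (simp add: idet_cof_odd_cycle n)
  have "dist_det (cycle_graph n) = idet {0..2 * int k} ?d"
    unfolding dist_det_def by (rule idet_bij[OF _ bij]) (use eq in auto)
  also have "\<dots> = real (k * (k + 1)) / real n * idet_cof {0..2 * int k} ?d"
  proof (rule idet_balanced_vector[where x = "\<lambda>_. 1"])
    show "(\<Sum>v=0..2 * int k. ?d u v * 1) = real (k * (k + 1))" if "u \<in> {0..2 * int k}" for u
    proof -
      have "(\<Sum>v=0..2 * int k. ?d u v * 1) =
          real_of_int (\<Sum>v=0..2 * int k. cycle_dist (2 * int k + 1) u v)"
        unfolding of_int_sum by (simp add: cycle_rdist_def)
      also have "\<dots> = real_of_int (int k * (int k + 1))"
        using sum_cycle_dist[of u "int k"] that by simp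
      finally show ?thesis by (simp add: algebra_simps)
    qed
  qed (auto simp: n)
  also have "real (k * (k + 1)) / real n = ((real n)\<^sup>2 - 1) / (4 * real n)"
    by (simp add: n field_simps power2_eq_square)
  finally show "dist_det (cycle_graph n) = ((real n)\<^sup>2 - 1) / (4 * real n) * dist_cof (cycle_graph n)"
    by (simp only: cof)
qed

lemma single_edge:
  assumes "is_edge B"
  shows "dist_cof B = -2" "dist_det B = 1 / 2 * dist_cof B"
proof -
  let ?d = "\<lambda>x y. if x = y then 0 else (1::real)"
  obtain u v where uv: "u \<noteq> v" "B = \<lparr>pverts = {u, v}, parcs = {(u, v), (v, u)}\<rparr>"
    using assms by (auto simp: is_edge_def)
  have "pair_graph B" using uv by (auto simp: pair_graph_iff sym_def irrefl_def)
  then have "int (graph_dist B x y) = (if x = y then 0 else 1)" if "x \<in> {u, v}" "y \<in> {u, v}" for x y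
    by (rule dist_functionI(2)) (use uv that in auto)
  then have d: "graph_dist B x y = (if x = y then 0 else 1)" if "x \<in> {u, v}" "y \<in> {u, v}" for x y
    using that by (metis of_nat_0 of_nat_1 of_nat_eq_iff)
  have "dist_cof B = idet_cof {u, v} (\<lambda>x y. if x = y then 0 else 1)"
    unfolding dist_cof_def uv(2) pair_pre_digraph.simps
    by (rule idet_cof_cong) (use d uv(2) in auto)
  also have "\<dots> = idet ({u, v} - {u}) (diff_form (\<lambda>_. u) (\<lambda>x y. if x = y then 0 else 1))"
    by (rule idet_cof_eq_diff_form[where rk = "\<lambda>x. if x = u then 0 else 1"]) (use uv in auto)
  also have "{u, v} - {u} = {v}" using uv(1) by auto
  finally show cof: "dist_cof B = -2" using uv(1) by (simp add: diff_form_def)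
  have "dist_det B = idet {u, v} (\<lambda>x y. if x = y then 0 else 1)"
    unfolding dist_det_def uv(2) pair_pre_digraph.simps
    by (rule idet_cong) (use d uv(2) in auto)
  then show "dist_det B = 1 / 2 * dist_cof B" using idet_two[OF uv(1)] uv(1) cof by simp
qed

section \<open>Theta graphs and their distances\<close>

text \<open>
  Indexing the lengths by the number of the path lets the arguments below treat the three paths
  symmetrically, instead of by cases on how the parameters are ordered.
\<close>

definition general_theta :: "(nat \<Rightarrow> nat) \<Rightarrow> theta_vertex pair_pre_digraph" where
  "general_theta len =
     (let E = {(theta_point (len k) k i, theta_point (len k) k (Suc i)) |k i. k < 3 \<and> i < len k}
      in \<lparr>pverts = {theta_point (len k) k i |k i. k < 3 \<and> i \<le> len k}, parcs = E \<union> E\<inverse>\<rparr>)"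

lemma theta_graph_eq: "theta_graph l p q = general_theta ((!) [l, p, q])"
  by (simp add: theta_graph_def general_theta_def Let_def)

text \<open>
  The distance from the vertex at place \<open>x\<close> of a path of length \<open>L\<close> to the vertex at place \<open>y\<close> of a
  path of length \<open>K\<close>, if the end points are at distance \<open>m\<close>. The two minima are the distances from
  the first vertex to the end points; if both are on the same path, there is also the direct way.
\<close>

definition path_dist :: "bool \<Rightarrow> int \<Rightarrow> int \<Rightarrow> int \<Rightarrow> int \<Rightarrow> int \<Rightarrow> int" where
  "path_dist same m L x K y =
    (let r = min (min x (L - x + m) + y) (min (L - x) (x + m) + (K - y))
     in if same then min \<bar>x - y\<bar> r else r)"

text \<open>
  The routes through the end points to the places \<open>h + u\<close> and \<open>h + v\<close> of a path of length
  \<open>u + v + 2 h\<close> are longer by \<open>h\<close> than those to the places \<open>u\<close> and \<open>v\<close> of a path of length \<open>u + v\<close>.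
\<close>

lemma path_dist_complementary:
  "path_dist b m L x (u + v + 2 * h) (h + v) =
    (let r = h + min (min x (L - x + m) + v) (min (L - x) (x + m) + u)
     in if b then min \<bar>x - (h + v)\<bar> r else r)" (is ?P)
  "path_dist b m L x (u + v + 2 * h) (h + u) =
    (let r = h + min (min x (L - x + m) + u) (min (L - x) (x + m) + v)
     in if b then min \<bar>x - (h + u)\<bar> r else r)" (is ?Q)
proof -
  have *: "min (s + (h + v)) (t + (u + v + 2 * h - (h + v))) = h + min (s + v) (t + u)"
    "min (s + (h + u)) (t + (u + v + 2 * h - (h + u))) = h + min (s + u) (t + v)" for s t
    by linarith+
  show ?P ?Q
    by (simp_all only: path_dist_def Let_def *)
qed

text \<open>
  Only one of the paths may have length \<open>1\<close>, since a second one would be a parallel edge. The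
  parameter \<open>m\<close> is the smallest length, which is the distance of the two end points.
\<close>

locale theta =
  fixes len :: "nat \<Rightarrow> nat" and m :: nat
  assumes len_pos: "\<And>k. k < 3 \<Longrightarrow> 1 \<le> len k"
    and simple: "\<And>j k. j < 3 \<Longrightarrow> k < 3 \<Longrightarrow> j \<noteq> k \<Longrightarrow> len j = 1 \<Longrightarrow> len k \<noteq> 1"
    and m_le: "\<And>k. k < 3 \<Longrightarrow> m \<le> len k"
    and m_attained: "\<exists>k<3. len k = m"
begin

abbreviation "\<Theta> \<equiv> general_theta len"
abbreviation "pt k y \<equiv> theta_point (len k) k y"

lemma m_pos: "1 \<le> m"
  using m_attained len_pos by auto

lemma pverts_theta: "v \<in> pverts \<Theta> \<longleftrightarrow> (\<exists>k<3. \<exists>y\<le>len k. v = pt k y)"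
  by (auto simp: general_theta_def Let_def)

lemma parcs_theta: "(u, v) \<in> parcs \<Theta> \<longleftrightarrow> (\<exists>k<3. \<exists>i<len k.
    u = pt k i \<and> v = pt k (Suc i) \<or> u = pt k (Suc i) \<and> v = pt k i)"
  by (auto simp: general_theta_def Let_def)

lemma pt_eq_iff:
  assumes "j < 3" "k < 3" "x \<le> len j" "y \<le> len k"
  shows "pt j x = pt k y \<longleftrightarrow>
    x = 0 \<and> y = 0 \<or> x = len j \<and> y = len k \<or> j = k \<and> x = y"
  using assms len_pos[of j] len_pos[of k] by (auto simp: theta_point_def)

lemma pt_in_verts: "k < 3 \<Longrightarrow> y \<le> len k \<Longrightarrow> pt k y \<in> pverts \<Theta>"
  unfolding pverts_theta by blast

lemma pair_graph_theta: "pair_graph \<Theta>"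
proof -
  have "pverts \<Theta> \<subseteq> (\<Union>k<3. pt k ` {..len k})"
  proof
    fix v assume "v \<in> pverts \<Theta>"
    then obtain k y where "k < 3" "y \<le> len k" "v = pt k y" unfolding pverts_theta by blast
    then show "v \<in> (\<Union>k<3. pt k ` {..len k})" by (intro UN_I[of k] image_eqI[of _ _ y]) auto
  qed
  then have "finite (pverts \<Theta>)" by (rule finite_subset) simp
  moreover have "u \<noteq> v" if "(u, v) \<in> parcs \<Theta>" for u v
    using that by (auto simp: parcs_theta pt_eq_iff)
  then have "irrefl (parcs \<Theta>)" by (auto simp: irrefl_def)
  moreover have "sym (parcs \<Theta>)" unfolding sym_def parcs_theta by blast
  moreover have "parcs \<Theta> \<subseteq> pverts \<Theta> \<times> pverts \<Theta>"
  proof (rule subrelI)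
    fix u v assume "(u, v) \<in> parcs \<Theta>"
    then obtain k i where "k < 3" "i < len k"
      "u = pt k i \<and> v = pt k (Suc i) \<or> u = pt k (Suc i) \<and> v = pt k i"
      unfolding parcs_theta by blast
    then show "(u, v) \<in> pverts \<Theta> \<times> pverts \<Theta>"
      using pt_in_verts[of k i] pt_in_verts[of k "Suc i"] by auto
  qed
  ultimately show ?thesis by (simp add: pair_graph_iff)
qed

text \<open>
  Some coordinates of a vertex. Those of the two end points are ambiguous; \<open>coord_dist_pt\<close> states
  that the distance formula does not depend on the choice.
\<close>

definition coord :: "theta_vertex \<Rightarrow> nat \<times> nat" where
  "coord v = (case v of Source \<Rightarrow> (0, 0) | Sink \<Rightarrow> (0, len 0) | Inner k y \<Rightarrow> (k, y))"

definition coord_dist :: "nat \<times> nat \<Rightarrow> nat \<times> nat \<Rightarrow> int" where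
  "coord_dist a b = path_dist (fst a = fst b) (int m) (int (len (fst a))) (int (snd a))
    (int (len (fst b))) (int (snd b))"

lemma coord_dist_Pair:
  "coord_dist (j, x) (k, y) = path_dist (j = k) (int m) (int (len j)) (int x) (int (len k)) (int y)"
  by (simp add: coord_dist_def)

lemma coord_pt:
  assumes "k < 3" "y \<le> len k"
  shows "coord (pt k y) = (if y = 0 then (0, 0) else if y = len k then (0, len 0) else (k, y))"
  by (simp add: coord_def theta_point_def)

lemma path_dist_to_ends:
  assumes "0 \<le> x" "x \<le> int (len j)" "k < 3" "b \<longrightarrow> j = k"
  shows "path_dist b (int m) (int (len j)) x (int (len k)) 0 = min x (int (len j) - x + int m)"
    and "path_dist b (int m) (int (len j)) x (int (len k)) (int (len k)) =
      min (int (len j) - x) (x + int m)"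
  using assms m_le[of k] by (auto simp: path_dist_def Let_def)

lemma path_dist_from_ends:
  assumes "0 \<le> y" "y \<le> int (len k)" "k < 3" "j < 3" "b \<longrightarrow> j = k"
  shows "path_dist b (int m) (int (len j)) 0 (int (len k)) y = min y (int (len k) - y + int m)"
    and "path_dist b (int m) (int (len j)) (int (len j)) (int (len k)) y =
      min (int (len k) - y) (y + int m)"
  using assms m_le[of k] m_le[of j] by (auto simp: path_dist_def Let_def)

lemma coord_dist_pt:
  assumes "j < 3" "k < 3" "x \<le> len j" "y \<le> len k"
  shows "coord_dist (coord (pt j x)) (coord (pt k y)) = coord_dist (j, x) (k, y)"
  using assms len_pos[of j] len_pos[of k] len_pos[of 0] m_le[of 0] m_le[of j] m_le[of k]
  unfolding coord_pt[OF assms(1,3)] coord_pt[OF assms(2,4)]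
  by (auto simp: coord_dist_Pair path_dist_to_ends path_dist_from_ends)

lemma coord_dist_step: "\<bar>coord_dist a (k, Suc y) - coord_dist a (k, y)\<bar> \<le> 1"
proof -
  have lip: "\<bar>min p q - min p' q'\<bar> \<le> 1" if "\<bar>p - p'\<bar> \<le> 1" "\<bar>q - q'\<bar> \<le> 1" for p q p' q' :: int
    using that by linarith
  have ends: "\<bar>min (s + (1 + z)) (t + (K - (1 + z))) - min (s + z) (t + (K - z))\<bar> \<le> 1"
    for s t z K :: int by (rule lip) simp_all
  have "\<bar>\<bar>x - (1 + z)\<bar> - \<bar>x - z\<bar>\<bar> \<le> 1" for x z :: int by linarith
  from lip[OF this ends] ends
  show ?thesis by (simp add: coord_dist_def path_dist_def Let_def)
qed

text \<open>
  The formula is a minimum over routes; the first step back along a route that attains it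
  decreases the distance. At an end point of the paths this may be a step into another path: into
  the one of the origin, or into a shortest one if the route comes from the other end point.
\<close>

lemma coord_dist_closer:
  assumes j: "j < 3" "x \<le> len j" and k: "k < 3" "y \<le> len k" and ne: "pt k y \<noteq> pt j x"
  shows "\<exists>i<3. \<exists>z\<le>len i. (pt i z, pt k y) \<in> parcs \<Theta> \<and> coord_dist (j, x) (i, z) < coord_dist (j, x) (k, y)"
proof -
  let ?s = "min (int x) (int (len j) - int x + int m)"
  let ?t = "min (int (len j) - int x) (int x + int m)"
  have up: "(pt i (Suc z), pt i z) \<in> parcs \<Theta>" and down: "(pt i z, pt i (Suc z)) \<in> parcs \<Theta>"
    if "i < 3" "z < len i" for i z
    using that by (auto simp: parcs_theta)
  obtain s where s: "s < 3" "len s = m" using m_attained by auto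
  have along: "coord_dist (j, x) (j, z) \<le> \<bar>int x - int z\<bar>" for z
    by (simp add: coord_dist_Pair path_dist_def Let_def)
  have "coord_dist (j, x) (i, z) \<le> min (?s + int z) (?t + (int (len i) - int z))" for i z
    by (cases "j = i"; simp only: coord_dist_Pair path_dist_def Let_def if_True if_False simp_thms
        min.cobounded2 order.refl)
  then have via: "coord_dist (j, x) (i, z) \<le> ?s + int z"
    "coord_dist (j, x) (i, z) \<le> ?t + (int (len i) - int z)" for i z
    by (meson min.boundedE)+
  have choice: "(if b then min p (min q r) else min q r) = q \<or>
      (if b then min p (min q r) else min q r) = r \<or> b \<and> (if b then min p (min q r) else min q r) = p"
    for b and p q r :: int by (auto simp: min_def)
  have D: "coord_dist (j, x) (k, y) = ?s + int y \<or>
      coord_dist (j, x) (k, y) = ?t + (int (len k) - int y) \<or>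
      j = k \<and> coord_dist (j, x) (k, y) = \<bar>int x - int y\<bar>"
    unfolding coord_dist_Pair path_dist_def Let_def by (rule choice)
  consider "coord_dist (j, x) (k, y) = ?s + int y" "0 < y"
    | "coord_dist (j, x) (k, y) = ?s" "y = 0"
    | "coord_dist (j, x) (k, y) = ?t + (int (len k) - int y)" "y < len k"
    | "coord_dist (j, x) (k, y) = ?t" "y = len k"
    | "j = k" "x \<noteq> y" "coord_dist (j, x) (k, y) = \<bar>int x - int y\<bar>"
    using D k ne by force
  then show ?thesis
  proof cases
    case 1
    then have "coord_dist (j, x) (k, y - 1) < coord_dist (j, x) (k, y)"
      using via(1)[of k "y - 1"] by linarith
    moreover have "(pt k (y - 1), pt k y) \<in> parcs \<Theta>"
      using down[of k "y - 1"] k 1(2) by simp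
    ultimately show ?thesis using k by (intro exI[of _ k] conjI exI[of _ "y - 1"]) auto
  next
    case 2
    have x: "0 < x" using ne 2 by (cases x) (auto simp: theta_point_def)
    show ?thesis
    proof (cases "int x \<le> int (len j) - int x + int m")
      case True
      then have "coord_dist (j, x) (j, 1) < coord_dist (j, x) (k, y)"
        using along[of 1] 2 x by linarith
      moreover have "(pt j 1, pt k y) \<in> parcs \<Theta>"
        using up[of j 0] j x 2(2) by (simp add: theta_point_def)
      ultimately show ?thesis using j x by (intro exI[of _ j] conjI exI[of _ 1]) auto
    next
      case False
      then have "coord_dist (j, x) (s, 1) < coord_dist (j, x) (k, y)"
        using via(2)[of s 1] 2 s m_pos j by linarith
      moreover have "(pt s 1, pt k y) \<in> parcs \<Theta>"
        using up[of s 0] s m_pos 2(2) by (simp add: theta_point_def)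
      ultimately show ?thesis using s m_pos by (intro exI[of _ s] conjI exI[of _ 1]) auto
    qed
  next
    case 3
    then have "coord_dist (j, x) (k, Suc y) < coord_dist (j, x) (k, y)"
      using via(2)[of k "Suc y"] by linarith
    moreover have "(pt k (Suc y), pt k y) \<in> parcs \<Theta>" using up[of k y] k 3(2) by simp
    ultimately show ?thesis using k 3(2) by (intro exI[of _ k] conjI exI[of _ "Suc y"]) auto
  next
    case 4
    have sink: "pt i (len i) = Sink" if "i < 3" for i
      using len_pos[OF that] by (simp add: theta_point_def)
    have x: "x < len j" using ne 4 sink j k by (metis le_neq_implies_less)
    show ?thesis
    proof (cases "int (len j) - int x \<le> int x + int m")
      case True
      then have "coord_dist (j, x) (j, len j - 1) < coord_dist (j, x) (k, y)"
        using along[of "len j - 1"] 4 x by linarith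
      moreover have "(pt j (len j - 1), pt k y) \<in> parcs \<Theta>"
        using down[of j "len j - 1"] j x 4(2) sink k by simp
      ultimately show ?thesis using j by (intro exI[of _ j] conjI exI[of _ "len j - 1"]) auto
    next
      case False
      then have "coord_dist (j, x) (s, m - 1) < coord_dist (j, x) (k, y)"
        using via(1)[of s "m - 1"] 4 s m_pos j by linarith
      moreover have "(pt s (m - 1), pt k y) \<in> parcs \<Theta>"
        using down[of s "m - 1"] s m_pos 4(2) sink[of s] sink[of k] k by simp
      ultimately show ?thesis using s by (intro exI[of _ s] conjI exI[of _ "m - 1"]) auto
    qed
  next
    case 5
    show ?thesis
    proof (cases "x < y")
      case True
      then have "coord_dist (j, x) (j, y - 1) < coord_dist (j, x) (k, y)"
        using along[of "y - 1"] 5 by linarith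
      moreover have "(pt j (y - 1), pt k y) \<in> parcs \<Theta>"
        using down[of j "y - 1"] j k 5(1) True by simp
      ultimately show ?thesis using j k 5(1) by (intro exI[of _ j] conjI exI[of _ "y - 1"]) auto
    next
      case False
      then have "coord_dist (j, x) (j, Suc y) < coord_dist (j, x) (k, y)"
        using along[of "Suc y"] 5 by linarith
      moreover have "(pt j (Suc y), pt k y) \<in> parcs \<Theta>"
        using up[of j y] j k 5 False by simp
      ultimately show ?thesis using j 5 False by (intro exI[of _ j] conjI exI[of _ "Suc y"]) auto
    qed
  qed
qed

lemma conn_theta: "conn \<Theta>"
  and graph_dist_theta: "j < 3 \<Longrightarrow> k < 3 \<Longrightarrow> x \<le> len j \<Longrightarrow> y \<le> len k \<Longrightarrow>
    int (graph_dist \<Theta> (pt j x) (pt k y)) =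
      path_dist (j = k) (int m) (int (len j)) (int x) (int (len k)) (int y)"
proof -
  let ?D = "\<lambda>u v. coord_dist (coord u) (coord v)"
  have ne: "pverts \<Theta> \<noteq> {}" using pt_in_verts[of 0 0] by auto
  have nonneg: "0 \<le> ?D u v" if "u \<in> pverts \<Theta>" "v \<in> pverts \<Theta>" for u v
    using that unfolding pverts_theta
    by (auto simp: coord_dist_pt coord_dist_Pair path_dist_def Let_def)
  have zero: "?D u u = 0" if "u \<in> pverts \<Theta>" for u
    using that unfolding pverts_theta
    by (auto simp: coord_dist_pt coord_dist_Pair path_dist_def Let_def)
  have step: "?D u b \<le> ?D u a + 1" if ab: "u \<in> pverts \<Theta>" "(a, b) \<in> parcs \<Theta>" for u a b
  proof -
    obtain k i where k: "k < 3" "i < len k"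
      "a = pt k i \<and> b = pt k (Suc i) \<or> a = pt k (Suc i) \<and> b = pt k i"
      using ab(2) unfolding parcs_theta by blast
    obtain j x where j: "j < 3" "x \<le> len j" "u = pt j x" using ab(1) unfolding pverts_theta by blast
    have "?D u (pt k i) = coord_dist (j, x) (k, i)" "?D u (pt k (Suc i)) = coord_dist (j, x) (k, Suc i)"
      using j k by (auto intro!: coord_dist_pt)
    then show ?thesis using coord_dist_step[of "(j, x)" k i] k(3) by auto
  qed
  have closer: "\<exists>w. (w, v) \<in> parcs \<Theta> \<and> ?D u w < ?D u v"
    if uv: "u \<in> pverts \<Theta>" "v \<in> pverts \<Theta>" "v \<noteq> u" for u v
  proof -
    obtain j x where j: "j < 3" "x \<le> len j" "u = pt j x" using uv(1) unfolding pverts_theta by blast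
    obtain k y where k: "k < 3" "y \<le> len k" "v = pt k y" using uv(2) unfolding pverts_theta by blast
    obtain i z where "i < 3" "z \<le> len i" "(pt i z, v) \<in> parcs \<Theta>"
      "coord_dist (j, x) (i, z) < coord_dist (j, x) (k, y)"
      using coord_dist_closer[OF j(1,2) k(1,2)] uv(3) j k by blast
    then show ?thesis
      using coord_dist_pt j k by (intro exI[of _ "pt i z"]) simp
  qed
  note * = dist_functionI[where D = ?D, OF pair_graph_theta ne nonneg zero step closer]
  show "conn \<Theta>" by (rule *(1))
  assume jk: "j < 3" "k < 3" "x \<le> len j" "y \<le> len k"
  then have "pt j x \<in> pverts \<Theta>" "pt k y \<in> pverts \<Theta>" by (auto intro: pt_in_verts)
  then have "int (graph_dist \<Theta> (pt j x) (pt k y)) = ?D (pt j x) (pt k y)" using *(2) by blast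
  then show "int (graph_dist \<Theta> (pt j x) (pt k y)) =
      path_dist (j = k) (int m) (int (len j)) (int x) (int (len k)) (int y)"
    using coord_dist_pt[OF jk] by (simp add: coord_dist_Pair)
qed

lemma rdist_theta:
  assumes "j < 3" "k < 3" "x \<le> len j" "y \<le> len k"
  shows "rdist \<Theta> (pt j x) (pt k y) =
    real_of_int (path_dist (j = k) (int m) (int (len j)) (int x) (int (len k)) (int y))"
  using graph_dist_theta[OF assms] by (metis of_int_of_nat_eq)

section \<open>Singular theta graphs\<close>

text \<open>
  For \<open>h = 0\<close>, \<open>w\<close> is a place on a path of length \<open>u + v\<close> whose end points have distance \<open>m'\<close>, and
  \<open>A\<close> and \<open>B\<close> are the lengths of shortest routes from \<open>w\<close> through an end point to the places \<open>u\<close> and \<open>v\<close>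
  of a path of this length. Positive \<open>h\<close> serves the longer path, with \<open>w\<close> counted from its place \<open>h\<close>. The
  condition \<open>v - u \<le> m'\<close> ensures that routes using the third path are not shorter than those around
  the even cycle.
\<close>

lemma balanced_quadruple:
  fixes u v w h m' :: int
  assumes "0 \<le> u" "u < v" "v - u \<le> m'" "0 \<le> h" "- h \<le> w" "w \<le> u + v + h"
  defines "A \<equiv> min (min w (u + v - w + m') + u) (min (u + v - w) (w + m') + v)"
    and "B \<equiv> min (min w (u + v - w + m') + v) (min (u + v - w) (w + m') + u)"
  shows "A + \<bar>w - v\<bar> = B + \<bar>w - u\<bar>" "\<bar>w - u\<bar> \<le> A + 2 * h" "\<bar>w - v\<bar> \<le> B + 2 * h"
proof -
  consider "w \<le> u" | "u \<le> w" "w \<le> v" | "v \<le> w" by linarith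
  then have "A = w + u \<and> B = w + v \<and> w \<le> u \<or> A = w + u \<and> B = u + v - w + u \<and> u \<le> w \<and> w \<le> v \<or>
      A = u + v + v - w \<and> B = u + v - w + u \<and> v \<le> w"
  proof cases
    case 1
    then have "A = w + u \<and> B = w + v" unfolding A_def B_def using assms(1-3) by auto
    then show ?thesis using 1 by simp
  next
    case 2
    then have "A = w + u \<and> B = u + v - w + u" unfolding A_def B_def using assms(1-3) by auto
    then show ?thesis using 2 by simp
  next
    case 3
    then have "A = u + v + v - w \<and> B = u + v - w + u" unfolding A_def B_def using assms(1-3) by auto
    then show ?thesis using 3 by simp
  qed
  then show "A + \<bar>w - v\<bar> = B + \<bar>w - u\<bar>" "\<bar>w - u\<bar> \<le> A + 2 * h" "\<bar>w - v\<bar> \<le> B + 2 * h"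
    using assms(1-6) by auto
qed

text \<open>
  The antipode of the place \<open>u\<close> of path \<open>j\<close> in the even cycle formed by the paths \<open>j\<close> and \<open>k\<close>, of
  length \<open>2 (u + v + h)\<close>, is the place \<open>h + v\<close> of path \<open>k\<close>, and likewise with \<open>u\<close> and \<open>v\<close> exchanged.
  The two antipodal pairs have the same sum of distances to every vertex, also to those of the
  third path, because from there one reaches both pairs through the same end points. The pairs
  are different unless \<open>u = h = 0\<close>, when both consist of the two end points.
\<close>

lemma theta_singular:
  assumes jk: "j < 3" "k < 3" "j \<noteq> k"
    and uv: "len j = u + v" "len k = u + v + 2 * h" "u < v" "v - u \<le> m" "0 < u + h"
  shows "dist_det \<Theta> = 0" "dist_cof \<Theta> = 0"
proof -
  let ?a = "pt j u" and ?b = "pt k (h + v)" and ?c = "pt j v" and ?e = "pt k (h + u)"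
  let ?m = "int m" and ?u = "int u" and ?v = "int v" and ?h = "int h"
  have fin: "finite (pverts \<Theta>)" using pair_graph_theta by (simp add: pair_graph_iff)
  have vs: "?a \<in> pverts \<Theta>" "?b \<in> pverts \<Theta>" "?c \<in> pverts \<Theta>" "?e \<in> pverts \<Theta>"
    using pt_in_verts[of j u] pt_in_verts[of k "h + v"] pt_in_verts[of j v] pt_in_verts[of k "h + u"]
      jk uv(1,2) by simp_all
  have ne: "?a \<noteq> ?c" "?a \<noteq> ?e"
    using jk uv by (subst pt_eq_iff; auto)+
  have eq: "rdist \<Theta> z ?a + rdist \<Theta> z ?b = rdist \<Theta> z ?c + rdist \<Theta> z ?e" if "z \<in> pverts \<Theta>" for z
  proof -
    from that obtain i x where z: "i < 3" "x \<le> len i" "z = pt i x" unfolding pverts_theta by blast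
    let ?P = "\<lambda>n y. path_dist (i = n) ?m (int (len i)) (int x) (int (len n)) y"
    have d: "rdist \<Theta> z ?a = real_of_int (?P j ?u)" "rdist \<Theta> z ?b = real_of_int (?P k (?h + ?v))"
      "rdist \<Theta> z ?c = real_of_int (?P j ?v)" "rdist \<Theta> z ?e = real_of_int (?P k (?h + ?u))"
      using rdist_theta[OF z(1) jk(1) z(2), of u] rdist_theta[OF z(1) jk(2) z(2), of "h + v"]
        rdist_theta[OF z(1) jk(1) z(2), of v] rdist_theta[OF z(1) jk(2) z(2), of "h + u"] uv(1,2) z(3)
      by simp_all
    have bounds: "0 \<le> ?u" "?u < ?v" "?v - ?u \<le> ?m" "0 \<le> ?h" using uv(3,4) by auto
    have len: "int (len j) = ?u + ?v" "int (len k) = ?u + ?v + 2 * ?h" using uv(1,2) by simp_all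
    have "?P j ?u + ?P k (?h + ?v) = ?P j ?v + ?P k (?h + ?u)"
    proof -
      define s where "s = min (int x) (int (len i) - int x + ?m)"
      define t where "t = min (int (len i) - int x) (int x + ?m)"
      let ?A = "min (s + ?u) (t + ?v)" and ?B = "min (s + ?v) (t + ?u)"
      note c = path_dist_complementary[where u = ?u and v = ?v and h = 0 and x = "int x"
          and L = "int (len i)" and m = ?m and b = "i = j",
          unfolded mult_zero_right add_0_right add_0 Let_def, folded s_def t_def]
      have pj: "?P j ?u = (if i = j then min \<bar>int x - ?u\<bar> ?A else ?A)"
        "?P j ?v = (if i = j then min \<bar>int x - ?v\<bar> ?B else ?B)"
        unfolding len by (rule c)+
      have pk: "?P k (?h + ?v) = (if i = k then min \<bar>int x - (?h + ?v)\<bar> (?h + ?B) else ?h + ?B)"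
        "?P k (?h + ?u) = (if i = k then min \<bar>int x - (?h + ?u)\<bar> (?h + ?A) else ?h + ?A)"
        unfolding len path_dist_complementary Let_def s_def t_def by (rule refl)+
      consider "i = j" | "i = k" | "i \<noteq> j" "i \<noteq> k" by blast
      then show ?thesis
      proof cases
        case 1
        have x: "- 0 \<le> int x" "int x \<le> ?u + ?v + 0" using z(2) uv(1) 1 by auto
        note b = balanced_quadruple[OF bounds(1-3) order.refl x]
        have "min (int x) (?u + ?v - int x + ?m) = s" "min (?u + ?v - int x) (int x + ?m) = t"
          unfolding s_def t_def 1 len by (rule refl)+
        note b' = b[unfolded this mult_zero_right add_0_right]
        have ij: "(i = j) = True" "(i = k) = False" using 1 jk(3) by auto
        have "\<bar>int x - ?u\<bar> + (?h + ?B) = \<bar>int x - ?v\<bar> + (?h + ?A)"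
          using b'(1) by (metis add.assoc add.commute)
        then show ?thesis
          unfolding ij pj[unfolded ij if_True] pk[unfolded ij if_False]
            min.absorb1[OF b'(2)] min.absorb1[OF b'(3)] .
      next
        case 2
        have x: "- ?h \<le> int x - ?h" "int x - ?h \<le> ?u + ?v + ?h" using z(2) uv(2) 2 by auto
        define A where "A = min (min (int x - ?h) (?u + ?v - (int x - ?h) + ?m) + ?u)
            (min (?u + ?v - (int x - ?h)) (int x - ?h + ?m) + ?v)"
        define B where "B = min (min (int x - ?h) (?u + ?v - (int x - ?h) + ?m) + ?v)
            (min (?u + ?v - (int x - ?h)) (int x - ?h + ?m) + ?u)"
        note b = balanced_quadruple[OF bounds x, folded A_def B_def, unfolded diff_diff_eq]
        have e: "min (int x - ?h) (?u + ?v - (int x - ?h) + ?m) = s - ?h"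
          "min (?u + ?v - (int x - ?h)) (int x - ?h + ?m) = t - ?h"
          unfolding s_def t_def 2 len by linarith+
        have st: "?A = ?h + A" "?B = ?h + B"
          unfolding A_def B_def e by linarith+
        have ik: "(i = k) = True" "(i = j) = False" using 2 jk(3) by auto
        have le: "\<bar>int x - (?h + ?u)\<bar> \<le> ?h + (?h + A)" "\<bar>int x - (?h + ?v)\<bar> \<le> ?h + (?h + B)"
          using b by linarith+
        have "?h + A + \<bar>int x - (?h + ?v)\<bar> = ?h + B + \<bar>int x - (?h + ?u)\<bar>"
          using b(1) by linarith
        then show ?thesis
          unfolding ik pk[unfolded ik if_True] pj[unfolded ik if_False] st
            min.absorb1[OF le(1)] min.absorb1[OF le(2)] .
      next
        case 3
        then show ?thesis unfolding pj pk by simp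
      qed
    qed
    then have "real_of_int (?P j ?u + ?P k (?h + ?v)) = real_of_int (?P j ?v + ?P k (?h + ?u))" by simp
    then show ?thesis unfolding d by simp
  qed
  show "dist_det \<Theta> = 0"
    unfolding dist_det_def by (rule idet_four_points(1)[OF fin vs eq ne])
  show "dist_cof \<Theta> = 0"
    unfolding dist_cof_def by (rule idet_four_points(2)[OF fin vs eq ne])
qed

end

section \<open>Nonsingular theta graphs\<close>

text \<open>
  A path together with a shortest way between its end points is an isometric cycle.
\<close>

lemma path_dist_same:
  assumes "0 \<le> x" "x \<le> L" "0 \<le> y" "y \<le> L" "0 \<le> m"
  shows "path_dist True m L x L y = cycle_dist (L + m) x y"
proof (cases "x \<le> y")
  case True
  then show ?thesis using assms by (auto simp: path_dist_def cycle_dist_def Let_def)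
next
  case False
  then have "y \<le> x" by simp
  then show ?thesis using assms by (auto simp: path_dist_def cycle_dist_def Let_def)
qed

lemma path_dist_chord:
  "x < g \<Longrightarrow> path_dist False 1 (2 * g) x (2 * h) y = x + min y (2 * h + 1 - y)"
  "path_dist False 1 (2 * g) g (2 * h) y = g + min y (2 * h - y)"
  "g < x \<Longrightarrow> path_dist False 1 (2 * g) x (2 * h) y = 2 * g - x + min (y + 1) (2 * h - y)"
  by (auto simp: path_dist_def Let_def)

text \<open>
  In \<open>\<theta>(1, 2 g, 2 h)\<close>, the distances of a vertex of a long path to the two end points
  grow together by \<open>1\<close> at each step until just before the middle of the path, and decrease together
  from just after it. So a step away from the middle changes all distances to the other long path
  by the same amount, and edges of different long paths interact only at both middles.
\<close>

lemma path_dist_chord_edges: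
  "path_dist False 1 (2 * g) x (2 * h) y - path_dist False 1 (2 * g) (x - 1) (2 * h) y
    - path_dist False 1 (2 * g) x (2 * h) (y + 1) + path_dist False 1 (2 * g) (x - 1) (2 * h) (y + 1) =
    (if x = g \<and> y = h \<or> x = g + 1 \<and> y + 1 = h then 1 else 0)"
proof -
  consider "x < g" | "x = g" | "x = g + 1" | "g + 1 < x" by linarith
  then show ?thesis
    by cases (simp_all add: path_dist_chord, auto)
qed

text \<open>
  The middles of the two long paths are antipodal in the even cycle formed by these.
\<close>

lemma path_dist_chord_middle:
  assumes "0 \<le> x" "x \<le> 2 * g" "0 \<le> h"
  shows "path_dist True 1 (2 * g) x (2 * g) g + path_dist False 1 (2 * g) x (2 * h) h = g + h"
proof -
  have "path_dist True 1 (2 * g) x (2 * g) g = \<bar>x - g\<bar>"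
    using assms by (subst path_dist_same) (auto simp: cycle_dist_def)
  moreover consider "x < g" | "x = g" | "g < x" by linarith
  then have "path_dist False 1 (2 * g) x (2 * h) h = g + h - \<bar>x - g\<bar>"
    by cases (use assms in \<open>simp_all add: path_dist_chord\<close>)
  ultimately show ?thesis by simp
qed

lemma cycle_edge_pos_bounds:
  assumes "i \<in> {1..2 * k}"
  shows "0 \<le> cycle_edge_pos k i" (is ?a) "cycle_edge_pos k i < 2 * k" (is ?b)
    "cycle_edge_pos k i = 0 \<longleftrightarrow> i = k" (is ?c)
    "cycle_edge_pos k i = 2 * k - 1 \<longleftrightarrow> i = k + 1" (is ?d)
    "cycle_edge_pos k i = 2 * k - 2 \<longleftrightarrow> i = 1" (is ?e)
proof -
  have parity: "2 * a \<noteq> 2 * k - 1" "2 * a + 1 \<noteq> 2 * k - 2" "2 * a + 1 \<noteq> 0" for a by presburger+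
  show ?a ?b ?c ?d ?e
    using assms parity[of "k - i"] parity[of "2 * k - i"] by (auto simp: cycle_edge_pos_def)
qed

context theta
begin

lemma finite_verts: "finite (pverts \<Theta>)"
  using pair_graph_theta by (simp add: pair_graph_iff)

text \<open>
  Number the vertices around the even cycle of length \<open>2 g + 2 h\<close> formed by the long paths, and take
  the edges of this numbering. Those of the first path form a path with ends at the middle, as in
  the odd cycle of length \<open>2 g + 1\<close>; so do those of the second path, except that one edge is missing.
  By \<open>path_dist_chord_edges\<close> the two are linked at both ends, which makes a cycle of \<open>2 g + 2 h\<close> edges
  minus one. For the ratio, the sum of the unit vectors of the two middles is balanced.
\<close>

lemma theta_one_even_even:
  assumes ijk: "i < 3" "j < 3" "k < 3" "i \<noteq> j" "i \<noteq> k" "j \<noteq> k"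
    and len: "len i = 1" "len j = 2 * g" "len k = 2 * h"
  shows "dist_cof \<Theta> = - (2 * real g + 2 * real h)"
    and "dist_det \<Theta> = (real g + real h) / 2 * dist_cof \<Theta>"
proof -
  have m: "m = 1" using m_pos m_le[OF ijk(1)] len(1) by simp
  have gh: "1 \<le> g" "1 \<le> h" using len_pos[OF ijk(2)] len_pos[OF ijk(3)] len by auto
  define p q where "p = 2 * int g" and "q = 2 * int h"
  have pq: "2 \<le> p" "2 \<le> q" using gh by (auto simp: p_def q_def)
  have D: "rdist \<Theta> (pt a x) (pt b y) =
      real_of_int (path_dist (a = b) 1 (int (len a)) (int x) (int (len b)) (int y))"
    if "a < 3" "b < 3" "x \<le> len a" "y \<le> len b" for a b x y
    using rdist_theta[OF that] m by simp
  have ends: "pt a 0 = Source" "pt a (len a) = Sink" if "a < 3" for a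
    using len_pos[OF that] by (simp_all add: theta_point_def)
  have cover: "(\<exists>x\<le>len j. v = pt j x) \<or> (\<exists>y\<le>len k. v = pt k y)" if v: "v \<in> pverts \<Theta>" for v
  proof -
    obtain n y where n: "n < 3" "y \<le> len n" "v = pt n y" using v unfolding pverts_theta by blast
    then consider "n = i" | "n = j" | "n = k" using ijk by linarith
    then show ?thesis
    proof cases
      case 1
      then have "y = 0 \<or> y = len i" using n(2) len(1) by auto
      then have "v = pt j 0 \<or> v = pt j (len j)" using n(3) 1 ends ijk by auto
      then show ?thesis by auto
    qed (use n in auto)
  qed
  define \<phi> where "\<phi> a = (if a \<le> p then pt j (nat a) else pt k (nat (p + q - a)))" for a
  let ?I = "{0..p + q - 1}"
  have bij: "bij_betw \<phi> ?I (pverts \<Theta>)"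
    unfolding bij_betw_def
  proof
    show "inj_on \<phi> ?I"
    proof (rule inj_onI)
      fix a b assume "a \<in> ?I" "b \<in> ?I" "\<phi> a = \<phi> b"
      then show "a = b"
        using pt_eq_iff[OF ijk(2,2)] pt_eq_iff[OF ijk(2,3)] pt_eq_iff[OF ijk(3,2)] pt_eq_iff[OF ijk(3,3)]
          ijk(6) len gh by (auto simp: \<phi>_def p_def q_def split: if_splits)
    qed
    show "\<phi> ` ?I = pverts \<Theta>"
    proof
      show "\<phi> ` ?I \<subseteq> pverts \<Theta>"
      proof
        fix v assume "v \<in> \<phi> ` ?I"
        then obtain a where "a \<in> ?I" "v = \<phi> a" by blast
        then show "v \<in> pverts \<Theta>"
          using pt_in_verts[OF ijk(2), of "nat a"] pt_in_verts[OF ijk(3), of "nat (p + q - a)"] len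
          by (auto simp: \<phi>_def p_def q_def)
      qed
      show "pverts \<Theta> \<subseteq> \<phi> ` ?I"
      proof
        fix v assume "v \<in> pverts \<Theta>"
        then consider x where "x \<le> len j" "v = pt j x" | y where "y \<le> len k" "v = pt k y"
          using cover by blast
        then show "v \<in> \<phi> ` ?I"
        proof cases
          case 1
          then show ?thesis
            using len pq by (intro image_eqI[of _ _ "int x"]) (auto simp: \<phi>_def p_def)
        next
          case (2 y)
          consider "y = 0" | "y = len k" | "0 < y" "y < len k" using 2(1) by linarith
          then show ?thesis
          proof cases
            case 1
            then show ?thesis using 2 ends ijk pq
              by (intro image_eqI[of _ _ 0]) (auto simp: \<phi>_def)
          next
            case 2
            have "nat p = len j" using len by (simp add: p_def)
            then show ?thesis using 2 \<open>v = pt k y\<close> ends ijk pq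
              by (intro image_eqI[of _ _ p]) (auto simp: \<phi>_def)
          next
            case 3
            then show ?thesis using \<open>v = pt k y\<close> len pq
              by (intro image_eqI[of _ _ "p + q - int y"]) (auto simp: \<phi>_def q_def)
          qed
        qed
      qed
    qed
  qed
  let ?T = "\<lambda>a b. rdist \<Theta> (\<phi> a) (\<phi> b)"
  have first: "\<phi> a = pt j (nat a)" if "a \<le> p" for a using that by (simp add: \<phi>_def)
  have second: "\<phi> a = pt k (nat (p + q - a))" if "p \<le> a" "a < p + q" for a
  proof (cases "a = p")
    case True
    then have "nat p = len j" "nat (p + q - a) = len k" using len by (auto simp: p_def q_def)
    then show ?thesis using True ends ijk by (simp add: \<phi>_def)
  qed (use that in \<open>simp add: \<phi>_def\<close>)
  have T11: "?T a b = cycle_rdist (2 * int g + 1) a b"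
    if "0 \<le> a" "a \<le> p" "0 \<le> b" "b \<le> p" for a b
    using that len ijk path_dist_same[of a "2 * int g" b 1] D[OF ijk(2,2), of "nat a" "nat b"]
    by (simp add: first p_def cycle_rdist_def)
  have T22: "?T a b = cycle_rdist (2 * int h + 1) (p + q - a) (p + q - b)"
    if "p \<le> a" "a < p + q" "p \<le> b" "b < p + q" for a b
    using that len ijk path_dist_same[of "p + q - a" "2 * int h" "p + q - b" 1]
      D[OF ijk(3,3), of "nat (p + q - a)" "nat (p + q - b)"]
    by (simp add: second q_def cycle_rdist_def)
  have T12: "?T a b = real_of_int (path_dist False 1 (2 * int g) a (2 * int h) (p + q - b))"
    if "0 \<le> a" "a \<le> p" "p \<le> b" "b < p + q" for a b
    using that len ijk D[OF ijk(2,3), of "nat a" "nat (p + q - b)"]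
    by (simp add: first second p_def q_def)
  have sym: "?T a b = ?T b a" if "a \<in> ?I" "b \<in> ?I" for a b
    using graph_dist_commute[OF conn_theta, of "\<phi> a" "\<phi> b"] bij_betwE[OF bij] that by simp
  let ?F = "diff_form (\<lambda>a. a - 1) ?T"
  define e where "e a = cycle_edge_pos (int g) a" for a
  define c where "c a = cycle_edge_pos (int h) (p + q - a + 1)" for a
  \<comment> \<open>Path \<open>j\<close> occupies the places \<open>1, \<dots>, p\<close> from one end to the other. Its last edge is
       linked to the first edge of path \<open>k\<close>, which continues from \<open>p + 1\<close>. The missing edge of path \<open>k\<close>
       is the last but one; the last one is thus cut off there and goes to place \<open>0\<close>, next to the
       first edge of path \<open>j\<close> to which it is linked.\<close>
  define pos where "pos a = (if a \<le> p then 1 + e a else if c a = q - 1 then 0 else p + 1 + c a)" for a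
  have e: "0 \<le> e a" "e a \<le> p - 1" "e a = 0 \<longleftrightarrow> a = int g" "e a = p - 1 \<longleftrightarrow> a = int g + 1"
    if "1 \<le> a" "a \<le> p" for a
    using cycle_edge_pos_bounds[of a "int g"] that by (simp_all add: e_def p_def)
  have c: "0 \<le> c a" "c a \<le> q - 1" "c a = 0 \<longleftrightarrow> p + q - a + 1 = int h"
    "c a = q - 1 \<longleftrightarrow> p + q - a = int h" "c a \<noteq> q - 2" if "p < a" "a < p + q" for a
    using cycle_edge_pos_bounds[of "p + q - a + 1" "int h"] that by (simp_all add: c_def q_def)
  have F12: "?F a b = (if \<bar>pos a - pos b\<bar> = 1 then 1 else 0)"
    if a: "1 \<le> a" "a \<le> p" and b: "p < b" "b < p + q" for a b
  proof -
    let ?P = "path_dist False 1 (2 * int g)" and ?y = "p + q - b"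
    have "?F a b = real_of_int (?P a (2 * int h) ?y - ?P (a - 1) (2 * int h) ?y
        - ?P a (2 * int h) (?y + 1) + ?P (a - 1) (2 * int h) (?y + 1))"
      using a b T12[of a b] T12[of "a - 1" b] T12[of a "b - 1"] T12[of "a - 1" "b - 1"]
      by (simp add: diff_form_def algebra_simps)
    also have "\<dots> = (if a = int g \<and> ?y = int h \<or> a = int g + 1 \<and> ?y + 1 = int h then 1 else 0)"
      unfolding path_dist_chord_edges by simp
    also have "a = int g \<and> ?y = int h \<or> a = int g + 1 \<and> ?y + 1 = int h \<longleftrightarrow> \<bar>pos a - pos b\<bar> = 1"
    proof (cases "?y = int h")
      case True
      then have "pos b = 0" using c[OF b] b by (simp add: pos_def)
      then show ?thesis using True e(1,3)[OF a] a by (auto simp: pos_def)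
    next
      case False
      then have "pos b = p + 1 + c b" using c[OF b] b by (simp add: pos_def)
      moreover have "pos a = 1 + e a" using a by (simp add: pos_def)
      ultimately have "\<bar>pos a - pos b\<bar> = p + c b - e a" using e(2)[OF a] c(1)[OF b] by simp
      moreover have "p + c b - e a = 1 \<longleftrightarrow> e a = p - 1 \<and> c b = 0"
        using e(2)[OF a] c(1)[OF b] by auto
      ultimately show ?thesis using False e(4)[OF a] c(3)[OF b] by auto
    qed
    finally show ?thesis .
  qed
  have F: "?F a b = (if a = b then -2 else if \<bar>pos a - pos b\<bar> = 1 then 1 else 0)"
    if a: "a \<in> {1..p + q - 1}" and b: "b \<in> {1..p + q - 1}" for a b
  proof -
    consider "a \<le> p" "b \<le> p" | "a \<le> p" "p < b" | "p < a" "b \<le> p" | "p < a" "p < b" by linarith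
    then show ?thesis
    proof cases
      case 1
      then have "?F a b = diff_form (\<lambda>a. a - 1) (cycle_rdist (2 * int g + 1)) a b"
        using a b by (simp add: diff_form_def T11)
      also have "\<dots> = (if a = b then -2 else
          if \<bar>e a - e b\<bar> = 1 then 1 else 0)"
        unfolding e_def by (rule diff_form_odd_cycle) (use a b 1 in \<open>auto simp: p_def\<close>)
      finally show ?thesis using 1 by (simp add: pos_def)
    next
      case 2
      then show ?thesis using F12[of a b] a b by auto
    next
      case 3
      have "?F a b = ?F b a"
        using a b sym[of a b] sym[of "a - 1" b] sym[of a "b - 1"] sym[of "a - 1" "b - 1"]
        by (simp add: diff_form_def)
      then show ?thesis using F12[of b a] a b 3 by (auto simp: abs_minus_commute)
    next
      case 4
      let ?a = "p + q - a + 1" and ?b = "p + q - b + 1"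
      have "?F a b = diff_form (\<lambda>a. a - 1) (cycle_rdist (2 * int h + 1)) ?a ?b"
        using a b 4 by (simp add: diff_form_def T22 algebra_simps)
      also have "\<dots> = (if ?a = ?b then -2 else
          if \<bar>c a - c b\<bar> = 1 then 1 else 0)"
        unfolding c_def by (rule diff_form_odd_cycle) (use a b 4 in \<open>auto simp: q_def\<close>)
      also have "\<bar>c a - c b\<bar> = 1 \<longleftrightarrow> \<bar>pos a - pos b\<bar> = 1"
        using c(1,2,5)[of a] c(1,2,5)[of b] a b 4 pq
        by (cases "c a = q - 1"; cases "c b = q - 1") (auto simp: pos_def)
      also have "?a = ?b \<longleftrightarrow> a = b" by simp
      finally show ?thesis .
    qed
  qed
  let ?n = "nat (p + q - 1)"
  have "dist_cof \<Theta> = idet_cof ?I ?T"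
    unfolding dist_cof_def by (rule idet_cof_bij[OF _ bij, symmetric]) auto
  also have "\<dots> = idet (?I - {0}) ?F"
    by (rule idet_cof_eq_diff_form[where rk = nat]) (use pq in auto)
  also have "?I - {0} = {1..p + q - 1}" by auto
  also have "idet {1..p + q - 1} ?F = (-1) ^ ?n * (real ?n + 1)"
  proof (rule idet_path[where pos = pos])
    show "inj_on pos {1..p + q - 1}"
    proof (rule inj_onI)
      fix a b assume ab: "a \<in> {1..p + q - 1}" "b \<in> {1..p + q - 1}" "pos a = pos b"
      have inj: "c a = c b \<longleftrightarrow> a = b" "e a = e b \<longleftrightarrow> a = b"
        unfolding c_def e_def inj_eq[OF inj_on_cycle_edge_pos] by simp_all
      consider "a \<le> p" "b \<le> p" | "a \<le> p" "p < b" | "p < a" "b \<le> p" | "p < a" "p < b" by linarith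
      then show "a = b"
      proof cases
        case 1
        then show ?thesis using ab(3) inj by (simp add: pos_def)
      next
        case 2
        then show ?thesis using ab e[of a] c[of b] by (auto simp: pos_def split: if_splits)
      next
        case 3
        then show ?thesis using ab e[of b] c[of a] by (auto simp: pos_def split: if_splits)
      next
        case 4
        then show ?thesis using ab inj c[of a] c[of b] pq by (auto simp: pos_def split: if_splits)
      qed
    qed
    fix a assume a: "a \<in> {1..p + q - 1}"
    show "0 \<le> pos a \<and> pos a < int ?n"
    proof (cases "a \<le> p")
      case True
      then show ?thesis using a pq e(1,2)[of a] by (simp add: pos_def)
    next
      case False
      then have "c a \<noteq> q - 1 \<Longrightarrow> c a < q - 2" using a c(2,5)[of a] by auto
      then show ?thesis using False a pq c(1)[of a] by (auto simp: pos_def)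
    qed
  qed (use F pq in auto)
  also have "(-1::real) ^ ?n = -1"
    using gh by (intro neg_one_odd_power) (auto simp: p_def q_def even_nat_iff)
  also have "real ?n + 1 = 2 * real g + 2 * real h"
    using pq by (simp add: p_def q_def)
  finally show "dist_cof \<Theta> = - (2 * real g + 2 * real h)" by simp
  let ?u = "pt j g" and ?v = "pt k h"
  have uv: "?u \<in> pverts \<Theta>" "?v \<in> pverts \<Theta>" "?u \<noteq> ?v"
    using pt_in_verts[OF ijk(2), of g] pt_in_verts[OF ijk(3), of h]
      pt_eq_iff[OF ijk(2,3), of g h] len gh ijk by auto
  have mid: "rdist \<Theta> z ?u + rdist \<Theta> z ?v = real g + real h" if "z \<in> pverts \<Theta>" for z
    using cover[OF that]
  proof (elim disjE exE conjE)
    fix x assume x: "x \<le> len j" "z = pt j x"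
    have "path_dist True 1 (2 * int g) (int x) (2 * int g) (int g) +
        path_dist False 1 (2 * int g) (int x) (2 * int h) (int h) = int g + int h"
      by (rule path_dist_chord_middle) (use x len in auto)
    then show ?thesis
      using x len ijk D[OF ijk(2,2) x(1), of g] D[OF ijk(2,3) x(1), of h] by (simp flip: of_int_add)
  next
    fix y assume y: "y \<le> len k" "z = pt k y"
    have "path_dist True 1 (2 * int h) (int y) (2 * int h) (int h) +
        path_dist False 1 (2 * int h) (int y) (2 * int g) (int g) = int h + int g"
      by (rule path_dist_chord_middle) (use y len in auto)
    then show ?thesis
      using y len ijk D[OF ijk(3,3) y(1), of h] D[OF ijk(3,2) y(1), of g] by (simp flip: of_int_add)
  qed
  let ?x = "\<lambda>z. if z = ?u \<or> z = ?v then 1 else (0::real)"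
  have sum: "(\<Sum>z\<in>pverts \<Theta>. f z * ?x z) = f ?u + f ?v" for f :: "theta_vertex \<Rightarrow> real"
  proof -
    have "(\<Sum>z\<in>pverts \<Theta>. f z * ?x z) =
        (\<Sum>z\<in>pverts \<Theta>. (if z = ?u then f ?u else 0) + (if z = ?v then f ?v else 0))"
      using uv(3) by (intro sum.cong) auto
    then show ?thesis using uv finite_verts by (simp add: sum.distrib)
  qed
  show "dist_det \<Theta> = (real g + real h) / 2 * dist_cof \<Theta>"
    unfolding dist_det_def dist_cof_def
  proof (rule idet_balanced_vector[OF finite_verts, where x = ?x])
    show "(\<Sum>v\<in>pverts \<Theta>. rdist \<Theta> u v * ?x v) = real g + real h" if "u \<in> pverts \<Theta>" for u
      unfolding sum by (rule mid[OF that])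
    show "(\<Sum>v\<in>pverts \<Theta>. ?x v) = 2" using sum[of "\<lambda>_. 1"] by simp
  qed simp
qed

text \<open>
  The paths \<open>i\<close> and \<open>k\<close> form an isometric cycle of odd length \<open>2 n + 1\<close>, numbered from the middle vertex
  of path \<open>i\<close>, and the middle vertex of path \<open>j\<close>, with number \<open>N = 2 n + 1\<close>, is a twin of vertex \<open>0\<close>.
  To the edges of the cycle, which form a path, the difference of the twins is added as a new
  element. It is linked only to the edge at vertex \<open>0\<close>, which is the last but one of the path; removing
  this edge leaves the path of the first ones and the isolated last one, the edge \<open>n + 1\<close>.
\<close>

lemma theta_two_two_odd:
  assumes ijk: "i < 3" "j < 3" "k < 3" "i \<noteq> j" "i \<noteq> k" "j \<noteq> k"
    and len: "len i = 2" "len j = 2" "len k = 2 * n - 1" and n: "2 \<le> n"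
  shows "dist_cof \<Theta> = 8 * real n - 12"
    and "dist_det \<Theta> = ((real n)\<^sup>2 - real n - 1) / (2 * real n - 3) * dist_cof \<Theta>"
proof -
  have m: "m = 2"
  proof -
    obtain s where s: "s < 3" "len s = m" using m_attained by auto
    then have "s = i \<or> s = j \<or> s = k" using ijk by linarith
    then have "2 \<le> m" using s len n by auto
    then show ?thesis using m_le[OF ijk(1)] len by simp
  qed
  define N where "N = 2 * int n + 1"
  have D: "rdist \<Theta> (pt a x) (pt b y) =
      real_of_int (path_dist (a = b) 2 (int (len a)) (int x) (int (len b)) (int y))"
    if "a < 3" "b < 3" "x \<le> len a" "y \<le> len b" for a b x y
    using rdist_theta[OF that] m by simp
  have ends: "pt a 0 = Source" "pt a (len a) = Sink" if "a < 3" for a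
    using len_pos[OF that] by (simp_all add: theta_point_def)
  have q: "int (len k) = 2 * int n - 1" using len(3) n by simp
  define \<phi> where "\<phi> a = (if a = 0 then pt i 1 else if a = N then pt j 1 else pt k (nat (a - 1)))" for a
  let ?I = "{0..N}"
  have bij: "bij_betw \<phi> ?I (pverts \<Theta>)"
    unfolding bij_betw_def
  proof
    show "inj_on \<phi> ?I"
    proof (rule inj_onI)
      fix a b assume ab: "a \<in> ?I" "b \<in> ?I" "\<phi> a = \<phi> b"
      have ne: "pt i 1 \<noteq> pt j 1" "pt i 1 \<noteq> pt k x" "pt j 1 \<noteq> pt k x" if "x \<le> len k" for x
        using that pt_eq_iff[OF ijk(1,2), of 1 1] pt_eq_iff[OF ijk(1,3), of 1 x]
          pt_eq_iff[OF ijk(2,3), of 1 x] ijk(4-6) len(1,2) by auto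
      have inj: "pt k x = pt k y \<longleftrightarrow> x = y" if "x \<le> len k" "y \<le> len k" for x y
        using pt_eq_iff[OF ijk(3,3) that] by auto
      have le: "nat (x - 1) \<le> len k" if "x \<in> ?I" "x \<noteq> N" for x
        using that q by (auto simp: N_def)
      show "a = b"
      proof (cases "a = 0 \<or> a = N \<or> b = 0 \<or> b = N")
        case True
        then show ?thesis
          using ab ne(1)[of 0] ne(2,3)[OF le[of a]] ne(2,3)[OF le[of b]]
          by (auto simp: \<phi>_def split: if_splits)
      next
        case False
        then have "nat (a - 1) = nat (b - 1)"
          using ab inj[OF le[of a] le[of b]] by (simp add: \<phi>_def)
        moreover have "1 \<le> a" "1 \<le> b" using False ab(1,2) by auto
        ultimately show ?thesis by linarith
      qed
    qed
    show "\<phi> ` ?I = pverts \<Theta>"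
    proof
      show "\<phi> ` ?I \<subseteq> pverts \<Theta>"
      proof
        fix v assume "v \<in> \<phi> ` ?I"
        then obtain a where "a \<in> ?I" "v = \<phi> a" by blast
        then show "v \<in> pverts \<Theta>"
          using pt_in_verts[OF ijk(1), of 1] pt_in_verts[OF ijk(2), of 1]
            pt_in_verts[OF ijk(3), of "nat (a - 1)"] len q n
          by (auto simp: \<phi>_def N_def)
      qed
      show "pverts \<Theta> \<subseteq> \<phi> ` ?I"
      proof
        fix v assume "v \<in> pverts \<Theta>"
        then obtain s y where s: "s < 3" "y \<le> len s" "v = pt s y" unfolding pverts_theta by blast
        have on_k: "pt k x \<in> \<phi> ` ?I" if "x \<le> len k" for x
          using that len n by (intro image_eqI[of _ _ "int x + 1"]) (auto simp: \<phi>_def N_def)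
        have end_points: "Source \<in> \<phi> ` ?I" "Sink \<in> \<phi> ` ?I"
          using on_k[of 0] on_k[of "len k"] ends[OF ijk(3)] by simp_all
        consider "s = k" | "y = 0" | "y = len s" | "s = i" "y = 1" | "s = j" "y = 1"
        proof -
          have "s = i \<or> s = j \<or> s = k" using s(1) ijk by linarith
          moreover have "y = 0 \<or> y = 1 \<or> y = 2" if "len s = 2" using s(2) that by linarith
          ultimately show ?thesis using that len(1,2) by metis
        qed
        then show "v \<in> \<phi> ` ?I"
        proof cases
          case 1
          then show ?thesis using on_k s by simp
        next
          case 2
          then show ?thesis using ends s end_points by simp
        next
          case 3
          then show ?thesis using ends s end_points by simp
        next
          case 4
          then show ?thesis using s by (intro image_eqI[of _ _ 0]) (auto simp: \<phi>_def N_def)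
        next
          case 5
          then show ?thesis using s by (intro image_eqI[of _ _ N]) (auto simp: \<phi>_def N_def)
        qed
      qed
    qed
  qed
  let ?T = "\<lambda>a b. rdist \<Theta> (\<phi> a) (\<phi> b)"
  let ?c = "cycle_rdist (2 * int n + 1)"
  have sym: "?T a b = ?T b a" if "a \<in> ?I" "b \<in> ?I" for a b
    using graph_dist_commute[OF conn_theta, of "\<phi> a" "\<phi> b"] bij_betwE[OF bij] that by simp
  have csym: "?c a b = ?c b a" for a b by (simp add: cycle_rdist_def cycle_dist_def abs_minus_commute)
  have short_path: "path_dist False 2 2 1 (2 * int n - 1) (b - 1) = cycle_dist (2 * int n + 1) 0 b"
    if "1 \<le> b" "b \<le> 2 * int n" for b
    using that by (auto simp: path_dist_def cycle_dist_def Let_def)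
  have T_path: "?T a b = ?c a b" if "1 \<le> a" "a \<le> 2 * int n" "1 \<le> b" "b \<le> 2 * int n" for a b
    using that q D[OF ijk(3,3), of "nat (a - 1)" "nat (b - 1)"]
      path_dist_same[of "a - 1" "2 * int n - 1" "b - 1" 2]
    by (simp add: \<phi>_def N_def cycle_rdist_def cycle_dist_def)
  have T_zero: "?T 0 b = ?c 0 b" and T_N: "?T N b = ?c 0 b" if "1 \<le> b" "b \<le> 2 * int n" for b
    using that q len(1,2) ijk D[OF ijk(1,3), of 1 "nat (b - 1)"] D[OF ijk(2,3), of 1 "nat (b - 1)"]
      short_path[OF that]
    by (simp_all add: \<phi>_def N_def cycle_rdist_def)
  have T_0N: "?T 0 0 = 0" "?T N N = 0" "?T 0 N = 2" "?T N 0 = 2"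
    using len(1,2) ijk D[OF ijk(1,1), of 1 1] D[OF ijk(2,2), of 1 1] D[OF ijk(1,2), of 1 1]
      D[OF ijk(2,1), of 1 1]
    by (simp_all add: \<phi>_def N_def path_dist_def Let_def)
  have T: "?T a b = ?c a b" if "0 \<le> a" "a \<le> 2 * int n" "0 \<le> b" "b \<le> 2 * int n" for a b
  proof -
    consider "a = 0" "b = 0" | "a = 0" "1 \<le> b" | "1 \<le> a" "b = 0" | "1 \<le> a" "1 \<le> b"
      using \<open>0 \<le> a\<close> \<open>0 \<le> b\<close> by linarith
    then show ?thesis
    proof cases
      case 1
      then show ?thesis using T_0N by (simp add: cycle_rdist_def cycle_dist_def)
    next
      case 2
      then show ?thesis using T_zero that by simp
    next
      case 3
      then show ?thesis using T_zero[of a] that sym[of 0 a] csym[of a 0] by (simp add: N_def)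
    next
      case 4
      then show ?thesis using T_path that by simp
    qed
  qed
  let ?\<pi> = "\<lambda>a. if a = N then 0 else a - 1"
  let ?F = "diff_form ?\<pi> ?T"
  have F_cycle: "?F a b = diff_form (\<lambda>a. a - 1) ?c a b"
    if "a \<in> {1..2 * int n}" "b \<in> {1..2 * int n}" for a b
    using that by (simp add: diff_form_def T N_def)
  have F_NN: "?F N N = -4" using T_0N by (simp add: diff_form_def)
  have F_N: "?F N b = (if b = 1 then -2 else 0)" "?F b N = (if b = 1 then -2 else 0)"
    if "b \<in> {1..2 * int n}" for b
  proof -
    have b: "b \<noteq> N" "1 \<le> b" "b \<le> 2 * int n" using that by (auto simp: N_def)
    show F: "?F N b = (if b = 1 then -2 else 0)"
    proof (cases "b = 1")
      case True
      then show ?thesis using b T_0N T_zero[of 1] T_N[of 1] by (simp add: diff_form_def)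
    next
      case False
      then show ?thesis using b T_zero[of b] T_N[of b] T_zero[of "b - 1"] T_N[of "b - 1"]
        by (simp add: diff_form_def)
    qed
    have "?F b N = ?F N b"
      using b sym[of b N] sym[of "b - 1" N] sym[of b 0] sym[of "b - 1" 0] by (simp add: diff_form_def N_def)
    then show "?F b N = (if b = 1 then -2 else 0)" using F by simp
  qed
  let ?E = "{1..2 * int n}"
  let ?G = "diff_form (\<lambda>a. a - 1) ?c"
  have "dist_cof \<Theta> = idet_cof ?I ?T"
    unfolding dist_cof_def by (rule idet_cof_bij[OF _ bij, symmetric]) auto
  also have "\<dots> = idet (?I - {0}) ?F"
    by (rule idet_cof_eq_diff_form[where rk = nat]) (auto simp: N_def)
  also have "\<dots> = ?F N N * idet (?I - {0} - {N}) ?F - ?F N 1 * ?F 1 N * idet (?I - {0} - {N, 1}) ?F"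
    by (rule idet_leaf) (use n F_N in \<open>auto simp: N_def\<close>)
  also have "?I - {0} - {N} = ?E" by (auto simp: N_def)
  also have "?I - {0} - {N, 1} = ?E - {1}" by (auto simp: N_def)
  also have "?F N N = -4" by (rule F_NN)
  also have "?F N 1 = -2" using F_N(1)[of 1] n by simp
  also have "?F 1 N = -2" using F_N(2)[of 1] n by simp
  also have "idet ?E ?F = idet ?E ?G"
    by (rule idet_cong) (use F_cycle in auto)
  also have "idet ?E ?G = 2 * real n + 1"
    using idet_odd_cycle_edges[of ?E "int n" "2 * n"] cycle_edge_pos_bounds(1,2)[of _ "int n"] by auto
  also have "idet (?E - {1}) ?F = idet (?E - {1}) ?G"
    by (rule idet_cong) (use F_cycle in auto)
  also have "idet (?E - {1}) ?G = idet ({int n + 1} \<union> (?E - {1, int n + 1})) ?G"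
    using n by (intro arg_cong2[where f = idet]) auto
  also have "\<dots> = idet {int n + 1} ?G * idet (?E - {1, int n + 1}) ?G"
  proof (rule idet_block_triangular)
    fix a b assume "a \<in> {int n + 1}" "b \<in> ?E - {1, int n + 1}"
    then have ab: "a = int n + 1" "a \<in> ?E" "b \<in> ?E" "b \<noteq> 1" "a \<noteq> b" using n by auto
    then have "\<not> (\<bar>a - b\<bar> = int n \<or> \<bar>a - b\<bar> = int n + 1)" by auto
    then show "?G a b = 0"
      unfolding diff_form_odd_cycle[OF ab(2,3)] using cycle_edge_pos_adjacent[OF ab(2,3)] ab(5) by simp
  qed auto
  also have "idet {int n + 1} ?G = -2"
    using diff_form_odd_cycle[of "int n + 1" "int n" "int n + 1"] n by simp
  also have "idet (?E - {1, int n + 1}) ?G = (-1) ^ (2 * n - 2) * (real (2 * n - 2) + 1)"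
  proof (rule idet_odd_cycle_edges)
    show "card (?E - {1, int n + 1}) = 2 * n - 2"
      using n by (subst card_Diff_subset) auto
    fix a assume "a \<in> ?E - {1, int n + 1}"
    then show "0 \<le> cycle_edge_pos (int n) a \<and> cycle_edge_pos (int n) a < int (2 * n - 2)"
      using cycle_edge_pos_bounds[of a "int n"] n by auto
  qed auto
  also have "(-1::real) ^ (2 * n - 2) = 1" using n by (simp add: right_diff_distrib')
  finally have "dist_cof \<Theta> = -4 * (2 * real n + 1) - (-2) * (-2) * (-2 * (real (2 * n - 2) + 1))"
    by simp
  then show "dist_cof \<Theta> = 8 * real n - 12" using n by (simp add: of_nat_diff)
  \<comment> \<open>On an odd cycle, \<open>2 e\<^sub>0\<close> plus the two vertices opposite to \<open>0\<close> has a constant sum of distances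
       except at \<open>0\<close> itself. With \<open>e\<^sub>0\<close> split evenly between the twins, both this vector and the
       all-ones vector of the cycle exceed a constant only at the twins, and by the same amount; so
       their difference is balanced.\<close>
  let ?x = "\<lambda>a. if a = 0 \<or> a = N then - 1 / 2 else if a = int n \<or> a = int n + 1 then 0 else (1::real)"
  have sum: "(\<Sum>a\<in>?I. f a * ?x a) = (\<Sum>a=0..2 * int n. f a)
      - 3 / 2 * f 0 - f (int n) - f (int n + 1) - 1 / 2 * f N" for f
  proof -
    have "?I = insert N {0..2 * int n}" by (auto simp: N_def)
    then have "(\<Sum>a\<in>?I. f a * ?x a) = - 1 / 2 * f N + (\<Sum>a=0..2 * int n. f a * ?x a)"
      by (simp add: N_def)
    also have "(\<Sum>a=0..2 * int n. f a * ?x a) = (\<Sum>a=0..2 * int n. f a - (if a = 0 then 3 / 2 * f 0 else 0)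
        - (if a = int n then f (int n) else 0) - (if a = int n + 1 then f (int n + 1) else 0))"
      using n by (intro sum.cong) (auto simp: N_def)
    also have "\<dots> = (\<Sum>a=0..2 * int n. f a) - 3 / 2 * f 0 - f (int n) - f (int n + 1)"
      using n by (simp add: sum_subtractf)
    finally show ?thesis by simp
  qed
  have csum: "(\<Sum>a=0..2 * int n. ?c u a) = real n * (real n + 1)" if "0 \<le> u" "u \<le> 2 * int n" for u
  proof -
    have "(\<Sum>a=0..2 * int n. ?c u a) = real_of_int (\<Sum>a=0..2 * int n. cycle_dist (2 * int n + 1) u a)"
      unfolding of_int_sum by (simp add: cycle_rdist_def)
    then show ?thesis using sum_cycle_dist[OF that] by simp
  qed
  have mids: "?c u (int n) + ?c u (int n + 1) = 2 * real n + 1 - 2 * ?c u 0"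
    if "1 \<le> u" "u \<le> 2 * int n" for u
  proof -
    have "cycle_dist (2 * int n + 1) u (int n) + cycle_dist (2 * int n + 1) u (int n + 1) =
        2 * int n + 1 - 2 * cycle_dist (2 * int n + 1) u 0"
      using that by (cases "u \<le> int n") (auto simp: cycle_dist_def)
    then have "real_of_int (cycle_dist (2 * int n + 1) u (int n) + cycle_dist (2 * int n + 1) u (int n + 1)) =
        real_of_int (2 * int n + 1 - 2 * cycle_dist (2 * int n + 1) u 0)" by simp
    then show ?thesis by (simp add: cycle_rdist_def)
  qed
  have c0: "?c 0 0 = 0" "?c 0 (int n) = real n" "?c 0 (int n + 1) = real n"
    by (simp_all add: cycle_rdist_def cycle_dist_def)
  let ?l = "(real n)\<^sup>2 - real n - 1"
  have on_cycle: "(\<Sum>a\<in>?I. ?T u a * ?x a) = ?l" if u: "0 \<le> u" "u \<le> 2 * int n" for u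
  proof -
    have "(\<Sum>a=0..2 * int n. ?T u a) = (\<Sum>a=0..2 * int n. ?c u a)"
      by (rule sum.cong) (use T u in auto)
    then have *: "(\<Sum>a\<in>?I. ?T u a * ?x a) = real n * (real n + 1)
        - 3 / 2 * ?c u 0 - ?c u (int n) - ?c u (int n + 1) - 1 / 2 * ?T u N"
      unfolding sum using csum[OF u] T u n by simp
    show ?thesis
    proof (cases "u = 0")
      case True
      then show ?thesis unfolding * using c0 T_0N by (simp add: power2_eq_square algebra_simps)
    next
      case False
      then have "1 \<le> u" using u by simp
      then have "?T u N = ?c u 0"
        using T_N[of u] sym[of u N] csym[of u 0] u by (simp add: N_def)
      then show ?thesis unfolding * using mids[OF \<open>1 \<le> u\<close> u(2)] by (simp add: power2_eq_square algebra_simps)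
    qed
  qed
  have "(\<Sum>a\<in>?I. ?T N a * ?x a) = (\<Sum>a\<in>?I. ?T 0 a * ?x a)"
  proof -
    have "(\<Sum>a\<in>?I. ?T N a * ?x a) =
        (\<Sum>a\<in>?I. ?T 0 a * ?x a + (if a = 0 then -1 else 0) + (if a = N then 1 else 0))"
    proof (rule sum.cong)
      fix a assume "a \<in> ?I"
      then have "a = 0 \<or> a = N \<or> 1 \<le> a \<and> a \<le> 2 * int n" by (auto simp: N_def)
      then consider "a = 0" | "a = N" | "1 \<le> a" "a \<le> 2 * int n" by blast
      then show "?T N a * ?x a = ?T 0 a * ?x a + (if a = 0 then -1 else 0) + (if a = N then 1 else 0)"
        by cases (use T_0N T_N T_zero in \<open>auto simp: N_def\<close>)
    qed simp
    then show ?thesis by (simp add: sum.distrib N_def)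
  qed
  then have balanced: "(\<Sum>a\<in>?I. ?T u a * ?x a) = ?l" if "u \<in> ?I" for u
    using on_cycle[of u] on_cycle[of 0] that by (cases "u = N") (auto simp: N_def)
  have "(\<Sum>a\<in>?I. ?x a) = 2 * real n - 3"
    using sum[of "\<lambda>_. 1"] by simp
  moreover have "2 * real n - 3 \<noteq> 0" using n by linarith
  ultimately have "idet ?I ?T = ?l / (2 * real n - 3) * idet_cof ?I ?T"
    by (intro idet_balanced_vector[where x = ?x] balanced) auto
  moreover have "idet ?I ?T = dist_det \<Theta>"
    unfolding dist_det_def by (rule idet_bij[OF _ bij]) auto
  moreover have "idet_cof ?I ?T = dist_cof \<Theta>"
    unfolding dist_cof_def by (rule idet_cof_bij[OF _ bij]) auto
  ultimately show "dist_det \<Theta> = ?l / (2 * real n - 3) * dist_cof \<Theta>" by simp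
qed

text \<open>
  Listing the three middle vertices before the two end points, consecutive differences interact
  only with their neighbours; the sum of the unit vectors of the two end points is balanced.
\<close>

lemma theta_two_two_two:
  assumes len: "\<And>k. k < 3 \<Longrightarrow> len k = 2"
  shows "dist_cof \<Theta> = -16" "dist_det \<Theta> = dist_cof \<Theta>"
proof -
  have m: "m = 2" using m_attained len by auto
  let ?\<phi> = "\<lambda>a::nat. if a < 3 then pt a 1 else if a = 3 then pt 0 0 else pt 0 2"
  let ?d = "\<lambda>a b::nat. if a = b then 0 else if (a < 3) = (b < 3) then 2 else (1::real)"
  have five: "{..<5::nat} = {0, 1, 2, 3, 4}" by auto
  have three: "a < 3 \<longleftrightarrow> a = 0 \<or> a = 1 \<or> a = 2" "a \<le> 2 \<longleftrightarrow> a = 0 \<or> a = 1 \<or> a = 2" for a :: nat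
    by auto
  have pt: "pt k 0 = Source" "pt k 1 = Inner k 1" "pt k 2 = Sink" if "k < 3" for k
    using len[OF that] by (simp_all add: theta_point_def)
  have "v \<in> pverts \<Theta> \<longleftrightarrow> v \<in> {Inner 0 1, Inner 1 1, Inner 2 1, Source, Sink}" for v
  proof -
    have "v \<in> pverts \<Theta> \<longleftrightarrow> (\<exists>k<3. v = pt k 0 \<or> v = pt k 1 \<or> v = pt k 2)"
      unfolding pverts_theta using len three(2) by metis
    also have "\<dots> \<longleftrightarrow> (\<exists>k<3. v = Source \<or> v = Inner k 1 \<or> v = Sink)"
      using pt by metis
    also have "\<dots> \<longleftrightarrow> v \<in> {Inner 0 1, Inner 1 1, Inner 2 1, Source, Sink}"
      unfolding three by auto
    finally show ?thesis .
  qed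
  then have verts: "pverts \<Theta> = {Inner 0 1, Inner 1 1, Inner 2 1, Source, Sink}" by blast
  have bij: "bij_betw ?\<phi> {..<5} (pverts \<Theta>)"
    unfolding bij_betw_def five verts by (auto simp: len theta_point_def)
  have d: "?d a b = rdist \<Theta> (?\<phi> a) (?\<phi> b)" if "a \<in> {..<5}" "b \<in> {..<5}" for a b
  proof -
    have D: "rdist \<Theta> (pt x u) (pt y w) = real_of_int (path_dist (x = y) 2 2 (int u) 2 (int w))"
      if "x < 3" "y < 3" "u \<le> 2" "w \<le> 2" for x y u w
      using rdist_theta[of x y u w] that len m by simp
    show ?thesis
      using that unfolding five
      by (elim insertE emptyE) (simp_all add: D path_dist_def Let_def)
  qed
  let ?F = "diff_form (\<lambda>a. a - 1) ?d"
  have "dist_cof \<Theta> = idet_cof {..<5} ?d"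
    unfolding dist_cof_def by (rule idet_cof_bij[OF _ bij, symmetric]) (use d in auto)
  also have "\<dots> = idet ({..<5} - {0}) ?F"
    by (rule idet_cof_eq_diff_form[where rk = id]) auto
  also have "{..<5::nat} - {0} = {1, 2, 3, 4}" by auto
  also have "idet {1, 2, 3, 4} ?F = -16"
  proof -
    have "idet {3, 4} ?F = 4"
      using idet_leaf[of "{3, 4}" 3 4 ?F] by (simp add: diff_form_def)
    moreover have "idet {2, 3, 4} ?F = ?F 2 2 * idet ({2, 3, 4} - {2}) ?F
        - ?F 2 3 * ?F 3 2 * idet ({2, 3, 4} - {2, 3}) ?F"
      by (rule idet_leaf) (auto simp: diff_form_def)
    ultimately have "idet {2, 3, 4} ?F = 0" by (simp add: diff_form_def)
    moreover have "idet {1, 2, 3, 4} ?F = ?F 1 1 * idet ({1, 2, 3, 4} - {1}) ?F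
        - ?F 1 2 * ?F 2 1 * idet ({1, 2, 3, 4} - {1, 2}) ?F"
      by (rule idet_leaf) (auto simp: diff_form_def)
    ultimately show ?thesis using \<open>idet {3, 4} ?F = 4\<close> by (simp add: diff_form_def)
  qed
  finally show cof: "dist_cof \<Theta> = -16" .
  have "dist_det \<Theta> = idet {..<5} ?d"
    unfolding dist_det_def by (rule idet_bij[OF _ bij, symmetric]) (use d in auto)
  also have "\<dots> = 2 / 2 * idet_cof {..<5} ?d"
    by (rule idet_balanced_vector[where x = "\<lambda>a. if 3 \<le> a then 1 else 0"]) (auto simp: five)
  also have "idet_cof {..<5} ?d = dist_cof \<Theta>"
    unfolding dist_cof_def by (rule idet_cof_bij[OF _ bij]) (use d in auto)
  finally show "dist_det \<Theta> = dist_cof \<Theta>" by simp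
qed

text \<open>
  The two places of the shorter path have distance \<open>\<delta>\<close> equal to \<open>1\<close> or \<open>2\<close> according to the parity
  of its length, and a distance of \<open>2\<close> requires \<open>m \<ge> 2\<close>.
\<close>

lemma theta_singular_pair:
  assumes jk: "j < 3" "k < 3" "j \<noteq> k" and parity: "even (len j + len k)"
    and "odd (len j) \<or> 2 \<le> m \<and> (len j, len k) \<noteq> (2, 2)"
  shows "dist_det \<Theta> = 0" "dist_cof \<Theta> = 0"
proof -
  have *: "dist_det \<Theta> = 0 \<and> dist_cof \<Theta> = 0"
    if jk: "j < 3" "k < 3" "j \<noteq> k" and parity: "even (len j + len k)" and le: "len j \<le> len k"
      and "odd (len j) \<or> 2 \<le> m \<and> (len j, len k) \<noteq> (2, 2)" for j k
  proof -
    define \<delta> where "\<delta> = (if odd (len j) then 1 else 2 :: nat)"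
    define u where "u = (len j - \<delta>) div 2"
    define h where "h = (len k - len j) div 2"
    have "\<delta> \<le> len j" using len_pos[OF jk(1)] by (auto simp: \<delta>_def elim!: evenE)
    moreover have "even (len j - \<delta>)" using calculation by (auto simp: \<delta>_def)
    then have "len j - \<delta> = 2 * u" by (simp add: u_def)
    ultimately have j: "len j = u + (u + \<delta>)" by linarith
    have "even (len k - len j)" using parity le by simp
    then have k: "len k = u + (u + \<delta>) + 2 * h" using le j by (auto simp: h_def)
    have "\<delta> \<le> m" using that(6) m_pos by (auto simp: \<delta>_def)
    moreover have "0 < u + h"
    proof (rule ccontr)
      assume "\<not> 0 < u + h"
      then have "len j = \<delta>" "len k = \<delta>" using j k by auto
      then show False
        using that(6) simple[OF jk] by (auto simp: \<delta>_def split: if_splits)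
    qed
    ultimately show ?thesis
      using theta_singular[OF jk j k] by (auto simp: \<delta>_def)
  qed
  show "dist_det \<Theta> = 0" "dist_cof \<Theta> = 0"
  proof -
    have "even (len k + len j)" "odd (len j) \<longleftrightarrow> odd (len k)" using parity by auto
    then have "dist_det \<Theta> = 0 \<and> dist_cof \<Theta> = 0"
      using * assms by (cases "len j \<le> len k") auto
    then show "dist_det \<Theta> = 0" "dist_cof \<Theta> = 0" by blast+
  qed
qed

text \<open>
  Unless the graph is singular, no two of the lengths are odd, so two of them are even. If
  \<open>m \<ge> 2\<close>, any two even lengths are \<open>2\<close>; if \<open>m = 1\<close>, the path of length \<open>1\<close> is the only odd one.
\<close>

lemma theta_cases:
  obtains (singular) "dist_det \<Theta> = 0" "dist_cof \<Theta> = 0"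
  | (chord) i j k g h where "i < 3" "j < 3" "k < 3" "i \<noteq> j" "i \<noteq> k" "j \<noteq> k"
      "len i = 1" "len j = 2 * g" "len k = 2 * h"
  | (twin_odd) i j k n where "i < 3" "j < 3" "k < 3" "i \<noteq> j" "i \<noteq> k" "j \<noteq> k"
      "len i = 2" "len j = 2" "len k = 2 * n - 1" "2 \<le> n"
  | (all_two) "\<And>k. k < 3 \<Longrightarrow> len k = 2"
proof (cases "dist_det \<Theta> = 0 \<and> dist_cof \<Theta> = 0")
  case True
  then show ?thesis using singular by blast
next
  case nonzero: False
  have bad: "even (len j) \<and> (m < 2 \<or> len j = 2 \<and> len k = 2)"
    if "j < 3" "k < 3" "j \<noteq> k" "even (len j + len k)" for j k
  proof (rule ccontr)
    assume "\<not> ?thesis"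
    then have "odd (len j) \<or> 2 \<le> m \<and> (len j, len k) \<noteq> (2, 2)" by auto
    then show False using theta_singular_pair[OF that] nonzero by blast
  qed
  have pair: "even (len a) \<or> even (len b)" if "a < 3" "b < 3" "a \<noteq> b" for a b
    using bad[OF that] by auto
  have distinct: "\<exists>i j k. i < 3 \<and> j < 3 \<and> k < 3 \<and> i \<noteq> j \<and> i \<noteq> k \<and> j \<noteq> (k::nat) \<and> even (len i) \<and> even (len j)"
  proof -
    have "even (len 0) \<or> even (len 1)" "even (len 0) \<or> even (len 2)" "even (len 1) \<or> even (len 2)"
      using pair[of 0 1] pair[of 0 2] pair[of 1 2] by simp_all
    then consider "even (len 0)" "even (len 1)" | "even (len 0)" "even (len 2)" | "even (len 1)" "even (len 2)"
      by blast
    then show ?thesis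
    proof cases
      case 1
      then show ?thesis by (intro exI[of _ 0] exI[of _ 1] exI[of _ 2]) auto
    next
      case 2
      then show ?thesis by (intro exI[of _ 0] exI[of _ 2] exI[of _ 1]) auto
    next
      case 3
      then show ?thesis by (intro exI[of _ 1] exI[of _ 2] exI[of _ 0]) auto
    qed
  qed
  then obtain i j k where ijk: "i < 3" "j < 3" "k < 3" "i \<noteq> j" "i \<noteq> k" "j \<noteq> (k::nat)"
    and ev: "even (len i)" "even (len j)" by blast
  have third: "s = i \<or> s = j \<or> s = k" if "s < 3" for s using that ijk by linarith
  show ?thesis
  proof (cases "m < 2")
    case True
    then obtain s where s: "s < 3" "len s = 1" using m_attained m_pos
      by (metis One_nat_def Suc_1 le_antisym less_Suc_eq_le)
    then have "s = k" using third[OF s(1)] ev by auto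
    then show ?thesis
      using chord[of k i j "len i div 2" "len j div 2"] ijk ev s by auto
  next
    case False
    then have two: "len i = 2" "len j = 2" using bad[OF ijk(1,2,4)] ev by auto
    show ?thesis
    proof (cases "even (len k)")
      case True
      then have "len k = 2" using bad[OF ijk(1,3,5)] ev False by auto
      then show ?thesis using all_two two third by metis
    next
      case odd: False
      then obtain n where n: "len k = 2 * n + 1" by (auto elim!: oddE)
      then have "1 \<le> n" using m_le[OF ijk(3)] False by auto
      then show ?thesis using twin_odd[of i j k "n + 1"] ijk two n by auto
    qed
  qed
qed

lemma theta_det_zero_imp_cof_zero:
  assumes "dist_det \<Theta> = 0"
  shows "dist_cof \<Theta> = 0"
proof (cases rule: theta_cases)
  case (chord i j k g h)
  then have "1 \<le> g" using len_pos[OF chord(2)] by simp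
  then show ?thesis using theta_one_even_even[OF chord] assms by simp
next
  case (twin_odd i j k n)
  have "(real n)\<^sup>2 - real n - 1 \<noteq> 0"
  proof -
    have "2 * real n \<le> (real n)\<^sup>2" using twin_odd(10) by (simp add: power2_eq_square)
    then show ?thesis using twin_odd(10) by linarith
  qed
  moreover have "2 * real n - 3 \<noteq> 0" using twin_odd(10) by linarith
  ultimately show ?thesis using theta_two_two_odd(2)[OF twin_odd] assms by simp
next
  case all_two
  then show ?thesis using theta_two_two_two assms by simp
qed

end

section \<open>The formula for the determinant\<close>

lemma theta_lengths:
  assumes "1 \<le> l" "2 \<le> p" "2 \<le> q"
  shows "theta ((!) [l, p, q]) (min l (min p q))"
proof -
  have three: "k < 3 \<longleftrightarrow> k = 0 \<or> k = 1 \<or> k = 2" for k :: nat by auto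
  show ?thesis
  proof
    show "\<exists>k<3. [l, p, q] ! k = min l (min p q)"
      unfolding three by (simp add: ex_disj_distrib conj_disj_distribR min_def)
  qed (use assms in \<open>auto simp: three\<close>)
qed

lemma is_theta_dist:
  assumes "pair_graph B" "is_theta l p q B"
  shows "theta ((!) [l, p, q]) (min l (min p q))"
    and "dist_det B = dist_det (general_theta ((!) [l, p, q]))"
    and "dist_cof B = dist_cof (general_theta ((!) [l, p, q]))"
    and "2 \<le> card (pverts B)"
proof -
  have iso: "digraph_iso (with_proj B) (with_proj (general_theta ((!) [l, p, q])))"
    and lens: "1 \<le> l" "2 \<le> p" "2 \<le> q"
    using assms(2) by (auto simp: is_theta_def theta_graph_eq)
  show \<theta>: "theta ((!) [l, p, q]) (min l (min p q))" by (rule theta_lengths[OF lens])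
  interpret theta "(!) [l, p, q]" "min l (min p q)" by (rule \<theta>)
  note dist = dist_iso[OF assms(1) conn_theta iso]
  show "dist_det B = dist_det \<Theta>" "dist_cof B = dist_cof \<Theta>" by (fact dist)+
  have "{pt 0 0, pt 0 l} \<subseteq> pverts \<Theta>" "pt 0 0 \<noteq> pt 0 l"
    using pt_in_verts[of 0 0] pt_in_verts[of 0 l] pt_eq_iff[of 0 0 0 l] lens by auto
  then have "2 \<le> card (pverts \<Theta>)"
    using card_mono[OF finite_verts, of "{pt 0 0, pt 0 l}"] by simp
  then show "2 \<le> card (pverts B)" using dist(3) by simp
qed

lemma is_cycle_dist:
  assumes "pair_graph B" "is_cycle n B"
  shows "3 \<le> n" "dist_det B = dist_det (cycle_graph n)" "dist_cof B = dist_cof (cycle_graph n)"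
    "card (pverts B) = n"
  using dist_iso[OF assms(1) conn_cycle_graph, of n] assms(2) by (auto simp: is_cycle_def)

lemma singular_theta_block:
  assumes "pair_graph B" "is_singular_theta B"
  shows "dist_det B = 0" "dist_cof B = 0" "2 \<le> card (pverts B)"
proof -
  obtain l p q ws where \<theta>: "is_theta l p q B" "vertex_enum (theta_graph l p q) ws"
    and det: "det (distance_matrix (theta_graph l p q) ws) = 0"
    using assms(2) by (auto simp: is_singular_theta_def)
  note B = is_theta_dist[OF assms(1) \<theta>(1)]
  have "dist_det (general_theta ((!) [l, p, q])) = 0"
    using det det_distance_matrix[OF \<theta>(2)] by (simp add: theta_graph_eq)
  then show "dist_det B = 0" "dist_cof B = 0"
    using B theta.theta_det_zero_imp_cof_zero[OF B(1)] by simp_all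
  show "2 \<le> card (pverts B)" by (rule B(4))
qed

text \<open>
  The pair consists of the cofactor sum and of the ratio of determinant and cofactor sum: the
  former multiply and the latter add up over the blocks.
\<close>

definition has_invariants :: "'a pair_pre_digraph \<Rightarrow> real \<times> real \<Rightarrow> bool" where
  "has_invariants B x \<longleftrightarrow> dist_cof B = fst x \<and> dist_det B = snd x * fst x \<and> fst x \<noteq> 0"

lemma edge_invariants:
  assumes "is_edge B"
  shows "has_invariants B (-2, 1 / 2)"
  using single_edge[OF assms] by (simp add: has_invariants_def)

lemma odd_cycle_invariants:
  assumes "pair_graph B" "is_cycle n B" "odd n"
  shows "has_invariants B (real n, ((real n)\<^sup>2 - 1) / (4 * real n))"
  using is_cycle_dist[OF assms(1,2)] odd_cycle[of n] assms(3) by (simp add: has_invariants_def)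

lemma theta_one_even_even_invariants:
  assumes "pair_graph B" "is_theta 1 p q B" "even p" "even q"
  shows "has_invariants B (- (real p + real q), (real p + real q) / 4)"
proof -
  note B = is_theta_dist[OF assms(1,2)]
  interpret theta "(!) [1, p, q]" "min 1 (min p q)" by (rule B(1))
  obtain g h where gh: "p = 2 * g" "q = 2 * h" using assms(3,4) by (auto elim!: evenE)
  have "2 \<le> p" using assms(2) by (simp add: is_theta_def)
  moreover have "dist_cof \<Theta> = - (2 * real g + 2 * real h)"
    "dist_det \<Theta> = (real g + real h) / 2 * dist_cof \<Theta>"
    by (rule theta_one_even_even[of 0 1 2]; simp add: gh)+
  ultimately show ?thesis
    using B(2,3) gh by (simp add: has_invariants_def) (simp add: field_simps)
qed

lemma theta_two_two_two_invariants:
  assumes "pair_graph B" "is_theta 2 2 2 B"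
  shows "has_invariants B (-16, 1)"
proof -
  note B = is_theta_dist[OF assms]
  interpret theta "(!) [2, 2, 2]" "min 2 (min 2 2)" by (rule B(1))
  have "[2, 2, 2] ! k = (2::nat)" if "k < 3" for k
    using that by (auto simp: less_Suc_eq numeral_3_eq_3)
  then show ?thesis using theta_two_two_two B(2,3) by (simp add: has_invariants_def)
qed

lemma theta_two_two_odd_invariants:
  assumes "pair_graph B" "is_theta 2 2 q B" "odd q"
  shows "has_invariants B (4 * real q - 8, ((real q)\<^sup>2 - 5) / (4 * real q - 8))"
proof -
  note B = is_theta_dist[OF assms(1,2)]
  interpret theta "(!) [2, 2, q]" "min 2 (min 2 q)" by (rule B(1))
  obtain k where k: "q = 2 * k + 1" using assms(3) by (auto elim!: oddE)
  define n where "n = k + 1"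
  have "2 \<le> q" using assms(2) by (simp add: is_theta_def)
  then have n: "q = 2 * n - 1" "2 \<le> n" using k by (auto simp: n_def)
  have "dist_cof \<Theta> = 8 * real n - 12"
    "dist_det \<Theta> = ((real n)\<^sup>2 - real n - 1) / (2 * real n - 3) * dist_cof \<Theta>"
    by (rule theta_two_two_odd[of 0 1 2]; simp add: n)+
  moreover have "real q = 2 * real n - 1" using n by simp
  moreover have "8 * real n - 12 \<noteq> 0" using n by linarith
  moreover have "((2 * real n - 1)\<^sup>2 - 5) / (8 * real n - 12) = ((real n)\<^sup>2 - real n - 1) / (2 * real n - 3)"
  proof -
    have "(2 * real n - 1)\<^sup>2 - 5 = 4 * ((real n)\<^sup>2 - real n - 1)"
      by (simp add: power2_eq_square algebra_simps)
    moreover have "8 * real n - 12 = 4 * (2 * real n - 3)" by simp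
    ultimately show ?thesis by (metis mult_divide_mult_cancel_left_if zero_neq_numeral)
  qed
  ultimately show ?thesis using B(2,3) by (simp add: has_invariants_def)
qed

lemma dist_invariants_prod_sum:
  assumes "conn G" "2 \<le> card (pverts G)" "distinct bs" "set bs = blocks G"
    and "list_all2 has_invariants bs xs"
  shows "dist_cof G = prod_list (map fst xs)"
    and "dist_det G = sum_list (map snd xs) * dist_cof G"
proof -
  have pG: "pair_graph G" using assms(1) by (simp add: conn_def)
  have len: "length bs = length xs" using assms(5) by (rule list_all2_lengthD)
  have nth: "dist_cof (bs ! i) = fst (xs ! i)" "dist_det (bs ! i) = snd (xs ! i) * fst (xs ! i)"
      "fst (xs ! i) \<noteq> 0" if "i < length xs" for i
    using list_all2_nthD2[OF assms(5) that] by (simp_all add: has_invariants_def)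
  have inv: "dist_cof B \<noteq> 0" if "B \<in> blocks G" for B
  proof -
    obtain i where "i < length bs" "bs ! i = B" using \<open>B \<in> blocks G\<close> assms(4) by (metis in_set_conv_nth)
    then show ?thesis using nth[of i] len by simp
  qed
  have cof: "map dist_cof bs = map fst xs"
    by (rule nth_equalityI) (use len nth in auto)
  have ratio: "map (\<lambda>B. dist_det B / dist_cof B) bs = map snd xs"
    by (rule nth_equalityI) (use len nth in auto)
  note G = dist_cof_det_blocks[OF assms(1,2)]
  show "dist_cof G = prod_list (map fst xs)"
    unfolding G(1) cof[symmetric] assms(4)[symmetric]
    by (rule prod.distinct_set_conv_list[OF assms(3)])
  have "dist_det B * (\<Prod>C\<in>blocks G - {B}. dist_cof C) = dist_det B / dist_cof B * dist_cof G"
    if "B \<in> blocks G" for B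
    using inv[OF that] prod.remove[OF finite_blocks[OF pG] that, of dist_cof] G(1) by simp
  then have "dist_det G = (\<Sum>B\<in>blocks G. dist_det B / dist_cof B) * dist_cof G"
    unfolding G(2) sum_distrib_right by (intro sum.cong) auto
  also have "(\<Sum>B\<in>blocks G. dist_det B / dist_cof B) = sum_list (map snd xs)"
    unfolding ratio[symmetric] assms(4)[symmetric]
    by (rule sum.distinct_set_conv_list[OF assms(3)])
  finally show "dist_det G = sum_list (map snd xs) * dist_cof G" .
qed

lemma singular_block_imp_zero:
  assumes "conn G" "2 \<le> card (pverts G)" "B \<in> blocks G" "dist_det B = 0" "dist_cof B = 0"
  shows "dist_det G = 0" "dist_cof G = 0"
proof -
  have fin: "finite (blocks G)" using assms(1) by (simp add: conn_def finite_blocks)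
  show "dist_cof G = 0"
    unfolding dist_cof_det_blocks(1)[OF assms(1,2)]
    using fin assms(3,5) by (auto intro!: prod_zero)
  have "dist_det C * (\<Prod>D\<in>blocks G - {C}. dist_cof D) = 0" if "C \<in> blocks G" for C
    using fin assms(3-5) by (cases "C = B") (auto intro!: prod_zero)
  then show "dist_det G = 0"
    unfolding dist_cof_det_blocks(2)[OF assms(1,2)] by (intro sum.neutral ballI)
qed

text \<open>
  A block with vanishing invariants makes those of the graph vanish. For a single vertex the
  determinant is the entry \<open>0\<close>, and the cofactor sum is \<open>0\<close> by convention.
\<close>

lemma degenerate_imp_zero:
  assumes G: "conn G" and vs: "vertex_enum G vs" and deg: "degenerate G"
  shows "det (distance_matrix G vs) = 0 \<and> cof (distance_matrix G vs) = 0"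
proof (cases "is_K1 G")
  case True
  then obtain v where v: "pverts G = {v}" by (auto simp: is_K1_def)
  have "dist_det G = 0"
    using graph_dist_props(1)[OF G, of v] v by (simp add: dist_det_def)
  moreover have "length vs = 1"
    using vs v distinct_card[of vs] by (simp add: vertex_enum_def)
  ultimately show ?thesis
    using det_distance_matrix[OF vs] by (simp add: cof_def distance_matrix_def)
next
  case False
  have pG: "pair_graph G" using G by (simp add: conn_def)
  obtain B where B: "B \<in> blocks G" "(\<exists>n. even n \<and> is_cycle n B) \<or> is_singular_theta B"
    using deg False by (auto simp: degenerate_def)
  have b: "pair_graph B" "pverts B \<subseteq> pverts G"
    using B(1) blocks_iff[OF pG] by (auto simp: nonseparable_def conn_def subgr_def)
  have inv: "dist_det B = 0 \<and> dist_cof B = 0 \<and> 2 \<le> card (pverts B)"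
    using B(2)
  proof
    assume "\<exists>n. even n \<and> is_cycle n B"
    then obtain n where n: "even n" "is_cycle n B" by blast
    show ?thesis using is_cycle_dist[OF b(1) n(2)] even_cycle[of n] n(1) by auto
  next
    assume "is_singular_theta B"
    then show ?thesis using singular_theta_block[OF b(1)] by blast
  qed
  then have card: "2 \<le> card (pverts G)"
    using card_mono[OF _ b(2)] pG by (auto simp: pair_graph_iff)
  show ?thesis
    using singular_block_imp_zero[OF G card B(1)] inv
      det_distance_matrix[OF vs] cof_distance_matrix[OF vs card] by simp
qed

text \<open>
  The invariants of the blocks, in the order in which \<open>blocks_are\<close> lists the kinds of blocks.
\<close>

definition block_invariants ::
  "nat \<Rightarrow> nat \<Rightarrow> (nat \<Rightarrow> nat) \<Rightarrow> nat \<Rightarrow> (nat \<Rightarrow> nat) \<Rightarrow> (nat \<Rightarrow> nat) \<Rightarrow> nat \<Rightarrow> nat \<Rightarrow>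
    (nat \<Rightarrow> nat) \<Rightarrow> (real \<times> real) list" where
  "block_invariants m c l r p q s t q' =
    replicate m (-2, 1 / 2) @
    map (\<lambda>h. (real (l h), ((real (l h))\<^sup>2 - 1) / (4 * real (l h)))) [1..<Suc c] @
    map (\<lambda>i. (- (real (p i) + real (q i)), (real (p i) + real (q i)) / 4)) [1..<Suc r] @
    replicate s (-16, 1) @
    map (\<lambda>j. (4 * real (q' j) - 8, ((real (q' j))\<^sup>2 - 5) / (4 * real (q' j) - 8))) [1..<Suc t]"

text \<open>
  Each kind of block in the list is paired with its invariants; the list of blocks is then matched
  with the list of invariants through the list of kinds.
\<close>

lemma blocks_are_invariants:
  assumes G: "pair_graph G" and "blocks_are G m c l r p q s t q'"
  obtains bs where "distinct bs" "set bs = blocks G"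
    "list_all2 has_invariants bs (block_invariants m c l r p q s t q')"
proof -
  let ?xs = "block_invariants m c l r p q s t q'"
  let ?kinds = "replicate m is_edge @
         map (\<lambda>h. is_cycle (l h)) [1..<Suc c] @
         map (\<lambda>i. is_theta 1 (p i) (q i)) [1..<Suc r] @
         replicate s (is_theta 2 2 2) @
         map (\<lambda>j. is_theta 2 2 (q' j)) [1..<Suc t]"
  obtain bs where bs: "distinct bs" "set bs = blocks G"
      "list_all2 (\<lambda>B is_kind. is_kind B) bs ?kinds"
    and par: "\<forall>h\<in>{1..c}. odd (l h)" "\<forall>i\<in>{1..r}. even (p i) \<and> even (q i)"
      "\<forall>j\<in>{1..t}. odd (q' j) \<and> 1 < q' j"
    using assms(2) unfolding blocks_are_def by blast
  have pB: "pair_graph B" if "B \<in> set bs" for B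
    using that bs(2) blocks_iff[OF G] by (auto simp: nonseparable_def conn_def)
  let ?R = "\<lambda>is_kind x. \<forall>B. pair_graph B \<longrightarrow> is_kind B \<longrightarrow> has_invariants B x"
  have kinds: "list_all2 ?R ?kinds ?xs"
  proof (unfold block_invariants_def, intro list_all2_appendI)
    show "list_all2 ?R (replicate m is_edge) (replicate m (-2, 1 / 2))"
      using edge_invariants by (auto simp: list_all2_conv_all_nth)
    show "list_all2 ?R (replicate s (is_theta 2 2 2)) (replicate s (-16, 1))"
      using theta_two_two_two_invariants by (auto simp: list_all2_conv_all_nth)
    show "list_all2 ?R (map (\<lambda>i. is_theta 1 (p i) (q i)) [1..<Suc r])
        (map (\<lambda>i. (- (real (p i) + real (q i)), (real (p i) + real (q i)) / 4)) [1..<Suc r])"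
      unfolding list.rel_map
    proof (intro list.rel_refl_strong allI impI)
      fix i B assume "i \<in> set [1..<Suc r]" "pair_graph B" "is_theta 1 (p i) (q i) B"
      moreover from this have "even (p i)" "even (q i)" using par(2) by auto
      ultimately show "has_invariants B (- (real (p i) + real (q i)), (real (p i) + real (q i)) / 4)"
        by (intro theta_one_even_even_invariants)
    qed
  qed (use par in \<open>auto simp: list.rel_map list_all2_same odd_cycle_invariants
      theta_two_two_odd_invariants simp del: upt_Suc\<close>)
  have "list_all2 (\<lambda>B is_kind. pair_graph B \<and> is_kind B) bs ?kinds"
    by (rule list.rel_mono_strong[OF bs(3)]) (use pB in blast)
  then have "list_all2 has_invariants bs ?xs"
    by (rule list_all2_trans[rotated, OF _ kinds]) blast
  then show ?thesis using that bs(1,2) by blast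
qed

theorem theorem5:
  fixes G :: "'a pair_pre_digraph" and vs :: "'a list"
  assumes "pair_graph G"
    and "connected (with_proj G)"
    and "\<forall>B\<in>blocks G. at_most_bicyclic B"
    and "vertex_enum G vs"
  defines "D \<equiv> distance_matrix G vs"
  shows "(degenerate G \<longrightarrow> det D = 0 \<and> cof D = 0) \<and>
    (\<forall>m c r s t (l :: nat \<Rightarrow> nat) (p :: nat \<Rightarrow> nat) (q :: nat \<Rightarrow> nat) (q' :: nat \<Rightarrow> nat).
      \<not> degenerate G \<and> blocks_are G m c l r p q s t q' \<longrightarrow>
        det D =
          (real m / 2 +
           (\<Sum>h=1..c. ((real (l h))\<^sup>2 - 1) / (4 * real (l h))) +
           (\<Sum>i=1..r. (real (p i) + real (q i)) / 4) +
           real s +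
           (\<Sum>j=1..t. ((real (q' j))\<^sup>2 - 5) / (4 * real (q' j) - 8))) * cof D \<and>
        cof D =
          (-2) ^ m * (-1) ^ r * (-16) ^ s *
          (\<Prod>h=1..c. real (l h)) *
          (\<Prod>i=1..r. real (p i) + real (q i)) *
          (\<Prod>j=1..t. 4 * real (q' j) - 8))"
proof (intro conjI allI impI)
  have G: "conn G" using assms(1,2) connected_with_proj_iff by blast
  show "det D = 0" "cof D = 0" if "degenerate G"
    using degenerate_imp_zero[OF G assms(4) that] by (simp_all add: D_def)
  fix m c r s t :: nat and l p q q' :: "nat \<Rightarrow> nat"
  assume *: "\<not> degenerate G \<and> blocks_are G m c l r p q s t q'"
  have card: "2 \<le> card (pverts G)"
  proof (rule ccontr)
    assume "\<not> 2 \<le> card (pverts G)"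
    moreover have "card (pverts G) \<noteq> 0" using G by (auto simp: conn_def pair_graph_iff)
    ultimately have "card (pverts G) = 1" by linarith
    then obtain v where v: "pverts G = {v}" by (auto simp: card_1_singleton_iff)
    then have "parcs G = {}" using assms(1) by (auto simp: pair_graph_iff irrefl_def)
    then have "G = \<lparr>pverts = {v}, parcs = {}\<rparr>" using v by simp
    then show False using * by (auto simp: degenerate_def is_K1_def)
  qed
  obtain bs where bs: "distinct bs" "set bs = blocks G"
    and inv: "list_all2 has_invariants bs (block_invariants m c l r p q s t q')"
    (is "list_all2 _ _ ?xs")
    using * blocks_are_invariants[OF assms(1)] by blast
  note GG = dist_invariants_prod_sum[OF G card bs inv]
  have D: "det D = dist_det G" "cof D = dist_cof G"
    using det_distance_matrix[OF assms(4)] cof_distance_matrix[OF assms(4) card] by (simp_all add: D_def)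
  have sums: "sum_list (map f [1..<Suc n]) = (\<Sum>i=1..n. f i)" for f :: "nat \<Rightarrow> real" and n
    by (simp only: interv_sum_list_conv_sum_set_nat set_upt atLeastLessThanSuc_atLeastAtMost)
  have prods: "prod_list (map f [1..<Suc n]) = (\<Prod>i=1..n. f i)" for f :: "nat \<Rightarrow> real" and n
    using prod.distinct_set_conv_list[of "[1..<Suc n]" f]
    by (simp only: distinct_upt set_upt atLeastLessThanSuc_atLeastAtMost)
  have "sum_list (map snd ?xs) =
          real m / 2 +
           (\<Sum>h=1..c. ((real (l h))\<^sup>2 - 1) / (4 * real (l h))) +
           (\<Sum>i=1..r. (real (p i) + real (q i)) / 4) +
           real s +
           (\<Sum>j=1..t. ((real (q' j))\<^sup>2 - 5) / (4 * real (q' j) - 8))" (is "_ = ?ratio")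
    unfolding block_invariants_def map_append map_map comp_def snd_conv map_replicate sum_list_append sums
    by (simp add: sum_list_replicate)
  then show "det D = ?ratio * cof D"
    using GG(2) unfolding D by simp
  have "(\<Prod>i=1..r. - (real (p i) + real (q i))) = (-1) ^ r * (\<Prod>i=1..r. real (p i) + real (q i))"
    using prod.distrib[of "\<lambda>_. -1" "\<lambda>i. real (p i) + real (q i)" "{1..r}"] by simp
  moreover have "prod_list (map fst ?xs) = (-2) ^ m * (\<Prod>h=1..c. real (l h)) *
      (\<Prod>i=1..r. - (real (p i) + real (q i))) * (-16) ^ s * (\<Prod>j=1..t. 4 * real (q' j) - 8)"
    by (simp only: block_invariants_def map_append map_map map_replicate prod_list.append prod_list_replicate comp_def
        fst_conv prods mult.assoc)
  ultimately show "cof D =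
          (-2) ^ m * (-1) ^ r * (-16) ^ s *
          (\<Prod>h=1..c. real (l h)) *
          (\<Prod>i=1..r. real (p i) + real (q i)) *
          (\<Prod>j=1..t. 4 * real (q' j) - 8)"
    using GG(1) unfolding D by (simp only: ac_simps)
qed

end
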